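(* Consider the LCQ($d$) queueing system of size $n$ described in the context, with $d\ge 1$ fixed, $\lambda<1$ and $q\in(0,1]$. Then every subsequence of $\{n\}$ has a further subsequence along which the process $\mathbf{u}(\cdot)=(\mathbf{u}(t):t\ge 0)$ converges in distribution (in the Skorokhod space $D_U[0,\infty)$) to a differentiable process $\mathbf{v}(\cdot)$ such that $v_0(t)\equiv 1$ and \[\frac{d}{dt}v_k(t)=\lambda(v_{k-1}(t)-v_k(t))-(1-v_{k+1}(t))^d+(1-v_{k}(t))^d,\qquad k=1,2,\dots\]
   Context: System model: there are $n$ queues. Packets arrive to each queue according to independent Poisson processes of rate $\lambda<1$. Packet transmission times are i.i.d. exponential with mean $n^{-1}$. At most one queue transmits at a time. At each scheduling instant each queue is independently "connected" with probability $q\in(0,1]$, independently of queue lengths and of the past; channel states stay fixed during a transmission. The LCQ($d$) policy selects $d$ connected queues uniformly at random, independently, with repetitions allowed, and transmits a packet from a longest selected queue; if all selected queues are empty or no queue is connected, the scheduler idles for an exponential time of mean $n^{-1}$ and then makes a new decision (so scheduling instants form a Poisson process of rate $n$). Let $m_k(t)$ be the number of queues with at least $k$ packets at time $t$ and $u_k(t)=m_k(t)/n$, $k=0,1,2,\dots$; $\mathbf{u}(t)=\{u_k(t)\}_{k\ge 0}$. Let $U$ be the set of sequences $\mathbf{u}=\{u_k\}_{k\ge0}$ with $1=u_0\ge u_1\ge u_2\ge\cdots\ge 0$, with metric $\rho(\mathbf{u},\mathbf{u}')=\sup_{k>0}|u_k-u'_k|/k$ (convergence is coordinatewise; $U$ is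 compact). Equivalently, $\mathbf{u}(\cdot)$ is the Markov process on $U$ jumping from $\mathbf{u}$ to $\mathbf{u}+n^{-1}\mathbf{e}_k$ at rate $n\lambda(u_{k-1}-u_k)$ and to $\mathbf{u}-n^{-1}\mathbf{e}_k$ at rate $n\alpha_n((1-u_{k+1})^d-(1-u_k)^d)$, $k\ge1$, where $\alpha_n=1-(1-q)^n$ and $\mathbf{e}_k$ is the sequence with $1$ in coordinate $k$ and $0$ elsewhere. *)

theory Defs
  imports "HOL-Probability.Probability"
begin

definition U_set :: "(nat \<Rightarrow> real) set" where
  "U_set = {u. u 0 = 1 \<and> (\<forall>k. u (Suc k) \<le> u k) \<and> (\<forall>k. 0 \<le> u k)}"

definition rho :: "(nat \<Rightarrow> real) \<Rightarrow> (nat \<Rightarrow> real) \<Rightarrow> real" where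
  "rho u u' = (SUP k\<in>{1..}. \<bar>u k - u' k\<bar> / real k)"

section \<open>The Skorokhod space D_U[0,oo) with the Skorokhod (J1) metric (Ethier--Kurtz 3.5)\<close>

text \<open>Cadlag paths on [0,oo) with values in U (values at negative times are irrelevant).\<close>
definition D_U :: "(real \<Rightarrow> nat \<Rightarrow> real) set" where
  "D_U = {x. (\<forall>t\<ge>0. x t \<in> U_set)
          \<and> (\<forall>t\<ge>0. \<forall>e>0. \<exists>\<delta>>0. \<forall>s. t \<le> s \<and> s < t + \<delta> \<longrightarrow> rho (x s) (x t) < e)
          \<and> (\<forall>t>0. \<exists>L\<in>U_set. \<forall>e>0. \<exists>\<delta>>0. \<forall>s. 0 \<le> s \<and> t - \<delta> < s \<and> s < t \<longrightarrow> rho (x s) L < e)}"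

definition skor_gamma :: "(real \<Rightarrow> real) \<Rightarrow> real" where
  "skor_gamma l = (SUP p\<in>{(s,t). 0 \<le> t \<and> t < s}. \<bar>ln ((l (fst p) - l (snd p)) / (fst p - snd p))\<bar>)"

definition skor_Lambda :: "(real \<Rightarrow> real) set" where
  "skor_Lambda = {l. strict_mono_on {0..} l \<and> continuous_on {0..} l \<and> l ` {0..} = {0..}
       \<and> bdd_above ((\<lambda>p. \<bar>ln ((l (fst p) - l (snd p)) / (fst p - snd p))\<bar>) ` {(s,t). 0 \<le> t \<and> t < s})}"

definition skor_dist :: "(real \<Rightarrow> nat \<Rightarrow> real) \<Rightarrow> (real \<Rightarrow> nat \<Rightarrow> real) \<Rightarrow> real" where
  "skor_dist x y = (INF l\<in>skor_Lambda. max (skor_gamma l)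
      (LBINT u:{0..}. exp (- u) * min 1 (SUP t\<in>{0..}. rho (x (min t u)) (y (min (l t) u)))))"

definition skor_bcont :: "((real \<Rightarrow> nat \<Rightarrow> real) \<Rightarrow> real) \<Rightarrow> bool" where
  "skor_bcont F \<longleftrightarrow> (\<exists>B. \<forall>x\<in>D_U. \<bar>F x\<bar> \<le> B)
     \<and> (\<forall>x\<in>D_U. \<forall>e>0. \<exists>\<delta>>0. \<forall>y\<in>D_U. skor_dist x y < \<delta> \<longrightarrow> \<bar>F y - F x\<bar> < e)"

definition alpha_n :: "real \<Rightarrow> nat \<Rightarrow> real" where
  "alpha_n q n = 1 - (1 - q) ^ n"

definition S_n :: "nat \<Rightarrow> (nat \<Rightarrow> real) set" where
  "S_n n = {u\<in>U_set. (\<forall>k. \<exists>m::nat. u k = real m / real n) \<and> (\<exists>K. \<forall>k\<ge>K. u k = 0)}"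

definition qrate :: "nat \<Rightarrow> real \<Rightarrow> real \<Rightarrow> nat \<Rightarrow> (nat \<Rightarrow> real) \<Rightarrow> (nat \<Rightarrow> real) \<Rightarrow> real" where
  "qrate n lam q d u v =
     (if \<exists>k\<ge>1. v = u(k := u k + 1 / real n)
      then (let k = (THE k. k \<ge> 1 \<and> v = u(k := u k + 1 / real n))
            in real n * lam * (u (k - 1) - u k))
      else 0)
   + (if \<exists>k\<ge>1. v = u(k := u k - 1 / real n)
      then (let k = (THE k. k \<ge> 1 \<and> v = u(k := u k - 1 / real n))
            in real n * alpha_n q n * ((1 - u (k + 1)) ^ d - (1 - u k) ^ d))
      else 0)"

text \<open>Uniformization constant (bounds the total jump rate).\<close>
definition unif_c :: "nat \<Rightarrow> real \<Rightarrow> real" where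
  "unif_c n lam = real n * (lam + 1)"

definition jumpK :: "nat \<Rightarrow> real \<Rightarrow> real \<Rightarrow> nat \<Rightarrow> (nat \<Rightarrow> real) \<Rightarrow> (nat \<Rightarrow> real) \<Rightarrow> real" where
  "jumpK n lam q d u v =
     (if v = u then 1 - infsum (\<lambda>w. qrate n lam q d u w) (S_n n - {u}) / unif_c n lam
      else qrate n lam q d u v / unif_c n lam)"

fun jumpKpow :: "nat \<Rightarrow> real \<Rightarrow> real \<Rightarrow> nat \<Rightarrow> nat \<Rightarrow> (nat \<Rightarrow> real) \<Rightarrow> (nat \<Rightarrow> real) \<Rightarrow> real" where
  "jumpKpow n lam q d 0 u v = (if u = v then 1 else 0)"
| "jumpKpow n lam q d (Suc j) u v =
     infsum (\<lambda>w. jumpKpow n lam q d j u w * jumpK n lam q d w v) (S_n n)"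

text \<open>Transition function P_t(u,v) = exp(tQ)(u,v), via uniformization.\<close>
definition ptrans :: "nat \<Rightarrow> real \<Rightarrow> real \<Rightarrow> nat \<Rightarrow> real \<Rightarrow> (nat \<Rightarrow> real) \<Rightarrow> (nat \<Rightarrow> real) \<Rightarrow> real" where
  "ptrans n lam q d t u v =
     (\<Sum>j. exp (- unif_c n lam * t) * (unif_c n lam * t) ^ j / fact j * jumpKpow n lam q d j u v)"

definition is_LCQ_process ::
  "nat \<Rightarrow> real \<Rightarrow> real \<Rightarrow> nat \<Rightarrow> 'a measure \<Rightarrow> ('a \<Rightarrow> real \<Rightarrow> nat \<Rightarrow> real) \<Rightarrow> bool" where
  "is_LCQ_process n lam q d M X \<longleftrightarrow>
     prob_space M
   \<and> (\<forall>t k. (\<lambda>\<omega>. X \<omega> t k) \<in> borel_measurable M)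
   \<and> (\<forall>\<omega>\<in>space M. X \<omega> \<in> D_U)
   \<and> measure M {\<omega>\<in>space M. X \<omega> 0 \<in> S_n n} = 1
   \<and> (\<forall>(m::nat) (t::nat \<Rightarrow> real) (x::nat \<Rightarrow> nat \<Rightarrow> real).
        t 0 = 0 \<longrightarrow> (\<forall>i<m. t i \<le> t (Suc i)) \<longrightarrow> (\<forall>i\<le>m. x i \<in> S_n n) \<longrightarrow>
        measure M {\<omega>\<in>space M. \<forall>i\<le>m. X \<omega> (t i) = x i}
          = measure M {\<omega>\<in>space M. X \<omega> 0 = x 0}
            * (\<Prod>i<m. ptrans n lam q d (t (Suc i) - t i) (x i) (x (Suc i))))"

end

theory Submission
  imports Defs "HOL-Real_Asymp.Real_Asymp"
begin

text \<open>
  The drift is Lipschitz for \<open>rho\<close>, so the limiting equation generates a continuous flow on the compact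
  state space, and its only randomness is the initial state. Over a grid of mesh \<open>h\<close> the increments of the
  \<open>k\<close>-th coordinate, minus \<open>h\<close> times the drift, have conditional mean and second moment of order
  \<open>h / n + h\<^sup>2\<close>; a maximal inequality and a discrete Gronwall argument therefore keep the process
  uniformly close to the flow started at its own initial state, first on dyadic grids and then, by right continuity,
  at all times. Consequently the law of the whole path is governed by the law of the initial state. The latter is
  transported to the real line by a Cantor type coding of states, where Helly's theorem provides the convergent
  subsequence, and the limit process is the flow started at the limiting initial law.

  Skorokhod continuous functionals of the process are measurable because step paths with finitely many
  rational values approximate every cadlag path in the Skorokhod metric.
\<close>


section \<open>The state space\<close>

text \<open>The equations never close: coordinate \<open>k\<close> is driven by
  \<open>k + 1\<close>, so no finite block can be estimated by itself. The weight
  \<open>1 / k\<close> in \<open>rho\<close> resolves this twice. A neighbour costs only (k + 1) / k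
  \<le> 2, which makes the drift Lipschitz; and coordinates above \<open>K\<close> weigh less than
  \<open>1 / K\<close>, so that fluctuation estimates for \<open>K\<close> coordinates suffice. The
  initial laws are arbitrary, which is why only subsequences can converge and why the limit is
  random. The definition of the process gives its finite-dimensional laws on the countable set
  \<open>S_n n\<close>, so fluctuations are measured along grids of mesh at most
  \<open>T / n\<close>, on which quadratic errors sum to order \<open>1 / n\<close>. Test
  functionals come with continuity for \<open>skor_dist\<close> but with no \<sigma>-algebra: before
  the limit their measurability has to be deduced, and for the limit law the \<sigma>-algebra is
  chosen to suit. Their continuity, given pointwise, becomes uniform where it matters because the
  trajectories of the flow are parametrized continuously by [0, 1].\<close>

lemma U_set_nonneg: "u \<in> U_set \<Longrightarrow> 0 \<le> u k"
  and U_set_0: "u \<in> U_set \<Longrightarrow> u 0 = 1"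
  and U_set_Suc: "u \<in> U_set \<Longrightarrow> u (Suc k) \<le> u k"
  by (auto simp: U_set_def)

lemma U_set_le_1: "u \<in> U_set \<Longrightarrow> u k \<le> 1"
  by (induction k) (auto simp: U_set_0 intro: order_trans[OF U_set_Suc])

lemma U_setI:
  "u 0 = 1 \<Longrightarrow> (\<And>k. u (Suc k) \<le> u k) \<Longrightarrow> (\<And>k. 0 \<le> u k) \<Longrightarrow> u \<in> U_set"
  by (auto simp: U_set_def)

lemma U_set_dist_le_1:
  assumes "u \<in> U_set" "v \<in> U_set"
  shows "\<bar>u k - v k\<bar> \<le> 1"
  using U_set_nonneg[OF assms(1), of k] U_set_nonneg[OF assms(2), of k]
    U_set_le_1[OF assms(1), of k] U_set_le_1[OF assms(2), of k] by linarith

lemma rho_bdd_above: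
  assumes "u \<in> U_set" "v \<in> U_set"
  shows "bdd_above ((\<lambda>k. \<bar>u k - v k\<bar> / real k) ` {1..})"
proof (rule bdd_aboveI2[where M=1])
  fix k :: nat assume "k \<in> {1..}"
  then show "\<bar>u k - v k\<bar> / real k \<le> 1"
    using U_set_dist_le_1[OF assms, of k] by (auto simp: divide_le_eq)
qed

lemma rho_le_iff:
  assumes "u \<in> U_set" "v \<in> U_set"
  shows "rho u v \<le> D \<longleftrightarrow> (\<forall>k\<ge>1. \<bar>u k - v k\<bar> \<le> real k * D)"
  unfolding rho_def
  by (subst cSUP_le_iff[OF _ rho_bdd_above[OF assms]])
    (auto simp: divide_le_eq mult.commute)

lemma rho_leD:
  assumes "u \<in> U_set" "v \<in> U_set" "rho u v \<le> D"
  shows "\<bar>u k - v k\<bar> \<le> real k * D"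
  using assms rho_le_iff[OF assms(1,2), of D] by (cases "k = 0") (auto simp: U_set_0)

lemma rho_leI:
  assumes "u \<in> U_set" "v \<in> U_set" "\<And>k. k \<ge> 1 \<Longrightarrow> \<bar>u k - v k\<bar> \<le> real k * D"
  shows "rho u v \<le> D"
  using assms rho_le_iff[OF assms(1,2), of D] by blast

lemma rho_bound:
  assumes "u \<in> U_set" "v \<in> U_set"
  shows "\<bar>u k - v k\<bar> \<le> real k * rho u v"
  by (rule rho_leD[OF assms order_refl])

lemma rho_nonneg:
  assumes "u \<in> U_set" "v \<in> U_set"
  shows "0 \<le> rho u v"
  using rho_bound[OF assms, of 1] by simp

lemma rho_commute: "rho u v = rho v u"
  by (simp add: rho_def abs_minus_commute)

lemma rho_refl: "u \<in> U_set \<Longrightarrow> rho u u = 0"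
  using rho_leI[of u u 0] rho_nonneg[of u u] by simp

lemma rho_triangle:
  assumes "u \<in> U_set" "v \<in> U_set" "w \<in> U_set"
  shows "rho u w \<le> rho u v + rho v w"
proof (rule rho_leI[OF assms(1,3)])
  fix k :: nat
  show "\<bar>u k - w k\<bar> \<le> real k * (rho u v + rho v w)"
    using rho_bound[OF assms(1,2), of k] rho_bound[OF assms(2,3), of k]
    by (simp add: algebra_simps)
qed

text \<open>Coordinates beyond \<open>K\<close> differ by at most 1 and have weight below
  \<open>1 / K\<close>, so closeness in \<open>rho\<close> is a matter of finitely many
  coordinates.\<close>

lemma rho_le_of_coordinates:
  assumes "u \<in> U_set" "v \<in> U_set" "K > 0" "D \<ge> 0"
    and "\<And>k. 1 \<le> k \<Longrightarrow> k \<le> K \<Longrightarrow> \<bar>u k - v k\<bar> \<le> real k * D"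
  shows "rho u v \<le> max D (1 / real K)"
proof (rule rho_leI[OF assms(1,2)])
  fix k :: nat assume k: "k \<ge> 1"
  show "\<bar>u k - v k\<bar> \<le> real k * max D (1 / real K)"
  proof (cases "k \<le> K")
    case True
    then show ?thesis using assms(5)[OF k True]
      by (meson max.cobounded1 mult_left_mono of_nat_0_le_iff order_trans)
  next
    case False
    have "\<bar>u k - v k\<bar> \<le> 1" by (rule U_set_dist_le_1[OF assms(1,2)])
    also have "1 \<le> real k * (1 / real K)" using False assms(3) by simp
    also have "\<dots> \<le> real k * max D (1 / real K)" by (intro mult_left_mono) auto
    finally show ?thesis .
  qed
qed

section \<open>The drift\<close>

text \<open>\<open>a\<close> is \<open>alpha_n q n\<close> for the chain of size \<open>n\<close>
  and 1 for the limit. Only \<open>k \<ge> 1\<close> is meaningful: at \<open>k = 0\<close> natural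
  subtraction turns \<open>k - 1\<close> into 0.\<close>

definition lcq_drift :: "real \<Rightarrow> nat \<Rightarrow> real \<Rightarrow> (nat \<Rightarrow> real) \<Rightarrow> nat \<Rightarrow> real" where
  "lcq_drift lam d a u k = lam * (u (k - 1) - u k) - a * ((1 - u (k + 1)) ^ d - (1 - u k) ^ d)"

lemma one_minus_power_lipschitz:
  fixes x y :: real
  assumes "0 \<le> x" "x \<le> 1" "0 \<le> y" "y \<le> 1"
  shows "\<bar>(1 - x) ^ d - (1 - y) ^ d\<bar> \<le> real d * \<bar>x - y\<bar>"
  using norm_power_diff[of "1 - x" "1 - y" d] assms by (simp add: abs_minus_commute)

lemma one_minus_power_diff_nonneg:
  assumes "u \<in> U_set"
  shows "0 \<le> (1 - u (Suc k)) ^ d - (1 - u k) ^ d"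
  using power_mono[of "1 - u k" "1 - u (Suc k)" d] U_set_Suc[OF assms, of k] U_set_le_1[OF assms, of k]
  by simp

text \<open>Kept in terms of the three coordinates involved, so that both the unweighted and the
  weighted Lipschitz bound can be read off.\<close>

lemma lcq_drift_diff:
  assumes "0 \<le> lam" "0 \<le> a" "a \<le> 1" and u: "u \<in> U_set" and v: "v \<in> U_set"
  shows "\<bar>lcq_drift lam d a u k - lcq_drift lam d a v k\<bar>
    \<le> lam * (\<bar>u (k - 1) - v (k - 1)\<bar> + \<bar>u k - v k\<bar>)
      + real d * (\<bar>u (k + 1) - v (k + 1)\<bar> + \<bar>u k - v k\<bar>)"
proof -
  note bnds = U_set_nonneg[OF u] U_set_nonneg[OF v] U_set_le_1[OF u] U_set_le_1[OF v]
  have "lcq_drift lam d a u k - lcq_drift lam d a v k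
      = lam * ((u (k - 1) - v (k - 1)) - (u k - v k))
        - a * (((1 - u (k + 1)) ^ d - (1 - v (k + 1)) ^ d) - ((1 - u k) ^ d - (1 - v k) ^ d))"
    (is "_ = lam * ?A - a * (?B - ?C)")
    by (simp add: lcq_drift_def algebra_simps)
  then have "\<bar>lcq_drift lam d a u k - lcq_drift lam d a v k\<bar> \<le> \<bar>lam * ?A\<bar> + \<bar>a * (?B - ?C)\<bar>"
    by (simp only: abs_triangle_ineq4)
  also have "\<dots> \<le> lam * (\<bar>u (k - 1) - v (k - 1)\<bar> + \<bar>u k - v k\<bar>)
      + real d * (\<bar>u (k + 1) - v (k + 1)\<bar> + \<bar>u k - v k\<bar>)"
  proof (rule add_mono)
    show "\<bar>lam * ?A\<bar> \<le> lam * (\<bar>u (k - 1) - v (k - 1)\<bar> + \<bar>u k - v k\<bar>)"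
      using assms(1) by (simp add: abs_mult mult_left_mono)
    have "\<bar>a * (?B - ?C)\<bar> \<le> 1 * \<bar>?B - ?C\<bar>"
      unfolding abs_mult using assms by (intro mult_right_mono) auto
    also have "\<dots> \<le> \<bar>?B\<bar> + \<bar>?C\<bar>" using abs_triangle_ineq4 by simp
    also have "\<dots> \<le> real d * \<bar>u (k + 1) - v (k + 1)\<bar> + real d * \<bar>u k - v k\<bar>"
      by (intro add_mono one_minus_power_lipschitz) (auto simp: bnds)
    finally show "\<bar>a * (?B - ?C)\<bar> \<le> real d * (\<bar>u (k + 1) - v (k + 1)\<bar> + \<bar>u k - v k\<bar>)"
      by (simp add: distrib_left)
  qed
  finally show ?thesis .
qed

text \<open>The unweighted version serves short spans, over which all coordinates move by the same
  small amount: between two grid times of the flow, or over a few jumps of size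
  \<open>1 / n\<close>.\<close>

lemma lcq_drift_lipschitz_sup:
  assumes "0 \<le> lam" "lam \<le> 1" "0 \<le> a" "a \<le> 1" "u \<in> U_set" "v \<in> U_set"
    and "\<And>k. \<bar>u k - v k\<bar> \<le> D"
  shows "\<bar>lcq_drift lam d a u k - lcq_drift lam d a v k\<bar> \<le> (2 + 2 * real d) * D"
proof -
  have D: "0 \<le> D" using assms(7)[of 0] by linarith
  have "\<bar>lcq_drift lam d a u k - lcq_drift lam d a v k\<bar> \<le> lam * (D + D) + real d * (D + D)"
    by (rule order_trans[OF lcq_drift_diff[OF assms(1,3-6)]], intro add_mono mult_left_mono assms) auto
  also have "\<dots> \<le> 1 * (D + D) + real d * (D + D)"
    using assms(2) D by (intro add_mono mult_right_mono) auto
  finally show ?thesis by (simp add: algebra_simps)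
qed

text \<open>Here the weight pays off: \<open>k + 1 \<le> 2 * k\<close> for \<open>k \<ge> 1\<close>,
  so in the departure term the right neighbour contributes \<open>2 * d\<close> and the coordinate
  itself \<open>d\<close>, next to 2 from the arrivals.\<close>

lemma lcq_drift_lipschitz:
  assumes "0 \<le> lam" "lam \<le> 1" "0 \<le> a" "a \<le> 1" "u \<in> U_set" "v \<in> U_set" "k \<ge> 1" "0 \<le> D"
    and D: "\<And>k. \<bar>u k - v k\<bar> \<le> real k * D"
  shows "\<bar>lcq_drift lam d a u k - lcq_drift lam d a v k\<bar> \<le> real k * ((2 + 3 * real d) * D)"
proof -
  have "real (k - 1) * D \<le> real k * D" using assms by (intro mult_right_mono) auto
  then have a: "\<bar>u (k - 1) - v (k - 1)\<bar> \<le> real k * D" using D[of "k - 1"] by linarith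
  have "real (k + 1) * D \<le> 2 * real k * D" using assms by (intro mult_right_mono) auto
  then have b: "\<bar>u (k + 1) - v (k + 1)\<bar> \<le> 2 * (real k * D)" using D[of "k + 1"] by linarith
  have "\<bar>lcq_drift lam d a u k - lcq_drift lam d a v k\<bar>
     \<le> lam * (real k * D + real k * D) + real d * (2 * (real k * D) + real k * D)"
    by (rule order_trans[OF lcq_drift_diff[OF assms(1,3-6)]], intro add_mono mult_left_mono a b D assms) auto
  also have "\<dots> \<le> 1 * (real k * D + real k * D) + real d * (2 * (real k * D) + real k * D)"
    using assms by (intro add_mono mult_right_mono) auto
  finally show ?thesis by (simp add: algebra_simps)
qed

lemma lcq_drift_bound:
  assumes "0 \<le> lam" "lam \<le> 1" "0 \<le> a" "a \<le> 1" "u \<in> U_set" "k \<ge> 1"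
  shows "\<bar>lcq_drift lam d a u k\<bar> \<le> 2"
proof -
  obtain j where k: "k = Suc j" using assms(6) by (cases k) auto
  have p: "0 \<le> u j - u k" "u j - u k \<le> 1"
    using U_set_Suc[OF assms(5), of j] U_set_le_1[OF assms(5), of j] U_set_nonneg[OF assms(5), of k] k
    by auto
  have "lam * (u j - u k) \<le> 1" "0 \<le> lam * (u j - u k)"
    using p assms mult_mono[of lam 1 "u j - u k" 1] by auto
  moreover have s: "0 \<le> (1 - u (k + 1)) ^ d - (1 - u k) ^ d"
    using one_minus_power_diff_nonneg[OF assms(5)] by simp
  have s1: "(1 - u (k + 1)) ^ d \<le> 1" "0 \<le> (1 - u k) ^ d"
    using U_set_le_1[OF assms(5)] U_set_nonneg[OF assms(5)] by (auto intro!: power_le_one)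
  have "a * ((1 - u (k + 1)) ^ d - (1 - u k) ^ d) \<le> 1 * 1"
    using s s1 assms(3,4) by (intro mult_mono) auto
  moreover have "0 \<le> a * ((1 - u (k + 1)) ^ d - (1 - u k) ^ d)"
    using s assms by auto
  ultimately show ?thesis unfolding lcq_drift_def k by auto
qed

text \<open>With \<open>a = alpha_n q n\<close> the right side is \<open>(1 - q) ^ n\<close>, the
  probability that no queue is connected.\<close>

lemma lcq_drift_alpha:
  assumes "0 \<le> a" "a \<le> 1" "u \<in> U_set"
  shows "\<bar>lcq_drift lam d a u k - lcq_drift lam d 1 u k\<bar> \<le> 1 - a"
proof -
  have s: "0 \<le> (1 - u (k + 1)) ^ d - (1 - u k) ^ d"
    using one_minus_power_diff_nonneg[OF assms(3)] by simp
  have s1: "(1 - u (k + 1)) ^ d \<le> 1" "0 \<le> (1 - u k) ^ d"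
    using U_set_le_1[OF assms(3)] U_set_nonneg[OF assms(3)] by (auto intro!: power_le_one)
  have "lcq_drift lam d a u k - lcq_drift lam d 1 u k = (1 - a) * ((1 - u (k + 1)) ^ d - (1 - u k) ^ d)"
    by (simp add: lcq_drift_def algebra_simps)
  moreover have "\<bar>\<dots>\<bar> \<le> (1 - a) * 1"
    unfolding abs_mult using s s1 assms by (intro mult_mono) auto
  ultimately show ?thesis by simp
qed

section \<open>The flow of the limiting equation\<close>

locale lcq_flow =
  fixes lam :: real and d :: nat
  assumes lam_pos: "0 < lam" and lam_less_1: "lam < 1"
begin

text \<open>\<open>c\<close> is large enough for \<open>u + drift / c\<close> to be a state again,
  \<open>L\<close> is the constant of \<open>lcq_drift_lipschitz\<close>, and \<open>A\<close>
  solves \<open>c + A = 2 * (c + L)\<close>, so that a Picard step halves distances in the norm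
  weighted by \<open>exp (- A * t)\<close>.\<close>

definition c :: real where "c = 1 + real d"
definition L :: real where "L = 2 + 3 * real d"
definition A :: real where "A = c + 2 * L"

lemma c_pos: "c > 0" and L_pos: "L > 0" and A_pos: "A > 0"
  by (auto simp: c_def L_def A_def)

text \<open>Adding a large multiple of the identity to the drift gives a self-map of the convex set of states,
  so that the Picard iteration for the integrating factor \<open>exp (c t)\<close> stays in the state space.\<close>

definition step_map :: "(nat \<Rightarrow> real) \<Rightarrow> nat \<Rightarrow> real" where
  "step_map u k = (if k = 0 then 1 else u k + lcq_drift lam d 1 u k / c)"

text \<open>Two effects could break the order of neighbouring coordinates: arrivals raising
  \<open>k + 1\<close> and departures lowering \<open>k\<close>. Both are controlled by the same gap
  \<open>u k - u (k + 1)\<close>, at most 1 times and \<open>d\<close> times, together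
  \<open>c\<close> times that gap.\<close>

lemma step_map_U:
  assumes u: "u \<in> U_set"
  shows "step_map u \<in> U_set"
proof -
  define w where "w k = (1 - u (Suc k)) ^ d - (1 - u k) ^ d" for k
  have w0: "0 \<le> w k" for k unfolding w_def by (rule one_minus_power_diff_nonneg[OF u])
  have w1: "w k \<le> real d * (u k - u (Suc k))" for k
    using one_minus_power_lipschitz[of "u (Suc k)" "u k" d] U_set_nonneg[OF u] U_set_le_1[OF u]
      U_set_Suc[OF u, of k] w0[of k] unfolding w_def by auto
  have S: "step_map u (Suc k) = u (Suc k) + (lam * (u k - u (Suc k)) - w (Suc k)) / c" for k
    by (simp add: step_map_def lcq_drift_def w_def)
  have cpos: "c > 0" by (rule c_pos)
  have lamu: "lam * (u k - u (Suc k)) \<le> 1 * (u k - u (Suc k))" for k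
    using lam_less_1 U_set_Suc[OF u, of k] by (intro mult_right_mono) auto
  have nn: "0 \<le> step_map u (Suc k)" for k
  proof -
    have "w (Suc k) \<le> real d * u (Suc k)"
      using w1[of "Suc k"] U_set_nonneg[OF u, of "Suc (Suc k)"] 
      by (smt (verit, best) mult_left_mono of_nat_0_le_iff)
    moreover have "real d * u (Suc k) \<le> c * u (Suc k)" 
      using U_set_nonneg[OF u] by (intro mult_right_mono) (auto simp: c_def)
    moreover have "0 \<le> lam * (u k - u (Suc k))" using lam_pos U_set_Suc[OF u, of k] by simp
    ultimately have "0 \<le> c * u (Suc k) + (lam * (u k - u (Suc k)) - w (Suc k))" by linarith
    then show ?thesis unfolding S using cpos by (simp add: field_simps)
  qed
  have mono: "step_map u (Suc (Suc k)) \<le> step_map u (Suc k)" for k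
  proof -
    have "0 \<le> lam * (u k - u (Suc k))" using lam_pos U_set_Suc[OF u, of k] by simp
    then have "lam * (u (Suc k) - u (Suc (Suc k))) - w (Suc (Suc k)) - (lam * (u k - u (Suc k)) - w (Suc k))
       \<le> c * (u (Suc k) - u (Suc (Suc k)))" (is "?a \<le> _")
      using lamu[of "Suc k"] w1[of "Suc k"] w0[of "Suc (Suc k)"] by (simp add: c_def algebra_simps)
    then have "?a / c \<le> u (Suc k) - u (Suc (Suc k))" using cpos by (simp add: pos_divide_le_eq mult.commute)
    moreover have "y + a \<le> x + b" if "a - b \<le> x - y" for a b x y :: real using that by linarith
    ultimately show ?thesis unfolding S diff_divide_distrib[of "lam * _ - _"] by blast
  qed
  have mono0: "step_map u (Suc 0) \<le> 1"
  proof -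
    have "lam * (u 0 - u (Suc 0)) - w (Suc 0) \<le> u 0 - u (Suc 0)"
      using lamu[of 0] w0[of "Suc 0"] by argo
    also have "\<dots> \<le> c * (u 0 - u (Suc 0))" using U_set_Suc[OF u, of 0] by (simp add: c_def distrib_right mult_left_mono)
    finally show ?thesis unfolding S using cpos U_set_0[OF u] by (simp add: field_simps)
  qed
  show ?thesis
  proof (rule U_setI)
    show "step_map u 0 = 1" by (simp add: step_map_def)
    show "step_map u (Suc k) \<le> step_map u k" for k
      by (cases k) (use mono mono0 in \<open>auto simp: step_map_def\<close>)
    show "0 \<le> step_map u k" for k by (cases k) (use nn in \<open>auto simp: step_map_def\<close>)
  qed
qed

lemma step_map_lipschitz:
  assumes "u \<in> U_set" "v \<in> U_set" "0 \<le> D" and D: "\<And>k. \<bar>u k - v k\<bar> \<le> real k * D"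
  shows "c * \<bar>step_map u k - step_map v k\<bar> \<le> real k * ((c + L) * D)"
proof (cases "k = 0")
  case False
  have "c * \<bar>step_map u k - step_map v k\<bar> = \<bar>c * (step_map u k - step_map v k)\<bar>"
    using c_pos by (simp add: abs_mult)
  also have "c * (step_map u k - step_map v k)
      = c * (u k - v k) + (lcq_drift lam d 1 u k - lcq_drift lam d 1 v k)"
    using False c_pos by (simp add: step_map_def field_simps)
  also have "\<bar>\<dots>\<bar> \<le> c * (real k * D) + real k * (L * D)"
  proof (rule order_trans[OF abs_triangle_ineq add_mono])
    show "\<bar>c * (u k - v k)\<bar> \<le> c * (real k * D)"
      unfolding abs_mult using D[of k] c_pos by (intro mult_mono) auto
    show "\<bar>lcq_drift lam d 1 u k - lcq_drift lam d 1 v k\<bar> \<le> real k * (L * D)"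
      unfolding L_def by (rule lcq_drift_lipschitz) (use assms lam_pos lam_less_1 False in auto)
  qed
  finally show ?thesis by (simp add: algebra_simps)
qed (simp add: step_map_def)

text \<open>Variation of constants for \<open>v' = - c * v + c * step_map v\<close>, which is the
  limiting equation rewritten. The weight \<open>exp (- c * t)\<close> and the density
  \<open>c * exp (- c * (t - s))\<close> on [0, t] have total mass 1, so each iterate averages
  states and stays in the convex set \<open>U_set\<close>.\<close>

primrec picard :: "nat \<Rightarrow> (nat \<Rightarrow> real) \<Rightarrow> real \<Rightarrow> nat \<Rightarrow> real" where
  "picard 0 u t k = u k"
| "picard (Suc m) u t k
    = exp (- c * t) * (u k + integral {0..t} (\<lambda>s. c * exp (c * s) * step_map (picard m u s) k))"

end

section \<open>Integrals on a half line with exponential weights\<close>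

lemma integral_has_real_derivative_atLeast:
  fixes f :: "real \<Rightarrow> real"
  assumes "continuous_on {a..} f" "a \<le> t"
  shows "((\<lambda>x. integral {a..x} f) has_real_derivative f t) (at t within {a..})"
proof -
  have "((\<lambda>x. integral {a..x} f) has_real_derivative f t) (at t within {a..t+1})"
    by (rule integral_has_real_derivative) (use assms in \<open>auto intro: continuous_on_subset\<close>)
  moreover have "at t within {a..t+1} = at t within {a..}"
    by (rule at_within_nhd[of _ "{..<t+1}"]) auto
  ultimately show ?thesis by simp
qed

lemma integral_exp_scaled:
  fixes b :: real
  assumes "b > 0" "t \<ge> 0"
  shows "((\<lambda>s. b * exp (b * s)) has_integral (exp (b * t) - 1)) {0..t}"
proof -
  have "((\<lambda>s. b * exp (b * s)) has_integral (exp (b * t) - exp (b * 0))) {0..t}"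
    by (rule fundamental_theorem_of_calculus)
      (use assms in \<open>auto intro!: derivative_eq_intros simp: has_real_derivative_iff_has_vector_derivative[symmetric]\<close>)
  then show ?thesis by simp
qed

lemma integral_diff_exp_bound:
  fixes f g :: "real \<Rightarrow> real"
  assumes "continuous_on {0..} f" "continuous_on {0..} g" "b > 0" "t \<ge> 0"
    and "\<And>s. 0 \<le> s \<Longrightarrow> \<bar>f s - g s\<bar> \<le> B * exp (b * s)"
  shows "\<bar>integral {0..t} f - integral {0..t} g\<bar> \<le> B * ((exp (b * t) - 1) / b)"
proof -
  have f: "f integrable_on {0..t}" "g integrable_on {0..t}"
    using assms by (auto intro!: integrable_continuous_real intro: continuous_on_subset)
  have e: "((\<lambda>s. (B / b) * (b * exp (b * s))) has_integral (B / b) * (exp (b * t) - 1)) {0..t}"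
    by (rule has_integral_mult_right[OF integral_exp_scaled]) (use assms in auto)
  have "\<bar>integral {0..t} (\<lambda>s. f s - g s)\<bar> \<le> integral {0..t} (\<lambda>s. (B / b) * (b * exp (b * s)))"
    unfolding real_norm_def[symmetric]
    by (rule integral_norm_bound_integral) (use f e assms in \<open>auto intro: integrable_diff\<close>)
  then show ?thesis using integral_unique[OF e] integral_diff[OF f] by simp
qed

section \<open>Convergence of the Picard iterates\<close>

context lcq_flow
begin

lemma picard_continuous: "continuous_on {0..} (\<lambda>t. picard m u t k)"
proof (induction m arbitrary: k)
  case (Suc m)
  have "continuous_on {0..} (\<lambda>s. c * exp (c * s) * step_map (picard m u s) k)"
    by (cases "k = 0")
      (use c_pos in \<open>auto simp: step_map_def lcq_drift_def intro!: continuous_intros Suc.IH\<close>)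
  from integral_has_real_derivative_atLeast[OF this]
  have "continuous_on {0..} (\<lambda>t. integral {0..t} (\<lambda>s. c * exp (c * s) * step_map (picard m u s) k))"
    by (auto simp: continuous_on_eq_continuous_within intro: DERIV_continuous)
  then show ?case by (auto intro!: continuous_intros)
qed simp

lemma picard_integrand_continuous:
  "continuous_on {0..} (\<lambda>s. c * exp (c * s) * step_map (picard m u s) k)"
  by (cases "k = 0")
    (use c_pos in \<open>auto simp: step_map_def lcq_drift_def intro!: continuous_intros picard_continuous\<close>)

lemma picard_integrand_integrable:
  "(\<lambda>s. c * exp (c * s) * step_map (picard m u s) k) integrable_on {0..t}"
  by (rule integrable_continuous_real) (auto intro: continuous_on_subset[OF picard_integrand_continuous])

lemma picard_U:
  assumes u: "u \<in> U_set" and "t \<ge> 0"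
  shows "picard m u t \<in> U_set"
  using assms(2)
proof (induction m arbitrary: t)
  case (Suc m)
  note int = picard_integrand_integrable[of m u _ t]
  have sm: "step_map (picard m u s) \<in> U_set" if "s \<in> {0..t}" for s
    using step_map_U Suc.IH[of s] that by auto
  show ?case
  proof (rule U_setI)
    have "integral {0..t} (\<lambda>s. c * exp (c * s) * step_map (picard m u s) 0)
        = integral {0..t} (\<lambda>s. c * exp (c * s))" by (simp add: step_map_def)
    also have "\<dots> = exp (c * t) - 1" by (rule integral_unique[OF integral_exp_scaled]) (use Suc c_pos in auto)
    finally show "picard (Suc m) u t 0 = 1"
      using U_set_0[OF u] by (simp add: exp_minus)
    show "picard (Suc m) u t (Suc k) \<le> picard (Suc m) u t k" for k
      unfolding picard.simps
      by (intro mult_left_mono add_mono integral_le int U_set_Suc[OF u] U_set_Suc[OF sm]) (use c_pos in auto)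
    show "0 \<le> picard (Suc m) u t k" for k
      unfolding picard.simps
      by (intro mult_nonneg_nonneg add_nonneg_nonneg integral_nonneg int U_set_nonneg[OF u] U_set_nonneg[OF sm]) (use c_pos in auto)
  qed
qed (simp add: u[unfolded U_set_def, simplified] U_set_def)

text \<open>One Picard step in the norm weighted by \<open>exp (- a * t)\<close>: a bound
  \<open>B\<close> turns into \<open>B * (c + L) / (c + a)\<close>. The rate is left open because it
  is used twice: \<open>L\<close> makes the factor 1 and gives stability in the starting point,
  uniformly in \<open>m\<close>; \<open>A\<close> makes it 1/2 and gives convergence.\<close>

lemma picard_diff_step:
  assumes "\<And>s. s \<ge> 0 \<Longrightarrow> picard m u s \<in> U_set" "\<And>s. s \<ge> 0 \<Longrightarrow> picard m' v s \<in> U_set"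
    and "a \<ge> 0" "B \<ge> 0" "t \<ge> 0"
    and D: "\<And>s k. s \<ge> 0 \<Longrightarrow> \<bar>picard m u s k - picard m' v s k\<bar> \<le> real k * (B * exp (a * s))"
    and uv: "\<bar>u k - v k\<bar> \<le> real k * D"
  shows "\<bar>picard (Suc m) u t k - picard (Suc m') v t k\<bar>
      \<le> real k * (exp (- c * t) * (D + B * (c + L) / (c + a) * (exp ((c + a) * t) - 1)))"
proof -
  let ?I = "\<lambda>m u. integral {0..t} (\<lambda>s. c * exp (c * s) * step_map (picard m u s) k)"
  have "\<bar>c * exp (c * s) * step_map (picard m u s) k - c * exp (c * s) * step_map (picard m' v s) k\<bar>
     \<le> (real k * ((c + L) * B)) * exp ((c + a) * s)" if "s \<ge> 0" for s
  proof -
    have "\<bar>c * exp (c * s) * step_map (picard m u s) k - c * exp (c * s) * step_map (picard m' v s) k\<bar>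
      = exp (c * s) * (c * \<bar>step_map (picard m u s) k - step_map (picard m' v s) k\<bar>)"
      using c_pos by (simp add: abs_mult flip: right_diff_distrib)
    also have "\<dots> \<le> exp (c * s) * (real k * ((c + L) * (B * exp (a * s))))"
      by (intro mult_left_mono step_map_lipschitz assms that D) (use assms in auto)
    also have "\<dots> = (real k * ((c + L) * B)) * exp ((c + a) * s)"
      by (simp add: distrib_right[of c a] exp_add)
    finally show ?thesis .
  qed
  then have I: "\<bar>?I m u - ?I m' v\<bar> \<le> (real k * ((c + L) * B)) * ((exp ((c + a) * t) - 1) / (c + a))"
    by (intro integral_diff_exp_bound picard_integrand_continuous) (use assms c_pos in auto)
  have "\<bar>picard (Suc m) u t k - picard (Suc m') v t k\<bar> = exp (- c * t) * \<bar>(u k - v k) + (?I m u - ?I m' v)\<bar>"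
    unfolding picard.simps right_diff_distrib[symmetric] abs_mult by (simp add: algebra_simps)
  also have "\<dots> \<le> exp (- c * t) * (real k * D + (real k * ((c + L) * B)) * ((exp ((c + a) * t) - 1) / (c + a)))"
    using I uv by (intro mult_left_mono) auto
  also have "\<dots> = real k * (exp (- c * t) * (D + B * (c + L) / (c + a) * (exp ((c + a) * t) - 1)))"
    by (simp add: algebra_simps)
  finally show ?thesis .
qed

lemma picard_lipschitz:
  assumes u: "u \<in> U_set" and v: "v \<in> U_set" and "D \<ge> 0" and D: "\<And>k. \<bar>u k - v k\<bar> \<le> real k * D"
    and "t \<ge> 0"
  shows "\<bar>picard m u t k - picard m v t k\<bar> \<le> real k * (D * exp (L * t))"
  using \<open>t \<ge> 0\<close>
proof (induction m arbitrary: t k)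
  case 0
  have "D * 1 \<le> D * exp (L * t)" using 0 assms L_pos by (intro mult_left_mono) auto
  then have "real k * D \<le> real k * (D * exp (L * t))" by (intro mult_left_mono) auto
  with D[of k] show ?case by simp
next
  case (Suc m)
  have cL: "c + L > 0" using c_pos L_pos by simp
  have "\<bar>picard (Suc m) u t k - picard (Suc m) v t k\<bar>
    \<le> real k * (exp (- c * t) * (D + D * (c + L) / (c + L) * (exp ((c + L) * t) - 1)))"
    by (rule picard_diff_step) (use Suc assms picard_U D L_pos in auto)
  also have "D * (c + L) / (c + L) = D" using cL by auto
  also have "exp (- c * t) * (D + D * (exp ((c + L) * t) - 1)) = D * exp (L * t)"
    by (simp add: distrib_right[of c L] right_diff_distrib exp_add exp_minus)
  finally show ?case .
qed

lemma picard_cauchy: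
  assumes u: "u \<in> U_set" and "t \<ge> 0"
  shows "\<bar>picard (Suc m) u t k - picard m u t k\<bar> \<le> real k * ((1/2) ^ m * exp (A * t))"
  using \<open>t \<ge> 0\<close>
proof (induction m arbitrary: t k)
  case 0
  show ?case
  proof (cases "k = 0")
    case True
    then show ?thesis using U_set_0[OF picard_U[OF u 0]] by (simp del: picard.simps)
  next
    case False
    have "\<bar>picard (Suc 0) u t k - picard 0 u t k\<bar> \<le> 1"
      by (rule U_set_dist_le_1[OF picard_U[OF u 0] picard_U[OF u 0]])
    also have "1 \<le> exp (A * t)" using 0 A_pos by simp
    also have "\<dots> \<le> real k * exp (A * t)" using False by simp
    finally show ?thesis by simp
  qed
next
  case (Suc m)
  have "\<bar>picard (Suc (Suc m)) u t k - picard (Suc m) u t k\<bar>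
    \<le> real k * (exp (- c * t) * (0 + (1/2) ^ m * (c + L) / (c + A) * (exp ((c + A) * t) - 1)))"
    by (rule picard_diff_step) (use Suc assms picard_U A_pos in \<open>auto simp del: picard.simps\<close>)
  \<comment> \<open>\<open>A\<close> was chosen for this quotient to be 1/2.\<close>
  also have "(1/2) ^ m * (c + L) / (c + A) = (1/2) ^ m * ((c + L) / (2 * (c + L)))"
    by (simp add: A_def)
  also have "(c + L) / (2 * (c + L)) = 1 / 2" using c_pos L_pos by (intro nonzero_divide_mult_cancel_right) auto
  also have "(1/2) ^ m * (1/2) = (1/2 :: real) ^ Suc m" by simp
  also have "exp (- c * t) * (0 + (1/2) ^ Suc m * (exp ((c + A) * t) - 1))
      = (1/2) ^ Suc m * (exp (A * t) - exp (- c * t))"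
    by (simp add: distrib_right[of c A] exp_add exp_minus field_simps)
  also have "\<dots> \<le> (1/2) ^ Suc m * exp (A * t)" by simp
  finally show ?case by (simp add: mult_left_mono)
qed

text \<open>\<open>max 0 t\<close> extends the path constantly to negative times, so that
  \<open>flow u t\<close> is a state at every real \<open>t\<close>.\<close>

definition flow :: "(nat \<Rightarrow> real) \<Rightarrow> real \<Rightarrow> nat \<Rightarrow> real" where
  "flow u t k = lim (\<lambda>m. picard m u (max 0 t) k)"

lemma picard_summable:
  assumes u: "u \<in> U_set" and t: "t \<ge> 0"
  shows "summable (\<lambda>m. picard (Suc m) u t k - picard m u t k)"
proof (rule summable_comparison_test')
  show "summable (\<lambda>m. (real k * exp (A * t)) * (1/2) ^ m)"
    by (intro summable_mult summable_geometric) auto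
  fix m :: nat
  show "norm (picard (Suc m) u t k - picard m u t k) \<le> (real k * exp (A * t)) * (1/2) ^ m"
    using picard_cauchy[OF u t, of m k] by (simp add: mult_ac del: picard.simps)
qed

lemma picard_tendsto:
  assumes u: "u \<in> U_set" and t: "t \<ge> 0"
  shows "(\<lambda>m. picard m u t k) \<longlonglongrightarrow> flow u t k"
proof -
  have "(\<lambda>n. (\<Sum>m<n. picard (Suc m) u t k - picard m u t k)) = (\<lambda>n. picard n u t k - picard 0 u t k)"
    by (rule ext, rule sum_lessThan_telescope)
  then have "convergent (\<lambda>n. picard n u t k - picard 0 u t k)"
    using picard_summable[OF u t, of k] by (simp add: summable_iff_convergent del: picard.simps)
  then have "convergent (\<lambda>n. (picard n u t k - picard 0 u t k) + picard 0 u t k)"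
    by (rule convergent_add) (rule convergent_const)
  then show ?thesis using t by (simp add: flow_def convergent_LIMSEQ_iff max_def)
qed

lemma picard_flow_dist:
  assumes u: "u \<in> U_set" and t: "t \<ge> 0"
  shows "\<bar>flow u t k - picard m u t k\<bar> \<le> real k * (2 * (1/2) ^ m * exp (A * t))"
proof -
  \<comment> \<open>The differences in \<open>picard_cauchy\<close> add up to the partial geometric
    sum \<open>2 - 2 * (1/2) ^ j\<close>.\<close>
  have "\<bar>picard (m + j) u t k - picard m u t k\<bar> \<le> real k * ((2 - 2 * (1/2) ^ j) * ((1/2) ^ m * exp (A * t)))" for j
  proof (induction j)
    case (Suc j)
    have "real k * ((2 - 2 * (1/2) ^ j) * ((1/2) ^ m * exp (A * t))) + real k * ((1/2) ^ (m + j) * exp (A * t))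
      = real k * ((2 - 2 * (1/2) ^ Suc j) * ((1/2) ^ m * exp (A * t)))"
      by (simp add: algebra_simps power_add)
    then show ?case using picard_cauchy[OF u t, of "m + j" k] Suc.IH by (simp del: picard.simps)
  qed simp
  moreover have "real k * ((2 - 2 * (1/2) ^ j) * ((1/2) ^ m * exp (A * t))) \<le> real k * (2 * ((1/2) ^ m * exp (A * t)))" for j
    by (intro mult_left_mono mult_right_mono) auto
  ultimately have "\<bar>picard (m + j) u t k - picard m u t k\<bar> \<le> real k * (2 * ((1/2) ^ m * exp (A * t)))" for j
    using order_trans by blast
  moreover have "(\<lambda>j. \<bar>picard (m + j) u t k - picard m u t k\<bar>) \<longlonglongrightarrow> \<bar>flow u t k - picard m u t k\<bar>"
    using LIMSEQ_ignore_initial_segment[OF picard_tendsto[OF u t, of k], of m]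
    by (intro tendsto_intros) (simp add: add.commute)
  ultimately show ?thesis
    by (intro LIMSEQ_le_const2) (auto simp: mult_ac)
qed

lemma flow_U:
  assumes u: "u \<in> U_set"
  shows "flow u t \<in> U_set"
proof -
  let ?t = "max 0 t"
  have eq: "flow u t = flow u ?t" by (auto simp: flow_def)
  have t0: "0 \<le> ?t" by simp
  note lim = picard_tendsto[OF u t0] and inU = picard_U[OF u t0]
  show ?thesis unfolding eq
  proof (rule U_setI)
    show "flow u ?t 0 = 1"
      using LIMSEQ_unique[OF lim[of 0, unfolded U_set_0[OF inU]] tendsto_const] .
    show "flow u ?t (Suc k) \<le> flow u ?t k" for k
      by (rule LIMSEQ_le[OF lim lim]) (use U_set_Suc[OF inU] in blast)
    show "0 \<le> flow u ?t k" for k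
      by (rule LIMSEQ_le_const[OF lim]) (use U_set_nonneg[OF inU] in blast)
  qed
qed

lemma flow_lipschitz:
  assumes u: "u \<in> U_set" and v: "v \<in> U_set" and "t \<ge> 0"
  shows "rho (flow u t) (flow v t) \<le> rho u v * exp (L * t)"
proof (rule rho_leI[OF flow_U[OF u] flow_U[OF v]])
  fix k :: nat
  have "(\<lambda>m. \<bar>picard m u t k - picard m v t k\<bar>) \<longlonglongrightarrow> \<bar>flow u t k - flow v t k\<bar>"
    using assms by (intro tendsto_intros picard_tendsto)
  then show "\<bar>flow u t k - flow v t k\<bar> \<le> real k * (rho u v * exp (L * t))"
    by (rule LIMSEQ_le_const2) (use picard_lipschitz[OF u v rho_nonneg[OF u v] rho_bound[OF u v]] assms in blast)
qed

lemma flow_uniform_limit: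
  assumes u: "u \<in> U_set" and T: "T \<ge> 0"
  shows "uniform_limit {0..T} (\<lambda>m t. picard m u t k) (\<lambda>t. flow u t k) sequentially"
proof (rule uniform_limitI)
  fix e :: real assume e: "e > 0"
  have "(\<lambda>m. real k * (2 * (1/2) ^ m * exp (A * T))) \<longlonglongrightarrow> real k * (2 * 0 * exp (A * T))"
    by (intro tendsto_intros LIMSEQ_power_zero) auto
  then have "\<forall>\<^sub>F m in sequentially. real k * (2 * (1/2) ^ m * exp (A * T)) < e"
    using e by (intro order_tendstoD) auto
  then show "\<forall>\<^sub>F m in sequentially. \<forall>t\<in>{0..T}. dist (picard m u t k) (flow u t k) < e"
  proof (rule eventually_mono, intro ballI)
    fix m t assume m: "real k * (2 * (1/2) ^ m * exp (A * T)) < e" and t: "t \<in> {0..T}"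
    have "\<bar>flow u t k - picard m u t k\<bar> \<le> real k * (2 * (1/2) ^ m * exp (A * t))"
      by (rule picard_flow_dist[OF u]) (use t in auto)
    also have "\<dots> \<le> real k * (2 * (1/2) ^ m * exp (A * T))"
      using t A_pos by (intro mult_left_mono) (auto intro!: mult_left_mono)
    finally show "dist (picard m u t k) (flow u t k) < e"
      using m by (simp add: dist_real_def abs_minus_commute)
  qed
qed

lemma flow_continuous:
  assumes u: "u \<in> U_set"
  shows "continuous_on {0..} (\<lambda>t. flow u t k)"
  unfolding continuous_on_eq_continuous_within
proof
  fix t :: real assume t: "t \<in> {0..}"
  have "continuous_on {0..t+1} (\<lambda>t. flow u t k)"
    by (rule uniform_limit_theorem[OF _ flow_uniform_limit[OF u]])
      (use t in \<open>auto intro!: always_eventually continuous_on_subset[OF picard_continuous]\<close>)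
  then have "continuous (at t within {0..t+1}) (\<lambda>t. flow u t k)"
    using t by (auto simp: continuous_on_eq_continuous_within)
  moreover have "at t within {0..t+1} = at t within {0..}"
    by (rule at_within_nhd[of _ "{..<t+1}"]) auto
  ultimately show "continuous (at t within {0..}) (\<lambda>t. flow u t k)"
    by (simp add: continuous_within)
qed

lemma flow_integrand_continuous:
  assumes u: "u \<in> U_set"
  shows "continuous_on {0..} (\<lambda>s. c * exp (c * s) * step_map (flow u s) k)"
  by (cases "k = 0")
    (use c_pos in \<open>auto simp: step_map_def lcq_drift_def intro!: continuous_intros flow_continuous[OF u]\<close>)

text \<open>The recursion of the iterates, passed to the limit: by \<open>picard_flow_dist\<close>
  the integrands converge geometrically in \<open>m\<close>, up to the common growth
  \<open>exp ((c + A) * s)\<close>.\<close>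

lemma flow_integral_equation:
  assumes u: "u \<in> U_set" and t: "t \<ge> 0"
  shows "flow u t k = exp (- c * t) * (u k + integral {0..t} (\<lambda>s. c * exp (c * s) * step_map (flow u s) k))"
    (is "_ = exp (- c * t) * (u k + ?I)")
proof -
  have bound: "\<bar>integral {0..t} (\<lambda>s. c * exp (c * s) * step_map (picard m u s) k) - ?I\<bar>
     \<le> (1/2) ^ m * (real k * ((c + L) * 2) * ((exp ((c + A) * t) - 1) / (c + A)))" for m
  proof -
    have "\<bar>c * exp (c * s) * step_map (picard m u s) k - c * exp (c * s) * step_map (flow u s) k\<bar>
      \<le> (real k * ((c + L) * (2 * (1/2) ^ m))) * exp ((c + A) * s)" if s: "s \<ge> 0" for s
    proof -
      have "\<bar>c * exp (c * s) * step_map (picard m u s) k - c * exp (c * s) * step_map (flow u s) k\<bar>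
        = exp (c * s) * (c * \<bar>step_map (picard m u s) k - step_map (flow u s) k\<bar>)"
        using c_pos by (simp add: abs_mult flip: right_diff_distrib)
      also have "\<dots> \<le> exp (c * s) * (real k * ((c + L) * (2 * (1/2) ^ m * exp (A * s))))"
        using picard_flow_dist[OF u s]
        by (intro mult_left_mono step_map_lipschitz picard_U flow_U u s) (auto simp: abs_minus_commute)
      also have "\<dots> = (real k * ((c + L) * (2 * (1/2) ^ m))) * exp ((c + A) * s)"
        by (simp add: distrib_right[of c A] exp_add)
      finally show ?thesis .
    qed
    then have "\<bar>integral {0..t} (\<lambda>s. c * exp (c * s) * step_map (picard m u s) k) - ?I\<bar>
      \<le> (real k * ((c + L) * (2 * (1/2) ^ m))) * ((exp ((c + A) * t) - 1) / (c + A))"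
      by (intro integral_diff_exp_bound picard_integrand_continuous flow_integrand_continuous u t)
        (use c_pos A_pos in auto)
    also have "(real k * ((c + L) * (2 * (1/2) ^ m))) * ((exp ((c + A) * t) - 1) / (c + A))
      = (1/2) ^ m * (real k * ((c + L) * 2) * ((exp ((c + A) * t) - 1) / (c + A)))"
      by (simp only: mult_ac)
    finally show ?thesis .
  qed
  have "(\<lambda>m. (1/2) ^ m * (real k * ((c + L) * 2) * ((exp ((c + A) * t) - 1) / (c + A)))) \<longlonglongrightarrow> 0"
    by (rule tendsto_mult_left_zero) (rule LIMSEQ_power_zero, simp)
  then have "(\<lambda>m. integral {0..t} (\<lambda>s. c * exp (c * s) * step_map (picard m u s) k) - ?I) \<longlonglongrightarrow> 0"
    by (rule Lim_null_comparison[rotated]) (use bound in \<open>auto simp only: real_norm_def intro!: always_eventually\<close>)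
  then have "(\<lambda>m. picard (Suc m) u t k) \<longlonglongrightarrow> exp (- c * t) * (u k + ?I)"
    unfolding picard.simps by (intro tendsto_intros) (simp add: LIM_zero_iff)
  moreover have "(\<lambda>m. picard (Suc m) u t k) \<longlonglongrightarrow> flow u t k"
    using picard_tendsto[OF u t] by (rule LIMSEQ_Suc)
  ultimately show ?thesis using LIMSEQ_unique by blast
qed

section \<open>Derivative and time regularity of the flow\<close>

lemma flow_0: "u \<in> U_set \<Longrightarrow> flow u 0 k = u k"
  using flow_integral_equation[of u 0 k] by simp

text \<open>Product rule for the integral equation: the derivative is
  \<open>- c * v + c * step_map v\<close>, and \<open>step_map\<close> was built so that this equals
  the drift.\<close>

lemma flow_has_derivative:
  assumes u: "u \<in> U_set" and t: "t \<ge> 0" and k: "k \<ge> 1"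
  shows "((\<lambda>s. flow u s k) has_real_derivative lcq_drift lam d 1 (flow u t) k) (at t within {0..})"
proof -
  let ?J = "\<lambda>t. integral {0..t} (\<lambda>s. c * exp (c * s) * step_map (flow u s) k)"
  have J: "(?J has_real_derivative c * exp (c * t) * step_map (flow u t) k) (at t within {0..})"
    by (rule integral_has_real_derivative_atLeast[OF flow_integrand_continuous[OF u] t])
  have "((\<lambda>t. exp (- c * t) * (u k + ?J t)) has_real_derivative
      - c * (exp (- c * t) * (u k + ?J t)) + exp (- c * t) * (c * exp (c * t) * step_map (flow u t) k)) (at t within {0..})"
    by (rule derivative_eq_intros J refl | simp)+
  also have "- c * (exp (- c * t) * (u k + ?J t)) + exp (- c * t) * (c * exp (c * t) * step_map (flow u t) k)
      = - c * flow u t k + c * step_map (flow u t) k"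
    unfolding flow_integral_equation[OF u t, of k, symmetric] by (simp add: exp_minus)
  also have "\<dots> = lcq_drift lam d 1 (flow u t) k" using k c_pos by (simp add: step_map_def field_simps)
  finally show ?thesis
    by (rule has_field_derivative_transform_within[where d = 1]) (use t flow_integral_equation[OF u] in auto)
qed

lemma flow_mean_value:
  assumes u: "u \<in> U_set" and "0 \<le> s" "s < t" and k: "k \<ge> 1"
  obtains z where "s < z" "z < t" "flow u t k - flow u s k = (t - s) * lcq_drift lam d 1 (flow u z) k"
proof -
  have "\<exists>z\<in>{s<..<t}. flow u t k - flow u s k = (\<lambda>h. h * lcq_drift lam d 1 (flow u z) k) (t - s)"
  proof (rule mvt_simple)
    show "s < t" by fact
    fix x assume x: "s \<le> x" "x \<le> t"
    have "((\<lambda>t. flow u t k) has_real_derivative lcq_drift lam d 1 (flow u x) k) (at x within {s..t})"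
      by (rule has_field_derivative_subset[OF flow_has_derivative[OF u _ k]]) (use x assms in auto)
    then show "((\<lambda>t. flow u t k) has_derivative (\<lambda>h. h * lcq_drift lam d 1 (flow u x) k)) (at x within {s..t})"
      by (simp add: has_field_derivative_def mult.commute[of _ "lcq_drift lam d 1 (flow u x) k"])
  qed
  then show ?thesis using that by auto
qed

lemma flow_time_lipschitz:
  assumes u: "u \<in> U_set" and "0 \<le> s" "0 \<le> t"
  shows "\<bar>flow u t k - flow u s k\<bar> \<le> 2 * \<bar>t - s\<bar>"
proof -
  have main: "\<bar>flow u t k - flow u s k\<bar> \<le> 2 * \<bar>t - s\<bar>" if "0 \<le> s" "s < t" for s t
  proof (cases "k = 0")
    case False
    then obtain z where "flow u t k - flow u s k = (t - s) * lcq_drift lam d 1 (flow u z) k"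
      using flow_mean_value[OF u \<open>0 \<le> s\<close> \<open>s < t\<close>, of k] by (metis One_nat_def Suc_leI neq0_conv)
    moreover have "\<bar>lcq_drift lam d 1 (flow u z) k\<bar> \<le> 2"
      using lcq_drift_bound[of lam 1 "flow u z" k d] lam_pos lam_less_1 flow_U[OF u] False by auto
    ultimately show ?thesis using mult_left_mono[of "\<bar>lcq_drift lam d 1 (flow u z) k\<bar>" 2 "\<bar>t - s\<bar>"]
      by (simp add: abs_mult mult.commute)
  qed (simp add: U_set_0[OF flow_U[OF u]])
  then show ?thesis using main[of s t] main[of t s] assms
    by (cases s t rule: linorder_cases) (auto simp: abs_minus_commute)
qed

text \<open>The drift at the intermediate time of the mean value theorem is compared with the drift
  at \<open>t\<close>: coordinates move at speed at most 2, and
  \<open>lcq_drift_lipschitz_sup\<close> contributes the factor \<open>2 + 2 * d\<close>.\<close>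

lemma flow_euler_error:
  assumes u: "u \<in> U_set" and "0 \<le> t" "0 < h" and k: "k \<ge> 1"
  shows "\<bar>flow u (t + h) k - flow u t k - h * lcq_drift lam d 1 (flow u t) k\<bar> \<le> 4 * (1 + real d) * h\<^sup>2"
proof -
  obtain z where z: "t < z" "z < t + h"
    "flow u (t + h) k - flow u t k = h * lcq_drift lam d 1 (flow u z) k"
    using flow_mean_value[OF u, of t "t + h" k] assms by auto
  have "\<bar>lcq_drift lam d 1 (flow u z) k - lcq_drift lam d 1 (flow u t) k\<bar> \<le> (2 + 2 * real d) * (2 * h)"
  proof (rule lcq_drift_lipschitz_sup)
    show "\<bar>flow u z k - flow u t k\<bar> \<le> 2 * h" for k
      using flow_time_lipschitz[OF u, of t z k] z assms by auto
  qed (use lam_pos lam_less_1 flow_U[OF u] in auto)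
  then have "h * \<bar>lcq_drift lam d 1 (flow u z) k - lcq_drift lam d 1 (flow u t) k\<bar> \<le> h * ((2 + 2 * real d) * (2 * h))"
    using assms by (intro mult_left_mono) auto
  moreover have "\<bar>flow u (t + h) k - flow u t k - h * lcq_drift lam d 1 (flow u t) k\<bar>
     = h * \<bar>lcq_drift lam d 1 (flow u z) k - lcq_drift lam d 1 (flow u t) k\<bar>"
    using assms unfolding z(3) by (simp add: abs_mult flip: right_diff_distrib)
  ultimately show ?thesis by (simp add: power2_eq_square algebra_simps)
qed

lemma flow_rho_time:
  assumes u: "u \<in> U_set" and "0 \<le> s" "0 \<le> t"
  shows "rho (flow u t) (flow u s) \<le> 2 * \<bar>t - s\<bar>"
proof (rule rho_leI[OF flow_U[OF u] flow_U[OF u]])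
  fix k :: nat assume "k \<ge> 1"
  then have "1 * (2 * \<bar>t - s\<bar>) \<le> real k * (2 * \<bar>t - s\<bar>)" by (intro mult_right_mono) auto
  then show "\<bar>flow u t k - flow u s k\<bar> \<le> real k * (2 * \<bar>t - s\<bar>)"
    using flow_time_lipschitz[OF assms, of k] by linarith
qed

lemma flow_D_U:
  assumes u: "u \<in> U_set"
  shows "flow u \<in> D_U"
proof -
  have close: "rho (flow u s) (flow u t) < e" if "e > 0" "0 \<le> s" "0 \<le> t" "\<bar>s - t\<bar> < e / 2" for s t e
    by (rule order.strict_trans1[OF flow_rho_time[OF u that(3,2)]]) (use that in simp)
  show ?thesis
    unfolding D_U_def mem_Collect_eq
  proof (intro conjI allI impI)
    fix t :: real
    show "flow u t \<in> U_set" by (rule flow_U[OF u])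
    show "\<exists>\<delta>>0. \<forall>s. t \<le> s \<and> s < t + \<delta> \<longrightarrow> rho (flow u s) (flow u t) < e" if "t \<ge> 0" "e > 0" for e
      by (rule exI[of _ "e / 2"]) (use that close in auto)
    have "\<exists>\<delta>>0. \<forall>s. 0 \<le> s \<and> t - \<delta> < s \<and> s < t \<longrightarrow> rho (flow u s) (flow u t) < e" if "t > 0" "e > 0" for e
      by (rule exI[of _ "e / 2"]) (use that close in auto)
    then show "\<exists>L\<in>U_set. \<forall>e>0. \<exists>\<delta>>0. \<forall>s. 0 \<le> s \<and> t - \<delta> < s \<and> s < t \<longrightarrow> rho (flow u s) L < e" if "t > 0"
      using that by (intro bexI[of _ "flow u t"] flow_U[OF u]) auto
  qed
qed

end

section \<open>Estimates in the Skorokhod metric\<close>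

lemma has_bochner_integral_exp_tail:
  fixes a :: real
  shows "has_bochner_integral lborel (\<lambda>u. exp (- u) * indicator {a..} u) (exp (- a))"
proof (rule has_bochner_integral_nn_integral)
  have "(\<integral>\<^sup>+ u. ennreal (exp (- u)) * indicator {a..} u \<partial>lborel) = 0 - (- exp (- a))"
  proof (rule nn_integral_FTC_atLeast)
    show "((\<lambda>u::real. - exp (- u)) \<longlongrightarrow> 0) at_top" by real_asymp
  qed (auto intro!: derivative_eq_intros)
  then show "(\<integral>\<^sup>+ u. ennreal (exp (- u) * indicator {a..} u) \<partial>lborel) = ennreal (exp (- a))"
    by (simp add: ennreal_mult' ennreal_indicator)
qed (auto simp: indicator_def)

lemma D_U_right_continuous:
  assumes "x \<in> D_U" "t \<ge> 0" "e > 0"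
  shows "\<exists>\<delta>>0. \<forall>s. t \<le> s \<and> s < t + \<delta> \<longrightarrow> rho (x s) (x t) < e"
  using assms by (simp add: D_U_def)

lemma exp_neg_small:
  assumes "(e::real) > 0"
  obtains T :: real where "T > 0" "exp (- T) < e"
proof
  let ?T = "max 1 (1 - ln e)"
  show "?T > 0" by simp
  have "exp (- ?T) \<le> exp (ln e - 1)" by simp
  also have "\<dots> < exp (ln e)" by simp
  also have "\<dots> = e" using assms by simp
  finally show "exp (- ?T) < e" .
qed

lemma skor_gamma_nonneg:
  assumes "l \<in> skor_Lambda"
  shows "0 \<le> skor_gamma l"
proof -
  have bdd: "bdd_above ((\<lambda>p. \<bar>ln ((l (fst p) - l (snd p)) / (fst p - snd p))\<bar>) ` {(s,t). 0 \<le> t \<and> t < s})"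
    using assms by (simp add: skor_Lambda_def)
  have "(\<lambda>p. \<bar>ln ((l (fst p) - l (snd p)) / (fst p - snd p))\<bar>) (1, 0) \<le> skor_gamma l"
    unfolding skor_gamma_def by (rule cSUP_upper[OF _ bdd]) auto
  then show ?thesis using abs_ge_zero order_trans by blast
qed

text \<open>All upper bounds for \<open>skor_dist\<close> come from here. The cap
  \<open>min 1\<close> lets an exceptional set \<open>B\<close> of truncation times cost no more
  than its measure, and the times after \<open>T\<close> cost \<open>exp (- T)\<close>.\<close>

lemma skor_dist_le:
  assumes l: "l \<in> skor_Lambda" and g: "skor_gamma l \<le> g"
    and B: "B \<in> sets lborel" "emeasure lborel B < \<infinity>" "measure lborel B \<le> \<beta>" and "T \<ge> 0" and \<eta>: "\<eta> \<ge> 0"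
    and close: "\<And>u t. 0 \<le> u \<Longrightarrow> u \<le> T \<Longrightarrow> u \<notin> B \<Longrightarrow> 0 \<le> t \<Longrightarrow> rho (x (min t u)) (y (min (l t) u)) \<le> \<eta>"
  shows "skor_dist x y \<le> max g (\<eta> + \<beta> + exp (- T))"
proof -
  let ?S = "\<lambda>l u. SUP t\<in>{0..}. rho (x (min t u)) (y (min (l t) u))"
  let ?h = "\<lambda>u. (exp (- u) * indicator {0..} u) * \<eta> + indicator B u + exp (- u) * indicator {T..} u"
  have h: "has_bochner_integral lborel ?h (exp (- 0) * \<eta> + measure lborel B + exp (- T))"
    by (intro has_bochner_integral_add has_bochner_integral_mult_left has_bochner_integral_exp_tail
        has_bochner_integral_real_indicator B)
  have "(LBINT u:{0..}. exp (- u) * min 1 (?S l u)) \<le> (\<integral>u. ?h u \<partial>lborel)"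
    unfolding set_lebesgue_integral_def
  \<comment> \<open>Integrability is checked for the majorant: if the integrand, which contains an
    uncountable supremum, failed to be integrable, its integral would be 0 and the inequality would
    follow from nonnegativity.\<close>
  proof (rule integral_mono')
    show "integrable lborel ?h" using h by (simp add: has_bochner_integral_iff)
    fix u :: real
    show "0 \<le> ?h u" using \<eta> by auto
    show "indicat_real {0..} u *\<^sub>R (exp (- u) * min 1 (?S l u)) \<le> ?h u"
    proof (cases "0 \<le> u")
      case True
      consider "u \<in> B" | "u \<notin> B" "u \<le> T" | "u \<notin> B" "T < u" by linarith
      then show ?thesis
      proof cases
        case 1
        have "exp (- u) * min 1 (?S l u) \<le> exp (- u) * 1" by (intro mult_left_mono) auto
        also have "\<dots> \<le> 1" using True by simp
        also have "1 \<le> ?h u" using True 1 \<eta> by (simp add: indicator_def)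
        finally show ?thesis using True by simp
      next
        case 2
        have "?S l u \<le> \<eta>" by (rule cSUP_least) (use close True 2 in auto)
        then have "exp (- u) * min 1 (?S l u) \<le> exp (- u) * \<eta>" by (intro mult_left_mono) auto
        also have "\<dots> \<le> ?h u" using True 2 by (simp add: indicator_def)
        finally show ?thesis using True by simp
      next
        case 3
        have "exp (- u) * min 1 (?S l u) \<le> exp (- u) * 1" by (intro mult_left_mono) auto
        then show ?thesis using True 3 \<eta> by (auto simp: indicator_def add_increasing)
      qed
    qed (use \<eta> in auto)
  qed
  also have "\<dots> = exp (- 0) * \<eta> + measure lborel B + exp (- T)"
    using h by (rule has_bochner_integral_integral_eq)
  also have "\<dots> \<le> \<eta> + \<beta> + exp (- T)" using B by simp
  finally have le: "max (skor_gamma l) (LBINT u:{0..}. exp (- u) * min 1 (?S l u)) \<le> max g (\<eta> + \<beta> + exp (- T))"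
    using g by (auto simp: le_max_iff_disj)
  have bdd: "bdd_below ((\<lambda>l. max (skor_gamma l) (LBINT u:{0..}. exp (- u) * min 1 (?S l u))) ` skor_Lambda)"
    by (rule bdd_belowI2[where m=0]) (use skor_gamma_nonneg in \<open>auto simp: le_max_iff_disj\<close>)
  have "skor_dist x y \<le> max (skor_gamma l) (LBINT u:{0..}. exp (- u) * min 1 (?S l u))"
    unfolding skor_dist_def by (rule cINF_lower[OF bdd l])
  also note le
  finally show ?thesis .
qed

text \<open>A shift with Lipschitz constant \<kappa> keeps the slopes in
  [1 - \<kappa>, 1 + \<kappa>]. For \<kappa> \<le> 1/2 they are at least 1/2, whence
  \<open>- ln z \<le> (1 - z) / z \<le> 2 * \<kappa>\<close>.\<close>

lemma time_shift_skor_Lambda: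
  fixes c :: "real \<Rightarrow> real"
  assumes c0: "c 0 = 0" and nn: "\<And>t. 0 \<le> c t" and lip: "\<And>s t. \<bar>c s - c t\<bar> \<le> \<kappa> * \<bar>s - t\<bar>" and \<kappa>: "\<kappa> \<le> 1/2"
  shows "(\<lambda>t. t + c t) \<in> skor_Lambda" "skor_gamma (\<lambda>t. t + c t) \<le> 2 * \<kappa>"
proof -
  let ?l = "\<lambda>t. t + c t"
  have k0: "0 \<le> \<kappa>" using order_trans[OF abs_ge_zero lip[of 1 0]] by simp
  have slope: "\<bar>ln ((?l s - ?l t) / (s - t))\<bar> \<le> 2 * \<kappa>" if "t < s" for s t
  proof -
    define z where "z = (?l s - ?l t) / (s - t)"
    have "z - 1 = (c s - c t) / (s - t)" using that by (simp add: z_def field_simps)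
    then have "\<bar>z - 1\<bar> = \<bar>c s - c t\<bar> / (s - t)" using that by (simp add: abs_divide)
    also have "\<dots> \<le> \<kappa>" using lip[of s t] that by (simp add: divide_le_eq)
    finally have z1: "\<bar>z - 1\<bar> \<le> \<kappa>" .
    then have z: "z \<ge> 1/2" using \<kappa> by linarith
    have "ln z \<le> \<kappa>" using ln_le_minus_one[of z] z z1 by linarith
    moreover have "- ln z \<le> 2 * \<kappa>"
    proof -
      have "- ln z = ln (1 / z)" using z by (simp add: ln_div)
      also have "\<dots> \<le> 1 / z - 1" using z by (intro ln_le_minus_one) auto
      also have "\<dots> = (1 - z) / z" using z by (simp add: field_simps)
      also have "\<dots> \<le> \<kappa> / (1/2)" using z z1 k0 by (intro frac_le) auto
      finally show ?thesis by simp
    qed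
    ultimately show ?thesis using k0 by (simp add: z_def)
  qed
  have strict: "?l t < ?l s" if "t < s" for s t
  proof -
    have "\<bar>c s - c t\<bar> \<le> (1/2) * \<bar>s - t\<bar>"
      using lip[of s t] mult_right_mono[OF \<kappa>, of "\<bar>s - t\<bar>"] by linarith
    then show ?thesis using that by (simp add: abs_le_iff) argo
  qed
  have cc: "continuous_on UNIV c"
  proof (rule continuous_onI)
    fix t e :: real assume "0 < e"
    then have "dist (c s) (c t) \<le> e" if "dist s t < e" for s
      using lip[of s t] mult_right_mono[OF \<kappa>, of "\<bar>s - t\<bar>"] that by (simp add: dist_real_def)
    with \<open>0 < e\<close> show "\<exists>d>0. \<forall>x'\<in>UNIV. dist x' t < d \<longrightarrow> dist (c x') (c t) \<le> e" by blast
  qed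
  have cont: "continuous_on S ?l" for S
    by (intro continuous_intros continuous_on_subset[OF cc]) auto
  have img: "?l ` {0..} = {0..}"
  proof (intro subset_antisym subsetI)
    fix y :: real assume y: "y \<in> {0..}"
    have "\<exists>x. 0 \<le> x \<and> x \<le> y \<and> ?l x = y"
      by (rule IVT') (use y nn c0 cont in auto)
    then show "y \<in> ?l ` {0..}" by force
  qed (use nn in \<open>auto intro: add_nonneg_nonneg\<close>)
  show "?l \<in> skor_Lambda" unfolding skor_Lambda_def mem_Collect_eq
    by (intro conjI strict_mono_onI cont img strict bdd_aboveI2[where M="2 * \<kappa>"]) (use slope in auto)
  have ne: "(1, 0) \<in> {(s, t::real). 0 \<le> t \<and> t < s}" by simp
  show "skor_gamma ?l \<le> 2 * \<kappa>" unfolding skor_gamma_def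
  proof (rule cSUP_least)
    show "{(s, t::real). 0 \<le> t \<and> t < s} \<noteq> {}" using ne by blast
  qed (use slope in auto)
qed

lemma id_skor_Lambda: "(\<lambda>t. t) \<in> skor_Lambda" "skor_gamma (\<lambda>t. t) \<le> 0"
  using time_shift_skor_Lambda[of "\<lambda>_. 0" 0] by auto

lemma skor_dist_le_uniform:
  assumes "T \<ge> 0" "\<eta> \<ge> 0" and "\<And>t. 0 \<le> t \<Longrightarrow> t \<le> T \<Longrightarrow> rho (x t) (y t) \<le> \<eta>"
  shows "skor_dist x y \<le> \<eta> + exp (- T)"
proof -
  have "skor_dist x y \<le> max 0 (\<eta> + 0 + exp (- T))"
    by (rule skor_dist_le[OF id_skor_Lambda, of "{}"]) (use assms in \<open>auto intro!: assms(3)\<close>)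
  then show ?thesis using assms by (simp add: max_def split: if_splits)
qed

section \<open>Measurability of Skorokhod continuous functionals\<close>

text \<open>Bisection via \<open>Bolzano\<close>: the one-sided limits make the single cut point
  \<open>z\<close> suffice near \<open>z\<close>, and the cut points of adjacent intervals are
  united.\<close>

lemma D_U_partition:
  assumes x: "x \<in> D_U" and "\<epsilon> > 0" "T \<ge> 0"
  obtains P where "finite P"
    "\<And>s t. 0 \<le> s \<Longrightarrow> s \<le> t \<Longrightarrow> t \<le> T \<Longrightarrow> P \<inter> {s<..t} = {} \<Longrightarrow> rho (x s) (x t) \<le> \<epsilon>"
proof -
  \<comment> \<open>The guard \<open>0 \<le> s\<close> is there because intervals around
    \<open>z = 0\<close> in the local step may reach below 0.\<close>
  define Q where "Q a b \<longleftrightarrow> (\<exists>P. finite P \<and> (\<forall>s t. 0 \<le> s \<longrightarrow> a \<le> s \<longrightarrow> s \<le> t \<longrightarrow> t \<le> b \<longrightarrow> P \<inter> {s<..t} = {} \<longrightarrow> rho (x s) (x t) \<le> \<epsilon>))" for a b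
  have U: "x t \<in> U_set" if "t \<ge> 0" for t using x that by (auto simp: D_U_def)
  have "Q 0 T" using \<open>T \<ge> 0\<close>
  proof (induction rule: Bolzano)
    case (trans a b e)
    then obtain P1 P2 where P: "finite P1" "finite P2"
      "\<And>s t. 0 \<le> s \<Longrightarrow> a \<le> s \<Longrightarrow> s \<le> t \<Longrightarrow> t \<le> b \<Longrightarrow> P1 \<inter> {s<..t} = {} \<Longrightarrow> rho (x s) (x t) \<le> \<epsilon>"
      "\<And>s t. 0 \<le> s \<Longrightarrow> b \<le> s \<Longrightarrow> s \<le> t \<Longrightarrow> t \<le> e \<Longrightarrow> P2 \<inter> {s<..t} = {} \<Longrightarrow> rho (x s) (x t) \<le> \<epsilon>"
      unfolding Q_def by metis
    show ?case unfolding Q_def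
    proof (intro exI[of _ "insert b (P1 \<union> P2)"] conjI allI impI)
      fix s t assume st: "0 \<le> s" "a \<le> s" "s \<le> t" "t \<le> e" "insert b (P1 \<union> P2) \<inter> {s<..t} = {}"
      then have "P1 \<inter> {s<..t} = {}" "P2 \<inter> {s<..t} = {}" "t < b \<or> b \<le> s" by auto
      then show "rho (x s) (x t) \<le> \<epsilon>" using P(3)[of s t] P(4)[of s t] st by auto
    qed (use P in auto)
  next
    case (local z)
    obtain r where r: "r > 0" "\<And>s. z \<le> s \<Longrightarrow> s < z + r \<Longrightarrow> rho (x s) (x z) < \<epsilon> / 2"
      using D_U_right_continuous[OF x local(1), of "\<epsilon> / 2"] \<open>\<epsilon> > 0\<close> by auto
    have "\<exists>r'>0. \<exists>y\<in>U_set. \<forall>s. 0 \<le> s \<and> z - r' < s \<and> s < z \<longrightarrow> rho (x s) y < \<epsilon> / 2"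
    proof (cases "z = 0")
      case True
      then show ?thesis using U[of 0] by (intro exI[of _ 1]) auto
    next
      case False
      then have "\<exists>y\<in>U_set. \<forall>e>0. \<exists>\<delta>>0. \<forall>s. 0 \<le> s \<and> z - \<delta> < s \<and> s < z \<longrightarrow> rho (x s) y < e"
        using x local unfolding D_U_def by auto
      then show ?thesis using \<open>\<epsilon> > 0\<close> by (meson half_gt_zero)
    qed
    then obtain r' y where r': "r' > 0" "y \<in> U_set" "\<And>s. 0 \<le> s \<Longrightarrow> z - r' < s \<Longrightarrow> s < z \<Longrightarrow> rho (x s) y < \<epsilon> / 2"
      by blast
    show ?case
    proof (intro exI[of _ "min r r'"] conjI allI impI)
      fix a b assume ab: "a \<le> z \<and> z \<le> b \<and> b - a < min r r'"
      show "Q a b" unfolding Q_def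
      proof (intro exI[of _ "{z}"] conjI allI impI)
        fix s t assume st: "0 \<le> s" "a \<le> s" "s \<le> t" "t \<le> b" "{z} \<inter> {s<..t} = {}"
        then have "t < z \<or> z \<le> s" by auto
        then show "rho (x s) (x t) \<le> \<epsilon>"
        proof
          assume "t < z"
          then have "rho (x s) y < \<epsilon> / 2" "rho (x t) y < \<epsilon> / 2"
            using r'(3)[of s] r'(3)[of t] st ab by auto
          then show ?thesis using rho_triangle[of "x s" y "x t"] U[of s] U[of t] st r' rho_commute[of y "x t"] by auto
        next
          assume "z \<le> s"
          then have "rho (x s) (x z) < \<epsilon> / 2" "rho (x t) (x z) < \<epsilon> / 2"
            using r(2)[of s] r(2)[of t] st ab by auto
          then show ?thesis using rho_triangle[of "x s" "x z" "x t"] U[of s] U[of t] U[of z] local st rho_commute[of "x z" "x t"] by auto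
        qed
      qed auto
    qed (use r r' in auto)
  qed
  then show ?thesis unfolding Q_def using that by blast
qed

text \<open>Sampling, truncation and rounding leave a value in a countable type, so every function
  of the code is measurable, whatever functional is applied after decoding. The \<open>m * m\<close>
  steps of length \<open>1 / m\<close> reach up to time \<open>m\<close>.\<close>

definition path_code :: "nat \<Rightarrow> (real \<Rightarrow> nat \<Rightarrow> real) \<Rightarrow> int list list" where
  "path_code m x = map (\<lambda>i. map (\<lambda>k. \<lfloor>real m * x (real i / real m) k\<rfloor>) [0..<Suc m]) [0..<Suc (m * m)]"

definition path_decode :: "nat \<Rightarrow> int list list \<Rightarrow> real \<Rightarrow> nat \<Rightarrow> real" where
  "path_decode m cs t k
    = (if k \<le> m then real_of_int (cs ! min (nat \<lfloor>real m * t\<rfloor>) (m * m) ! k) / real m else 0)"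

definition quantize :: "nat \<Rightarrow> (nat \<Rightarrow> real) \<Rightarrow> nat \<Rightarrow> real" where
  "quantize m u k = (if k \<le> m then real_of_int \<lfloor>real m * u k\<rfloor> / real m else 0)"

definition path_approx :: "nat \<Rightarrow> (real \<Rightarrow> nat \<Rightarrow> real) \<Rightarrow> real \<Rightarrow> nat \<Rightarrow> real" where
  "path_approx m x t = quantize m (x (real (min (nat \<lfloor>real m * t\<rfloor>) (m * m)) / real m))"

lemma path_decode_code: "path_decode m (path_code m x) = path_approx m x"
  by (auto simp: fun_eq_iff path_decode_def path_code_def path_approx_def quantize_def nth_append
      simp del: upt_Suc)

lemma quantize_U:
  assumes u: "u \<in> U_set" and m: "m \<ge> 1"
  shows "quantize m u \<in> U_set"
proof (rule U_setI)
  show "quantize m u 0 = 1" using m by (simp add: quantize_def U_set_0[OF u])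
  have nn: "0 \<le> real_of_int \<lfloor>real m * u k\<rfloor> / real m" for k
    using U_set_nonneg[OF u, of k] by simp
  then show "0 \<le> quantize m u k" for k by (simp add: quantize_def)
  show "quantize m u (Suc k) \<le> quantize m u k" for k
  proof (cases "Suc k \<le> m")
    case True
    have "\<lfloor>real m * u (Suc k)\<rfloor> \<le> \<lfloor>real m * u k\<rfloor>"
      by (intro floor_mono mult_left_mono U_set_Suc[OF u]) auto
    then show ?thesis using True by (simp add: quantize_def divide_right_mono)
  qed (use nn in \<open>auto simp: quantize_def\<close>)
qed

lemma rho_quantize:
  assumes u: "u \<in> U_set" and m: "m \<ge> 1"
  shows "rho u (quantize m u) \<le> 1 / real m"
proof -
  have "rho u (quantize m u) \<le> max (1 / real m) (1 / real m)"
  proof (rule rho_le_of_coordinates[OF u quantize_U[OF u m]])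
    fix k assume k: "1 \<le> k" "k \<le> m"
    have "real m * u k - 1 \<le> real_of_int \<lfloor>real m * u k\<rfloor>" "real_of_int \<lfloor>real m * u k\<rfloor> \<le> real m * u k" by linarith+
    then have "\<bar>real m * u k - real_of_int \<lfloor>real m * u k\<rfloor>\<bar> \<le> 1" by linarith
    moreover have "u k - quantize m u k = (real m * u k - real_of_int \<lfloor>real m * u k\<rfloor>) / real m"
      using k by (simp add: quantize_def field_simps)
    ultimately have "\<bar>u k - quantize m u k\<bar> \<le> 1 / real m" by (simp add: abs_divide divide_right_mono)
    also have "1 * (1 / real m) \<le> real k * (1 / real m)" using k by (intro mult_right_mono) auto
    finally show "\<bar>u k - quantize m u k\<bar> \<le> real k * (1 / real m)" by simp
  qed (use m in auto)
  then show ?thesis by simp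
qed

lemma path_approx_D_U:
  assumes x: "x \<in> D_U" and m: "m \<ge> 1"
  shows "path_approx m x \<in> D_U"
proof -
  define v where "v j = quantize m (x (real (min (nat j) (m * m)) / real m))" for j :: int
  have v: "path_approx m x t = v \<lfloor>real m * t\<rfloor>" for t by (simp add: v_def path_approx_def)
  have vU: "v j \<in> U_set" for j
    unfolding v_def using x m by (intro quantize_U) (auto simp: D_U_def)
  have mp: "real m > 0" using m by simp
  show ?thesis unfolding D_U_def mem_Collect_eq v
  proof (intro conjI allI impI vU)
    fix t e :: real assume "e > 0" "t \<ge> 0"
    have eq: "\<lfloor>real m * s\<rfloor> = \<lfloor>real m * t\<rfloor>" if "t \<le> s" "s < t + ((real_of_int \<lfloor>real m * t\<rfloor> + 1) / real m - t)" for s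
    proof -
      have "real m * s < real_of_int \<lfloor>real m * t\<rfloor> + 1" using that mp by (simp add: field_simps)
      moreover have "real m * t \<le> real m * s" using that by (intro mult_left_mono) auto
      ultimately show ?thesis by linarith
    qed
    have pos: "(real_of_int \<lfloor>real m * t\<rfloor> + 1) / real m - t > 0"
      using mp by (simp add: pos_less_divide_eq mult.commute[of t])
    have "rho (v \<lfloor>real m * s\<rfloor>) (v \<lfloor>real m * t\<rfloor>) < e"
      if "t \<le> s" "s < t + ((real_of_int \<lfloor>real m * t\<rfloor> + 1) / real m - t)" for s
      unfolding eq[OF that] using rho_refl[OF vU] \<open>e > 0\<close> by simp
    with pos show "\<exists>\<delta>>0. \<forall>s. t \<le> s \<and> s < t + \<delta> \<longrightarrow> rho (v \<lfloor>real m * s\<rfloor>) (v \<lfloor>real m * t\<rfloor>) < e"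
      by blast
  next
    fix t :: real assume "t > 0"
    \<comment> \<open>The step index just before \<open>t\<close>; it differs from
      \<open>\<lfloor>real m * t\<rfloor>\<close> exactly when \<open>t\<close> is a grid
      point.\<close>
    define j where "j = \<lceil>real m * t\<rceil> - 1"
    have j: "\<lfloor>real m * s\<rfloor> = j" if "t - (t - real_of_int j / real m) < s" "s < t" for s
    proof -
      have "real_of_int j < real m * s" using that mp by (simp add: field_simps)
      moreover have "real m * s < real m * t" using that mp by (intro mult_strict_left_mono) auto
      ultimately show ?thesis unfolding j_def by linarith
    qed
    have "real_of_int j < real m * t" unfolding j_def by linarith
    then have "t - real_of_int j / real m > 0" using mp by (simp add: field_simps)
    then have "\<exists>\<delta>>0. \<forall>s. 0 \<le> s \<and> t - \<delta> < s \<and> s < t \<longrightarrow> rho (v \<lfloor>real m * s\<rfloor>) (v j) < e" if "e > 0" for e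
      using that j rho_refl[OF vU] by (intro exI[of _ "t - real_of_int j / real m"]) auto
    then show "\<exists>L\<in>U_set. \<forall>e>0. \<exists>\<delta>>0. \<forall>s. 0 \<le> s \<and> t - \<delta> < s \<and> s < t \<longrightarrow> rho (v \<lfloor>real m * s\<rfloor>) L < e"
      by (intro bexI[of _ "v j"] vU) auto
  qed
qed

lemma finite_set_gap:
  fixes P :: "real set"
  assumes "finite P"
  obtains \<Delta> where "\<Delta> > 0" "\<And>p p'. p \<in> P \<Longrightarrow> p' \<in> P \<Longrightarrow> p \<noteq> p' \<Longrightarrow> \<Delta> \<le> \<bar>p - p'\<bar>"
proof -
  \<comment> \<open>The inserted 1 keeps the minimum defined when \<open>P\<close> has at most one
    point.\<close>
  let ?D = "insert 1 ((\<lambda>(p, p'). \<bar>p - p'\<bar>) ` {(p, p') \<in> P \<times> P. p \<noteq> p'})"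
  have fin: "finite ?D"
    using assms by (auto intro: finite_subset[of _ "P \<times> P"])
  show ?thesis
  proof (rule that[of "Min ?D"])
    show "Min ?D > 0" using fin by (subst Min_gr_iff) auto
    show "Min ?D \<le> \<bar>p - p'\<bar>" if "p \<in> P" "p' \<in> P" "p \<noteq> p'" for p p'
      by (rule Min_le[OF fin]) (use that in auto)
  qed
qed

text \<open>The time change moves every \<open>\<epsilon>\<close>-jump of the path to the next point of the grid of mesh \<open>1 / m\<close>:
  it is the identity plus a maximum of disjoint tents of slope \<open>\<kappa>\<close>.\<close>

lemma skor_dist_path_approx_le:
  assumes x: "x \<in> D_U" and "\<epsilon> \<ge> 0" "T \<ge> 0" and P: "finite P" "0 \<in> P" "P \<subseteq> {0..}"
    and osc: "\<And>s t. 0 \<le> s \<Longrightarrow> s \<le> t \<Longrightarrow> t \<le> T + 1 \<Longrightarrow> P \<inter> {s<..t} = {} \<Longrightarrow> rho (x s) (x t) \<le> \<epsilon>"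
    and \<Delta>: "\<Delta> > 0" "\<And>p p'. p \<in> P \<Longrightarrow> p' \<in> P \<Longrightarrow> p \<noteq> p' \<Longrightarrow> \<Delta> \<le> \<bar>p - p'\<bar>"
    and m: "real m \<ge> T + 1" "1 / (real m * \<Delta>) \<le> 1/2"
  shows "skor_dist x (path_approx m x)
    \<le> max (2 * (1 / (real m * \<Delta>))) ((\<epsilon> + 1 / real m) + real (card P) * (1 / real m) + exp (- T))"
proof -
  \<comment> \<open>With this slope a tent of height at most \<open>1 / m\<close> has vanished at
    distance \<Delta>, so at a point of \<open>P\<close> only its own tent is present.\<close>
  define \<kappa> where "\<kappa> = 1 / (real m * \<Delta>)"
  define e where "e p = real_of_int \<lceil>real m * p\<rceil> / real m - p" for p
  define c where "c t = Max ((\<lambda>p. max 0 (e p - \<kappa> * \<bar>t - p\<bar>)) ` P)" for t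
  have m1: "real m \<ge> 1" using m \<open>T \<ge> 0\<close> by linarith
  then have mp: "real m > 0" and m1': "m \<ge> 1" by auto
  have \<kappa>0: "\<kappa> \<ge> 0" using mp \<Delta> by (simp add: \<kappa>_def)
  have e: "0 \<le> e p" "e p \<le> 1 / real m" for p
  proof -
    have "real m * p \<le> real_of_int \<lceil>real m * p\<rceil>" "real_of_int \<lceil>real m * p\<rceil> \<le> real m * p + 1" by linarith+
    then have "p \<le> real_of_int \<lceil>real m * p\<rceil> / real m" "real_of_int \<lceil>real m * p\<rceil> / real m \<le> (real m * p + 1) / real m"
      using mp by (auto simp: pos_le_divide_eq mult.commute intro!: divide_right_mono)
    moreover have "(real m * p + 1) / real m = p + 1 / real m" using mp by (simp add: add_divide_distrib)
    ultimately show "0 \<le> e p" "e p \<le> 1 / real m" by (simp_all add: e_def)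
  qed
  have fin: "finite ((\<lambda>p. max 0 (e p - \<kappa> * \<bar>t - p\<bar>)) ` P)" for t using P by auto
  have c_ge: "max 0 (e p - \<kappa> * \<bar>t - p\<bar>) \<le> c t" if "p \<in> P" for p t
    unfolding c_def by (rule Max_ge[OF fin]) (use that in auto)
  have c_le: "c t \<le> b" if "\<And>p. p \<in> P \<Longrightarrow> max 0 (e p - \<kappa> * \<bar>t - p\<bar>) \<le> b" for t b
    unfolding c_def by (subst Max_le_iff[OF fin]) (use P that in auto)
  have c_nn: "0 \<le> c t" for t using c_ge[OF P(2), of t] by simp
  have c_m: "c t \<le> 1 / real m" for t
  proof (rule c_le)
    fix p
    have "0 \<le> \<kappa> * \<bar>t - p\<bar>" using \<kappa>0 by simp
    then show "max 0 (e p - \<kappa> * \<bar>t - p\<bar>) \<le> 1 / real m" using e(2)[of p] e(1)[of p] by simp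
  qed
  have c_lip1: "c s \<le> c t + \<kappa> * \<bar>s - t\<bar>" for s t
  proof (rule c_le)
    fix p assume p: "p \<in> P"
    have "\<kappa> * \<bar>t - p\<bar> \<le> \<kappa> * (\<bar>s - p\<bar> + \<bar>s - t\<bar>)" using \<kappa>0 by (intro mult_left_mono) auto
    moreover have "0 \<le> \<kappa> * \<bar>s - t\<bar>" using \<kappa>0 by simp
    ultimately show "max 0 (e p - \<kappa> * \<bar>s - p\<bar>) \<le> c t + \<kappa> * \<bar>s - t\<bar>"
      using c_ge[OF p, of t] by (simp add: distrib_left)
  qed
  have c_lip: "\<bar>c s - c t\<bar> \<le> \<kappa> * \<bar>s - t\<bar>" for s t
    using c_lip1[of s t] c_lip1[of t s] by (simp add: abs_minus_commute abs_le_iff)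
  have c_P: "c p = e p" if "p \<in> P" for p
  proof (rule antisym)
    show "e p \<le> c p" using c_ge[OF that, of p] by simp
    show "c p \<le> e p"
    proof (rule c_le)
      fix p' assume p': "p' \<in> P"
      show "max 0 (e p' - \<kappa> * \<bar>p - p'\<bar>) \<le> e p"
      proof (cases "p' = p")
        case False
        then have "\<kappa> * \<Delta> \<le> \<kappa> * \<bar>p - p'\<bar>" using \<kappa>0 \<Delta>(2)[OF that p'] by (intro mult_left_mono) auto
        moreover have "\<kappa> * \<Delta> = 1 / real m" using \<Delta>(1) by (simp add: \<kappa>_def)
        ultimately show ?thesis using e(2)[of p'] e(1)[of p] by simp
      qed (use e in auto)
    qed
  qed
  define l where "l t = t + c t" for t
  \<comment> \<open>The tent at 0 has height 0 and suppresses all others there: this is why 0 was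
    put into \<open>P\<close>.\<close>
  have c0: "c 0 = 0" using c_P[OF P(2)] by (simp add: e_def)
  have kh: "\<kappa> \<le> 1/2" using m by (simp add: \<kappa>_def)
  have \<Lambda>: "l \<in> skor_Lambda" "skor_gamma l \<le> 2 * \<kappa>"
    using time_shift_skor_Lambda[of c \<kappa>, OF c0 c_nn c_lip kh] by (simp_all add: l_def[abs_def])
  have l_mono: "l s \<le> l t \<longleftrightarrow> s \<le> t" if "0 \<le> s" "0 \<le> t" for s t
    using \<Lambda>(1) that by (intro strict_mono_on_less_eq[of "{0..}"]) (auto simp: skor_Lambda_def)
  have l_P: "l p = real_of_int \<lceil>real m * p\<rceil> / real m" if "p \<in> P" for p
    using c_P[OF that] by (simp add: l_def e_def)
  define g where "g s = real_of_int \<lfloor>real m * s\<rfloor> / real m" for s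
  have g: "g s \<le> s" "s - 1 / real m < g s" for s
  proof -
    have "real_of_int \<lfloor>real m * s\<rfloor> \<le> real m * s" "real m * s - 1 < real_of_int \<lfloor>real m * s\<rfloor>" by linarith+
    then have "real_of_int \<lfloor>real m * s\<rfloor> / real m \<le> s" "(real m * s - 1) / real m < real_of_int \<lfloor>real m * s\<rfloor> / real m"
      using mp by (auto simp: pos_divide_le_eq mult.commute intro!: divide_strict_right_mono)
    moreover have "(real m * s - 1) / real m = s - 1 / real m" using mp by (simp add: diff_divide_distrib)
    ultimately show "g s \<le> s" "s - 1 / real m < g s" by (simp_all add: g_def)
  qed
  have g0: "0 \<le> g s" if "0 \<le> s" for s using that mp by (simp add: g_def)
  \<comment> \<open>\<open>l\<close> sends the points of \<open>P\<close> to grid times, so the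
    sampling point \<open>g (l t)\<close> has passed exactly those points of \<open>P\<close> that
    \<open>t\<close> has passed. The oscillation bound then applies between the two.\<close>
  have same_side: "p \<le> t \<longleftrightarrow> p \<le> g (l t)" if "p \<in> P" "0 \<le> t" for p t
  proof -
    have "p \<le> t \<longleftrightarrow> l p \<le> l t" using l_mono[of p t] that P by auto
    also have "\<dots> \<longleftrightarrow> real_of_int \<lceil>real m * p\<rceil> \<le> real m * l t"
      using mp by (simp add: l_P[OF that(1)] pos_divide_le_eq mult.commute)
    also have "\<dots> \<longleftrightarrow> \<lceil>real m * p\<rceil> \<le> \<lfloor>real m * l t\<rfloor>" by (simp add: le_floor_iff)
    also have "\<dots> \<longleftrightarrow> real m * p \<le> real_of_int \<lfloor>real m * l t\<rfloor>" by (simp add: ceiling_le_iff)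
    also have "\<dots> \<longleftrightarrow> p \<le> g (l t)" using mp by (simp add: g_def pos_le_divide_eq mult.commute)
    finally show ?thesis .
  qed
  have U: "x t \<in> U_set" if "0 \<le> t" for t using x that by (auto simp: D_U_def)
  have osc': "rho (x s) (x t) \<le> \<epsilon>"
    if "0 \<le> s" "0 \<le> t" "s \<le> T + 1" "t \<le> T + 1" "\<And>p. p \<in> P \<Longrightarrow> p \<le> s \<longleftrightarrow> p \<le> t" for s t
  proof (cases "s \<le> t")
    case True
    show ?thesis by (rule osc) (use that True in force)+
  next
    case False
    have "rho (x t) (x s) \<le> \<epsilon>" by (rule osc) (use that False in force)+
    then show ?thesis by (simp add: rho_commute)
  qed
  have approx: "rho (x s) (path_approx m x t) \<le> \<epsilon> + 1 / real m"
    if "0 \<le> s" "0 \<le> t" "s \<le> T + 1" "t \<le> T + 1" "rho (x s) (x (g t)) \<le> \<epsilon>" for s t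
  proof -
    have "real m * t \<le> real m * real m" using that m by (intro mult_left_mono) auto
    then have "\<lfloor>real m * t\<rfloor> \<le> int (m * m)" by (simp add: floor_le_iff)
    then have "nat \<lfloor>real m * t\<rfloor> \<le> m * m" by linarith
    moreover have "0 \<le> \<lfloor>real m * t\<rfloor>" using that by simp
    ultimately have "real (min (nat \<lfloor>real m * t\<rfloor>) (m * m)) / real m = g t"
      unfolding g_def by (simp add: min_def)
    then have "path_approx m x t = quantize m (x (g t))" by (simp add: path_approx_def)
    then show ?thesis
      using rho_triangle[of "x s" "x (g t)" "path_approx m x t"] rho_quantize[of "x (g t)" m] that
        U[of s] U[OF g0[OF that(2)]] quantize_U[of "x (g t)" m] m1' by auto
  qed
  \<comment> \<open>Truncation at \<open>u\<close> can stop the two paths at different arguments, at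
    most \<open>1 / m\<close> apart. If \<open>u\<close> is more than \<open>1 / m\<close> past
    every point of \<open>P\<close> that it has passed, then \<open>g u\<close> and
    \<open>min t u\<close> are still on the same side of \<open>P\<close>; the other
    \<open>u\<close> are declared exceptional.\<close>
  define B where "B = (\<Union>p\<in>P. {p .. p + 1 / real m})"
  have mB: "emeasure lborel B \<le> ennreal (real (card P) * (1 / real m))"
  proof -
    have "emeasure lborel B \<le> (\<Sum>p\<in>P. emeasure lborel {p .. p + 1 / real m})"
      unfolding B_def by (rule emeasure_subadditive_finite) (use P in auto)
    also have "\<dots> = (\<Sum>p\<in>P. ennreal (1 / real m))" using mp by simp
    also have "\<dots> = ennreal (real (card P) * (1 / real m))"
      by (simp add: ennreal_of_nat_eq_real_of_nat flip: ennreal_mult)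
    finally show ?thesis .
  qed
  have "skor_dist x (path_approx m x) \<le> max (2 * \<kappa>) ((\<epsilon> + 1 / real m) + real (card P) * (1 / real m) + exp (- T))"
  proof (rule skor_dist_le[OF \<Lambda>])
    show "B \<in> sets lborel" unfolding B_def using P(1) by (intro sets.finite_UN) auto
    show "emeasure lborel B < \<infinity>" using mB by (rule order.strict_trans1) simp
    show "measure lborel B \<le> real (card P) * (1 / real m)"
      unfolding measure_def using mB by (intro enn2real_leI) auto
    show "0 \<le> T" "0 \<le> \<epsilon> + 1 / real m" using assms mp by auto
    fix u t :: real assume u: "0 \<le> u" "u \<le> T" "u \<notin> B" and t: "0 \<le> t"
    have lt: "t \<le> l t" "l t \<le> t + 1 / real m" using c_nn[of t] c_m[of t] by (auto simp: l_def)
    have m1r: "1 / real m \<le> 1" using m1 by simp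
    show "rho (x (min t u)) (path_approx m x (min (l t) u)) \<le> \<epsilon> + 1 / real m"
    proof (cases "l t \<le> u")
      case True
      then have "rho (x t) (path_approx m x (l t)) \<le> \<epsilon> + 1 / real m"
        using lt t u g(1)[of "l t"] g0[of "l t"] by (intro approx osc' same_side) auto
      then show ?thesis using True lt by simp
    next
      case False
      have "rho (x (min t u)) (path_approx m x u) \<le> \<epsilon> + 1 / real m"
      proof (intro approx osc')
        fix p assume p: "p \<in> P"
        then have "u < p \<or> p + 1 / real m < u" using u(3) by (force simp: B_def)
        moreover have "u - 1 / real m \<le> min t u" using lt False mp by (auto simp: min_def)
        ultimately show "p \<le> min t u \<longleftrightarrow> p \<le> g u" using g[of u] by linarith
      qed (use u t g[of u] g0[of u] in auto)
      then show ?thesis using False by simp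
    qed
  qed
  then show ?thesis by (simp add: \<kappa>_def)
qed

lemma skor_dist_path_approx:
  assumes x: "x \<in> D_U" and "e > 0"
  shows "eventually (\<lambda>m. skor_dist x (path_approx m x) < e) sequentially"
proof -
  obtain T :: real where T: "T > 0" "exp (- T) < e / 4" using exp_neg_small[of "e / 4"] \<open>e > 0\<close> by auto
  obtain P0 where P0: "finite P0"
    "\<And>s t. 0 \<le> s \<Longrightarrow> s \<le> t \<Longrightarrow> t \<le> T + 1 \<Longrightarrow> P0 \<inter> {s<..t} = {} \<Longrightarrow> rho (x s) (x t) \<le> e / 4"
    using D_U_partition[OF x, of "e / 4" "T + 1"] T \<open>e > 0\<close> by (auto simp del: Int_iff) 
  define P where "P = insert 0 (P0 \<inter> {0..})"
  have P: "finite P" "0 \<in> P" "P \<subseteq> {0..}" using P0 by (auto simp: P_def)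
  have osc: "rho (x s) (x t) \<le> e / 4" if "0 \<le> s" "s \<le> t" "t \<le> T + 1" "P \<inter> {s<..t} = {}" for s t
    by (rule P0) (use that in \<open>auto simp: P_def\<close>)
  obtain \<Delta> where \<Delta>: "\<Delta> > 0" "\<And>p p'. p \<in> P \<Longrightarrow> p' \<in> P \<Longrightarrow> p \<noteq> p' \<Longrightarrow> \<Delta> \<le> \<bar>p - p'\<bar>"
    using finite_set_gap[OF P(1)] by metis
  have "eventually (\<lambda>m. real m \<ge> T + 1) sequentially" by real_asymp
  moreover have "eventually (\<lambda>m. 1 / (real m * \<Delta>) < min (1/2) (e / 2)) sequentially"
  proof -
    have "(\<lambda>m. 1 / (real m * \<Delta>)) \<longlonglongrightarrow> 0" using \<Delta>(1) by real_asymp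
    then show ?thesis using \<open>e > 0\<close> by (intro order_tendstoD) auto
  qed
  moreover have "eventually (\<lambda>m. 1 / real m + real (card P) * (1 / real m) < e / 4) sequentially"
  proof -
    have "(\<lambda>m. 1 / real m + real (card P) * (1 / real m)) \<longlonglongrightarrow> 0" by real_asymp
    then show ?thesis using \<open>e > 0\<close> by (intro order_tendstoD) auto
  qed
  ultimately show ?thesis
  proof eventually_elim
    case (elim m)
    have "skor_dist x (path_approx m x)
      \<le> max (2 * (1 / (real m * \<Delta>))) ((e / 4 + 1 / real m) + real (card P) * (1 / real m) + exp (- T))"
      by (rule skor_dist_path_approx_le[OF x _ less_imp_le[OF T(1)] P osc \<Delta>]) (use elim \<open>e > 0\<close> in auto)
    also have "\<dots> < e" using elim T \<open>e > 0\<close> unfolding max_less_iff_conj min_less_iff_conj by linarith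
    finally show ?case .
  qed
qed

lemma skor_bcont_tendsto:
  assumes F: "skor_bcont F" and x: "x \<in> D_U" and y: "\<And>m. y m \<in> D_U"
    and conv: "\<And>e. e > 0 \<Longrightarrow> eventually (\<lambda>m. skor_dist x (y m) < e) sequentially"
  shows "(\<lambda>m. F (y m)) \<longlonglongrightarrow> F x"
proof (rule tendstoI)
  fix e :: real assume "e > 0"
  then obtain \<delta> where \<delta>: "\<delta> > 0" "\<And>y. y \<in> D_U \<Longrightarrow> skor_dist x y < \<delta> \<Longrightarrow> \<bar>F y - F x\<bar> < e"
    using F x unfolding skor_bcont_def by metis
  show "eventually (\<lambda>m. dist (F (y m)) (F x) < e) sequentially"
    using conv[OF \<delta>(1)] by eventually_elim (use \<delta>(2) y in \<open>auto simp: dist_real_def\<close>)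
qed

lemma path_code_measurable:
  assumes [measurable]: "\<And>t k. (\<lambda>\<omega>. X \<omega> t k) \<in> borel_measurable M"
  shows "(\<lambda>\<omega>. path_code m (X \<omega>)) \<in> measurable M (count_space UNIV)"
proof (subst measurable_count_space_eq2_countable)
  have "(\<lambda>\<omega>. path_code m (X \<omega>)) -` {cs} \<inter> space M \<in> sets M" for cs
  proof (cases "length cs = Suc (m * m) \<and> (\<forall>i<Suc (m * m). length (cs ! i) = Suc m)")
    case True
    then have "(\<lambda>\<omega>. path_code m (X \<omega>)) -` {cs} \<inter> space M
      = {\<omega>\<in>space M. \<forall>i<Suc (m * m). \<forall>k<Suc m. \<lfloor>real m * X \<omega> (real i / real m) k\<rfloor> = cs ! i ! k}"
      by (auto simp: path_code_def list_eq_iff_nth_eq simp del: upt_Suc)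
    also have "\<dots> \<in> sets M" by measurable
    finally show ?thesis .
  next
    case False
    then have "(\<lambda>\<omega>. path_code m (X \<omega>)) -` {cs} \<inter> space M = {}"
      by (auto simp: path_code_def simp del: upt_Suc)
    then show ?thesis by simp
  qed
  then show "(\<lambda>\<omega>. path_code m (X \<omega>)) \<in> space M \<rightarrow> UNIV \<and>
    (\<forall>cs\<in>UNIV. (\<lambda>\<omega>. path_code m (X \<omega>)) -` {cs} \<inter> space M \<in> sets M)" by simp
qed

text \<open>Continuity for \<open>skor_dist\<close> is the only handle on \<open>F\<close>: along
  each path its value is the limit of the values at the step approximations, and these factor
  through the countable code.\<close>

lemma skor_bcont_measurable:
  assumes X: "\<And>t k. (\<lambda>\<omega>. X \<omega> t k) \<in> borel_measurable M" and D: "\<And>\<omega>. \<omega> \<in> space M \<Longrightarrow> X \<omega> \<in> D_U"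
    and F: "skor_bcont F"
  shows "(\<lambda>\<omega>. F (X \<omega>)) \<in> borel_measurable M"
proof (rule borel_measurable_LIMSEQ_real)
  show "(\<lambda>\<omega>. F (path_approx (Suc m) (X \<omega>))) \<in> borel_measurable M" for m
    unfolding path_decode_code[symmetric]
    by (rule measurable_compose[OF path_code_measurable[OF X]]) simp
  show "(\<lambda>m. F (path_approx (Suc m) (X \<omega>))) \<longlonglongrightarrow> F (X \<omega>)" if "\<omega> \<in> space M" for \<omega>
    using skor_dist_path_approx[OF D[OF that]]
    by (intro skor_bcont_tendsto[OF F D[OF that]] path_approx_D_U[OF D[OF that]])
      (auto simp: eventually_sequentially_Suc[of "\<lambda>m. skor_dist _ (path_approx m _) < _"])
qed

section \<open>A continuous surjection of the real line onto the state space\<close>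

text \<open>Schoenberg's space-filling construction: every state is the image of a point of the Cantor set
  whose ternary digits list the binary digits of all its coordinates. It reduces weak compactness of laws on the
  state space to Helly's theorem on the real line.\<close>

definition tooth :: "real \<Rightarrow> real" where
  "tooth x = max 0 (min 1 (1/2 - cos (pi * x)))"

lemma tooth_bounds: "0 \<le> tooth x" "tooth x \<le> 1"
  by (auto simp: tooth_def)

lemma continuous_on_tooth:
  fixes f :: "real \<Rightarrow> real"
  shows "continuous_on S f \<Longrightarrow> continuous_on S (\<lambda>x. tooth (f x))"
  unfolding tooth_def by (intro continuous_intros) auto

text \<open>A clamped cosine replaces Schoenberg's piecewise linear function, so that continuity and
  period 2 are inherited from \<open>cos\<close>. Period 2 is the right one because shifting Cantor
  digits past the ternary point adds even integers.\<close>

lemma tooth_periodic: "tooth (2 * real_of_int n + x) = tooth x"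
proof -
  have "pi * (2 * real_of_int n + x) = pi * x + 2 * pi * real_of_int n" by (simp add: algebra_simps)
  then have "cos (pi * (2 * real_of_int n + x)) = cos (pi * x)"
    using sin_int_2pin[of n] cos_int_2pin[of n] by (simp add: cos_add)
  then show ?thesis by (simp add: tooth_def)
qed

lemma tooth_eq_0:
  assumes "0 \<le> x" "x \<le> 1/3"
  shows "tooth x = 0"
proof -
  have "cos (pi / 3) \<le> cos (pi * x)"
    using assms by (intro cos_monotone_0_pi_le) (auto simp: field_simps)
  then show ?thesis by (simp add: tooth_def cos_60)
qed

lemma tooth_eq_1:
  assumes "2/3 \<le> x" "x \<le> 1"
  shows "tooth x = 1"
proof -
  have "cos (pi * x) \<le> cos (2 * pi / 3)"
    using assms pi_gt_zero by (intro cos_monotone_0_pi_le) (auto simp: field_simps)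
  then show ?thesis by (simp add: tooth_def cos_120)
qed

definition cantor_point :: "(nat \<Rightarrow> real) \<Rightarrow> real" where
  "cantor_point b = (\<Sum>i. 2 * b i / 3 ^ Suc i)"

lemma cantor_sum: "(\<lambda>i. 2 / 3 ^ Suc i :: real) sums 1"
proof -
  have "(\<lambda>i. (2/3) * (1/3) ^ i :: real) sums ((2/3) * (1 / (1 - 1/3)))"
    by (intro sums_mult geometric_sums) auto
  then show ?thesis by (simp add: power_one_over divide_simps)
qed

context
  fixes b :: "nat \<Rightarrow> real"
  assumes b01: "\<And>i. b i \<in> {0, 1}"
begin

lemma cantor_le: "0 \<le> 2 * b i / 3 ^ Suc i" "2 * b i / 3 ^ Suc i \<le> 2 / 3 ^ Suc i"
  using b01[of i] by auto

lemma cantor_summable: "summable (\<lambda>i. 2 * b i / 3 ^ Suc i)"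
  by (rule summable_comparison_test'[OF sums_summable[OF cantor_sum], where N=0]) 
    (use cantor_le in \<open>simp only: real_norm_def abs_of_nonneg\<close>)

lemma cantor_point_bounds: "0 \<le> cantor_point b" "cantor_point b \<le> 1"
proof -
  show "0 \<le> cantor_point b" unfolding cantor_point_def
    by (rule suminf_nonneg[OF cantor_summable cantor_le(1)])
  have "cantor_point b \<le> (\<Sum>i. 2 / 3 ^ Suc i)" unfolding cantor_point_def
    by (rule suminf_le[OF cantor_le(2) cantor_summable sums_summable[OF cantor_sum]])
  then show "cantor_point b \<le> 1" using sums_unique[OF cantor_sum] by simp
qed

lemma cantor_point_shift: "3 * cantor_point b = 2 * b 0 + cantor_point (\<lambda>i. b (Suc i))"
proof -
  have "cantor_point b = (\<Sum>i. 2 * b (Suc i) / 3 ^ Suc (Suc i)) + 2 * b 0 / 3 ^ Suc 0"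
    unfolding cantor_point_def using suminf_split_head[OF cantor_summable] by simp
  also have "(\<Sum>i. 2 * b (Suc i) / 3 ^ Suc (Suc i)) = (\<Sum>i. 1/3 * (2 * b (Suc i) / 3 ^ Suc i))"
    by (simp add: field_simps)
  also have "\<dots> = 1/3 * cantor_point (\<lambda>i. b (Suc i))"
    unfolding cantor_point_def
  proof (rule suminf_mult)
    have "summable (\<lambda>i. 3 * (2 * b (Suc i) / 3 ^ Suc (Suc i)))"
      using cantor_summable by (intro summable_mult) (subst summable_Suc_iff)
    then show "summable (\<lambda>i. 2 * b (Suc i) / 3 ^ Suc i)" by simp
  qed
  finally show ?thesis by simp
qed

end

text \<open>The leading ternary digit 0 or 2 places the point in [0, 1/3] or in [2/3, 1], where
  \<open>tooth\<close> is constant.\<close>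

lemma tooth_cantor_point_0:
  assumes "\<And>i. b i \<in> {0, 1}"
  shows "tooth (cantor_point b) = b 0"
proof -
  have "0 \<le> cantor_point (\<lambda>i. b (Suc i))" "cantor_point (\<lambda>i. b (Suc i)) \<le> 1"
    using cantor_point_bounds[of "\<lambda>i. b (Suc i)"] assms by auto
  then show ?thesis
    using cantor_point_shift[of b, OF assms] assms[of 0] tooth_eq_0[of "cantor_point b"] tooth_eq_1[of "cantor_point b"]
    by auto
qed

text \<open>Multiplying by \<open>3 ^ i\<close> moves the first \<open>i\<close> ternary digits to
  the left of the point, where, each being 0 or 2, they form an even integer that
  \<open>tooth\<close> ignores.\<close>

lemma tooth_cantor_point:
  assumes b: "\<And>i. b i \<in> {0, 1}"
  shows "tooth (3 ^ i * cantor_point b) = b i"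
proof -
  have "\<exists>n. 3 ^ i * cantor_point b = 2 * real_of_int n + cantor_point (\<lambda>j. b (j + i))"
  proof (induction i)
    case 0
    show ?case by (intro exI[of _ 0]) simp
  next
    case (Suc i)
    then obtain n where n: "3 ^ i * cantor_point b = 2 * real_of_int n + cantor_point (\<lambda>j. b (j + i))" by blast
    have "\<exists>a::int. b i = real_of_int a" using b[of i] by (metis empty_iff insert_iff of_int_0 of_int_1)
    then obtain a :: int where a: "b i = real_of_int a" by blast
    have "3 ^ Suc i * cantor_point b = 3 * (2 * real_of_int n) + 3 * cantor_point (\<lambda>j. b (j + i))"
      using n by (simp add: algebra_simps)
    also have "3 * cantor_point (\<lambda>j. b (j + i)) = 2 * real_of_int a + cantor_point (\<lambda>j. b (j + Suc i))"
      using cantor_point_shift[of "\<lambda>j. b (j + i)"] b a by simp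
    finally show ?case by (intro exI[of _ "3 * n + a"]) (simp add: algebra_simps)
  qed
  then obtain n where "3 ^ i * cantor_point b = 2 * real_of_int n + cantor_point (\<lambda>j. b (j + i))" by blast
  then show ?thesis
    using tooth_cantor_point_0[of "\<lambda>j. b (j + i)"] b by (simp add: tooth_periodic)
qed

section \<open>Binary expansions and the coding of states\<close>

definition binary_digit :: "real \<Rightarrow> nat \<Rightarrow> real" where
  "binary_digit x j = real_of_int (\<lfloor>2 ^ Suc j * x\<rfloor> - 2 * \<lfloor>2 ^ j * x\<rfloor>)"

lemma binary_digit_01: "binary_digit x j \<in> {0, 1}"
proof -
  have "\<lfloor>2 * (2 ^ j * x)\<rfloor> - 2 * \<lfloor>2 ^ j * x\<rfloor> \<in> {0, 1}" by (simp, linarith)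
  then show ?thesis by (auto simp: binary_digit_def mult.assoc)
qed

lemma binary_digit_sums:
  assumes "0 \<le> x" "x < 1"
  shows "(\<lambda>j. binary_digit x j / 2 ^ Suc j) sums x"
proof -
  \<comment> \<open>The digits telescope; the case \<open>n = 0\<close> is where
    \<open>x < 1\<close> enters.\<close>
  have part: "(\<Sum>j<n. binary_digit x j / 2 ^ Suc j) = real_of_int \<lfloor>2 ^ n * x\<rfloor> / 2 ^ n" for n
  proof (induction n)
    case 0
    then show ?case using assms by (simp add: floor_eq_iff)
  next
    case (Suc n)
    then show ?case by (simp add: binary_digit_def field_simps)
  qed
  have "\<bar>real_of_int \<lfloor>2 ^ n * x\<rfloor> / 2 ^ n - x\<bar> \<le> (1/2) ^ n" for n
  proof -
    have "\<bar>real_of_int \<lfloor>2 ^ n * x\<rfloor> - 2 ^ n * x\<bar> \<le> 1" by linarith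
    moreover have "real_of_int \<lfloor>2 ^ n * x\<rfloor> / 2 ^ n - x = (real_of_int \<lfloor>2 ^ n * x\<rfloor> - 2 ^ n * x) / 2 ^ n"
      by (simp add: field_simps)
    ultimately show ?thesis by (simp add: abs_divide divide_right_mono power_one_over)
  qed
  then have "(\<lambda>n. real_of_int \<lfloor>2 ^ n * x\<rfloor> / 2 ^ n - x) \<longlonglongrightarrow> 0"
    by (intro Lim_null_comparison[OF _ LIMSEQ_power_zero[of "1/2::real"]]) auto
  then show ?thesis unfolding sums_def part by (simp add: LIM_zero_iff)
qed

text \<open>The coordinates are halved so that only binary expansions of numbers below \<open>1\<close> occur.\<close>

definition schoenberg :: "nat \<Rightarrow> real \<Rightarrow> real" where
  "schoenberg k t = 2 * (\<Sum>j. tooth (3 ^ prod_encode (k, j) * t) / 2 ^ Suc j)"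

definition state_code :: "(nat \<Rightarrow> real) \<Rightarrow> real" where
  "state_code u = cantor_point (\<lambda>i. case prod_decode i of (k, j) \<Rightarrow> binary_digit (u k / 2) j)"

lemma state_code_bounds: "0 \<le> state_code u" "state_code u \<le> 1"
  unfolding state_code_def
  by (intro cantor_point_bounds; use binary_digit_01 in \<open>auto split: prod.splits\<close>)+

lemma schoenberg_state_code:
  assumes "u \<in> U_set"
  shows "schoenberg k (state_code u) = u k"
proof -
  have "tooth (3 ^ prod_encode (k, j) * state_code u) = binary_digit (u k / 2) j" for j
    unfolding state_code_def by (subst tooth_cantor_point) (use binary_digit_01 in \<open>auto split: prod.splits\<close>)
  moreover have "(\<Sum>j. binary_digit (u k / 2) j / 2 ^ Suc j) = u k / 2"
    using U_set_nonneg[OF assms, of k] U_set_le_1[OF assms, of k]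
    by (intro sums_unique[symmetric] binary_digit_sums) auto
  ultimately show ?thesis by (simp add: schoenberg_def)
qed

text \<open>The code has to be measurable, to push laws forward to the line; continuity is asked of
  the decoding, for weak convergence.\<close>

lemma state_code_measurable:
  assumes [measurable]: "\<And>k. (\<lambda>\<omega>. u \<omega> k) \<in> borel_measurable M"
  shows "(\<lambda>\<omega>. state_code (u \<omega>)) \<in> borel_measurable M"
  unfolding state_code_def cantor_point_def binary_digit_def case_prod_beta
  by (intro borel_measurable_suminf) measurable

lemma continuous_schoenberg: "continuous_on UNIV (schoenberg k)"
proof -
  have "uniform_limit UNIV (\<lambda>n t. \<Sum>j<n. tooth (3 ^ prod_encode (k, j) * t) / 2 ^ Suc j)
     (\<lambda>t. \<Sum>j. tooth (3 ^ prod_encode (k, j) * t) / 2 ^ Suc j) sequentially"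
  proof (rule Weierstrass_m_test)
    show "norm (tooth (3 ^ prod_encode (k, j) * t) / 2 ^ Suc j) \<le> (1/2) ^ Suc j" for j t
      using tooth_bounds by (simp add: abs_divide divide_right_mono power_one_over)
    show "summable (\<lambda>j. (1/2::real) ^ Suc j)"
      by (subst summable_Suc_iff) (rule summable_geometric, simp)
  qed
  then have "continuous_on UNIV (\<lambda>t. \<Sum>j. tooth (3 ^ prod_encode (k, j) * t) / 2 ^ Suc j)"
    by (rule uniform_limit_theorem[rotated])
      (auto intro!: always_eventually continuous_intros continuous_on_tooth)
  then show ?thesis unfolding schoenberg_def[abs_def] by (intro continuous_intros)
qed

text \<open>At points that are not codes the sequence of values \<open>schoenberg k t\<close> need
  not be a state. This continuous retraction fixes \<open>U_set\<close> pointwise and makes the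
  parametrization state-valued on the whole line.\<close>

primrec retract_U :: "(nat \<Rightarrow> real) \<Rightarrow> nat \<Rightarrow> real" where
  "retract_U w 0 = 1"
| "retract_U w (Suc k) = max 0 (min (retract_U w k) (w (Suc k)))"

lemma retract_U_in_U: "retract_U w \<in> U_set"
proof (rule U_setI)
  show nn: "0 \<le> retract_U w k" for k by (cases k) auto
  show "retract_U w (Suc k) \<le> retract_U w k" for k using nn[of k] by simp
qed simp

lemma retract_U_id:
  assumes "u \<in> U_set"
  shows "retract_U u = u"
proof
  show "retract_U u k = u k" for k
  proof (induction k)
    case (Suc k)
    then show ?case using U_set_Suc[OF assms, of k] U_set_nonneg[OF assms, of "Suc k"] by simp
  qed (simp add: U_set_0[OF assms])
qed

definition param_U :: "real \<Rightarrow> nat \<Rightarrow> real" where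
  "param_U t = retract_U (\<lambda>k. schoenberg k t)"

lemma param_U_in_U: "param_U t \<in> U_set"
  by (simp add: param_U_def retract_U_in_U)

lemma param_U_state_code: "u \<in> U_set \<Longrightarrow> param_U (state_code u) = u"
  by (simp add: param_U_def schoenberg_state_code retract_U_id)

lemma continuous_param_U: "continuous_on UNIV (\<lambda>t. param_U t k)"
  unfolding param_U_def
proof (induction k)
  case (Suc k)
  have "continuous_on UNIV (\<lambda>t. schoenberg (Suc k) t)"
    using continuous_schoenberg[of "Suc k"] by simp
  with Suc show ?case by (auto intro!: continuous_intros)
qed simp

lemma param_U_sequentially:
  assumes s: "s \<longlonglongrightarrow> t" and e: "e > 0"
  shows "eventually (\<lambda>n. rho (param_U (s n)) (param_U t) < e) sequentially"
proof -
  obtain K :: nat where K: "1 / real (Suc K) < e"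
    using nat_approx_posE[OF e] by auto
  have "eventually (\<lambda>n. \<bar>param_U (s n) k - param_U t k\<bar> < e / 2) sequentially" for k
  proof -
    have "isCont (\<lambda>t. param_U t k) t"
      using continuous_param_U[of k] by (simp add: continuous_on_eq_continuous_at)
    then have "(\<lambda>n. param_U (s n) k) \<longlonglongrightarrow> param_U t k"
      using s by (rule isCont_tendsto_compose)
    then show ?thesis using tendstoD[of _ _ _ "e / 2"] e by (fastforce simp: dist_real_def)
  qed
  then have "eventually (\<lambda>n. \<forall>k\<in>{..Suc K}. \<bar>param_U (s n) k - param_U t k\<bar> < e / 2) sequentially"
    by (intro eventually_ball_finite) auto
  then show ?thesis
  proof eventually_elim
    case (elim n)
    have "rho (param_U (s n)) (param_U t) \<le> max (e / 2) (1 / real (Suc K))"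
    proof (rule rho_le_of_coordinates[OF param_U_in_U param_U_in_U])
      fix k assume k: "1 \<le> k" "k \<le> Suc K"
      then have "\<bar>param_U (s n) k - param_U t k\<bar> \<le> 1 * (e / 2)" using elim by force
      also have "\<dots> \<le> real k * (e / 2)" using k e by (intro mult_right_mono) auto
      finally show "\<bar>param_U (s n) k - param_U t k\<bar> \<le> real k * (e / 2)" .
    qed (use e in auto)
    also have "\<dots> < e" using K e by simp
    finally show ?case .
  qed
qed

section \<open>Expectations under probability mass functions\<close>

text \<open>The bound is asked for on the support only: the chain stays among states, whereas a
  coordinate is an unbounded function on all sequences.\<close>

lemma integral_bind_pmf_bounded:
  fixes f :: "'b \<Rightarrow> real"
  assumes f: "\<And>y. y \<in> set_pmf (bind_pmf M N) \<Longrightarrow> 0 \<le> f y \<and> f y \<le> B"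
  shows "measure_pmf.expectation (bind_pmf M N) f
    = measure_pmf.expectation M (\<lambda>x. measure_pmf.expectation (N x) f)"
proof -
  have fN: "AE y in measure_pmf (N x). 0 \<le> f y \<and> f y \<le> B" if "x \<in> set_pmf M" for x
    using f that by (auto simp: AE_measure_pmf_iff)
  have int: "integrable (N x) f" if "x \<in> set_pmf M" for x
    by (rule measure_pmf.integrable_const_bound[where B=B]) (use fN[OF that] in \<open>auto elim: AE_mp\<close>)
  have nn: "(\<integral>\<^sup>+ y. ennreal (f y) \<partial>N x) = ennreal (measure_pmf.expectation (N x) f)" if "x \<in> set_pmf M" for x
    by (rule nn_integral_eq_integral[OF int[OF that]]) (use fN[OF that] in \<open>auto elim: AE_mp\<close>)
  have "measure_pmf.expectation (bind_pmf M N) f = enn2real (\<integral>\<^sup>+ y. ennreal (f y) \<partial>bind_pmf M N)"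
    by (rule integral_eq_nn_integral) (use f in \<open>auto simp: AE_measure_pmf_iff\<close>)
  also have "(\<integral>\<^sup>+ y. ennreal (f y) \<partial>bind_pmf M N) = (\<integral>\<^sup>+ x. ennreal (measure_pmf.expectation (N x) f) \<partial>M)"
    unfolding nn_integral_bind_pmf by (rule nn_integral_cong_AE) (use nn in \<open>auto simp: AE_measure_pmf_iff\<close>)
  also have "enn2real \<dots> = measure_pmf.expectation M (\<lambda>x. measure_pmf.expectation (N x) f)"
    using fN by (intro integral_eq_nn_integral[symmetric]) (auto simp: AE_measure_pmf_iff intro!: integral_nonneg_AE)
  finally show ?thesis .
qed

lemma expectation_pmf_eq_infsum:
  fixes f :: "'a \<Rightarrow> real"
  assumes f: "\<And>x. \<bar>f x\<bar> \<le> B"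
  shows "measure_pmf.expectation p f = infsum (\<lambda>x. pmf p x * f x) UNIV"
    and "Infinite_Set_Sum.abs_summable_on (\<lambda>x. pmf p x * f x) UNIV"
proof -
  show *: "Infinite_Set_Sum.abs_summable_on (\<lambda>x. pmf p x * f x) UNIV"
  proof (rule Infinite_Set_Sum.abs_summable_on_comparison_test)
    show "Infinite_Set_Sum.abs_summable_on (\<lambda>x. B * pmf p x) UNIV"
      by (intro Infinite_Set_Sum.abs_summable_on_cmult_right pmf_abs_summable)
    show "norm (pmf p x * f x) \<le> norm (B * pmf p x)" for x
    proof -
      have "0 \<le> B" using f[of x] by linarith
      then show ?thesis using mult_left_mono[OF f[of x] pmf_nonneg[of p x]] by (simp add: abs_mult mult.commute)
    qed
  qed
  show "measure_pmf.expectation p f = infsum (\<lambda>x. pmf p x * f x) UNIV"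
    by (simp add: pmf_expectation_eq_infsetsum infsetsum_infsum[OF *])
qed

lemma has_bochner_integral_pmf_nat:
  fixes p :: "nat pmf" and f :: "nat \<Rightarrow> real"
  assumes "\<And>j. 0 \<le> f j" "(\<lambda>j. pmf p j * f j) sums s"
  shows "has_bochner_integral (measure_pmf p) f s"
proof (rule has_bochner_integral_nn_integral)
  have "(\<integral>\<^sup>+ j. ennreal (f j) \<partial>p) = (\<Sum>j. ennreal (pmf p j * f j))"
    by (simp add: nn_integral_measure_pmf nn_integral_count_space_nat ennreal_mult' assms)
  also have "\<dots> = ennreal s" by (rule suminf_ennreal_eq) (use assms in auto)
  finally show "(\<integral>\<^sup>+ j. ennreal (f j) \<partial>p) = ennreal s" .
  show "0 \<le> s" using sums_le[OF _ sums_zero assms(2)] assms(1) by simp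
qed (use assms in auto)

lemma poisson_moments:
  assumes r: "r > 0"
  shows "has_bochner_integral (measure_pmf (poisson_pmf r)) real r"
    and "has_bochner_integral (measure_pmf (poisson_pmf r)) (\<lambda>j. (real j)\<^sup>2) (r + r\<^sup>2)"
proof -
  have e0: "(\<lambda>i. r ^ i / fact i * exp (- r)) sums 1"
    using sums_mult2[OF exp_converges[of r], of "exp (- r)"] by (simp add: divide_inverse mult_ac exp_minus)
  \<comment> \<open>The identity E[J f(J)] = r E[f(J + 1)] for a Poisson variable J; constant
    \<open>f\<close> and a linear \<open>f\<close> give the two moments.\<close>
  have shift: "(\<lambda>i. (r ^ i / fact i * exp (- r)) * real i * f i) sums s"
    if "(\<lambda>i. r * ((r ^ i / fact i * exp (- r)) * f (Suc i))) sums s" for f :: "nat \<Rightarrow> real" and s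
  proof -
    have "(\<lambda>i. (r ^ Suc i / fact (Suc i) * exp (- r)) * real (Suc i) * f (Suc i))
       = (\<lambda>i. r * ((r ^ i / fact i * exp (- r)) * f (Suc i)))"
      by (rule ext) (simp add: fact_Suc del: of_nat_Suc)
    with that have "(\<lambda>i. (r ^ Suc i / fact (Suc i) * exp (- r)) * real (Suc i) * f (Suc i)) sums s" by simp
    from sums_Suc[OF this] show ?thesis by simp
  qed
  have e1: "(\<lambda>i. (r ^ i / fact i * exp (- r)) * real i) sums r"
    using shift[of "\<lambda>_. 1" r] sums_mult[OF e0, of r] by simp
  then show "has_bochner_integral (measure_pmf (poisson_pmf r)) real r"
    by (intro has_bochner_integral_pmf_nat) (auto simp: r)
  have "(\<lambda>i. r * ((r ^ i / fact i * exp (- r)) * real i + (r ^ i / fact i * exp (- r)))) sums (r * (r + 1))"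
    by (intro sums_mult sums_add e0 e1)
  then have "(\<lambda>i. (r ^ i / fact i * exp (- r)) * real i * real i) sums (r * (r + 1))"
    by (intro shift) (simp add: algebra_simps add_divide_distrib)
  then show "has_bochner_integral (measure_pmf (poisson_pmf r)) (\<lambda>j. (real j)\<^sup>2) (r + r\<^sup>2)"
    by (intro has_bochner_integral_pmf_nat) (auto simp: r power2_eq_square algebra_simps)
qed

section \<open>A maximal inequality for Markov chains\<close>

primrec path_pmf :: "('s \<Rightarrow> 's pmf) \<Rightarrow> nat \<Rightarrow> 's \<Rightarrow> 's list pmf" where
  "path_pmf T 0 y = return_pmf [y]"
| "path_pmf T (Suc m) y = bind_pmf (T y) (\<lambda>z. map_pmf ((#) y) (path_pmf T m z))"

lemma path_pmf_hd: "xs \<in> set_pmf (path_pmf T m y) \<Longrightarrow> xs \<noteq> [] \<and> hd xs = y"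
  by (cases m) auto

lemma pmf_path_pmf:
  assumes "length xs = Suc m"
  shows "pmf (path_pmf T m (hd xs)) xs = (\<Prod>i<m. pmf (T (xs ! i)) (xs ! Suc i))"
  using assms
proof (induction m arbitrary: xs)
  case 0
  then obtain y where "xs = [y]" by (auto simp: length_Suc_conv)
  then show ?case by simp
next
  case (Suc m)
  then obtain y z zs where xs: "xs = y # z # zs" and len: "length (z # zs) = Suc m"
    by (cases xs; cases "tl xs") (auto simp: length_Suc_conv)
  have "pmf (path_pmf T (Suc m) (hd xs)) xs = (\<integral>w. pmf (map_pmf ((#) y) (path_pmf T m w)) (y # z # zs) \<partial>T y)"
    by (simp add: xs pmf_bind)
  also have "\<dots> = (\<integral>w. pmf (path_pmf T m w) (z # zs) \<partial>T y)"
    by (subst pmf_map_inj') (auto intro: injI)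
  also have "\<dots> = (\<Sum>w\<in>{z}. pmf (path_pmf T m w) (z # zs) * pmf (T y) w)"
  proof (rule integral_measure_pmf_real)
    show "w \<in> {z}" if "pmf (path_pmf T m w) (z # zs) \<noteq> 0" for w
      using that path_pmf_hd[of "z # zs" T m w] by (auto simp: set_pmf_iff)
  qed simp
  also have "\<dots> = pmf (T y) z * (\<Prod>i<m. pmf (T ((z # zs) ! i)) ((z # zs) ! Suc i))"
    using Suc.IH[OF len] by simp
  also have "\<dots> = (\<Prod>i<Suc m. pmf (T (xs ! i)) (xs ! Suc i))"
    by (simp add: xs prod.lessThan_Suc_shift del: prod.lessThan_Suc)
  finally show ?case .
qed

text \<open>\<open>s\<close> accumulates the increments so far. Allowing any starting value is what
  makes an induction on the first step possible.\<close>

fun exceeds :: "('s \<Rightarrow> 's \<Rightarrow> real) \<Rightarrow> real \<Rightarrow> real \<Rightarrow> 's list \<Rightarrow> bool" where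
  "exceeds D \<epsilon> s [] = False"
| "exceeds D \<epsilon> s [y] = (\<bar>s\<bar> > \<epsilon>)"
| "exceeds D \<epsilon> s (y # z # zs) = (\<bar>s\<bar> > \<epsilon> \<or> exceeds D \<epsilon> (s + D y z) (z # zs))"

text \<open>Kolmogorov's inequality with a bias: conditioning on the first step and stopping as soon as the
  threshold is passed, the second moment grows by at most \<open>b + 2 * \<epsilon> * \<beta>\<close> in each step.\<close>

lemma path_pmf_exceeds:
  fixes T :: "'s \<Rightarrow> 's pmf" and D :: "'s \<Rightarrow> 's \<Rightarrow> real"
  assumes closed: "\<And>y. y \<in> S \<Longrightarrow> set_pmf (T y) \<subseteq> S"
    and bounded: "\<And>y z. y \<in> S \<Longrightarrow> z \<in> S \<Longrightarrow> \<bar>D y z\<bar> \<le> B"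
    and bias: "\<And>y. y \<in> S \<Longrightarrow> \<bar>measure_pmf.expectation (T y) (D y)\<bar> \<le> \<beta>"
    and var: "\<And>y. y \<in> S \<Longrightarrow> measure_pmf.expectation (T y) (\<lambda>z. (D y z)\<^sup>2) \<le> b"
    and "\<epsilon> > 0" and "y \<in> S"
  shows "emeasure (path_pmf T m y) {xs. exceeds D \<epsilon> s xs}
    \<le> ennreal ((s\<^sup>2 + real m * (b + 2 * \<epsilon> * \<beta>)) / \<epsilon>\<^sup>2)"
  using \<open>y \<in> S\<close>
proof (induction m arbitrary: y s)
  case 0
  show ?case
  proof (cases "\<bar>s\<bar> > \<epsilon>")
    case True
    then have "\<epsilon>\<^sup>2 \<le> s\<^sup>2" using \<open>\<epsilon> > 0\<close> by (metis abs_le_square_iff abs_of_pos less_imp_le)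
    then have "1 \<le> s\<^sup>2 / \<epsilon>\<^sup>2" using \<open>\<epsilon> > 0\<close> by simp
    then have "1 \<le> ennreal (s\<^sup>2 / \<epsilon>\<^sup>2)" using ennreal_leI[of 1] by simp
    then show ?thesis using True by (simp add: indicator_def)
  next
    case False
    then show ?thesis by (simp add: indicator_def)
  qed
next
  case (Suc m)
  have b0: "0 \<le> b" by (rule order_trans[OF Bochner_Integration.integral_nonneg var[OF Suc.prems]]) simp
  have be0: "0 \<le> \<beta>" using bias[OF Suc.prems] by linarith
  define C where "C = b + 2 * \<epsilon> * \<beta>"
  have C: "0 \<le> C" using b0 be0 \<open>\<epsilon> > 0\<close> by (simp add: C_def)
  show ?case
  proof (cases "\<bar>s\<bar> > \<epsilon>")
    case True
    then have "\<epsilon>\<^sup>2 \<le> s\<^sup>2" using \<open>\<epsilon> > 0\<close> by (metis abs_le_square_iff abs_of_pos less_imp_le)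
    then have "\<epsilon>\<^sup>2 \<le> s\<^sup>2 + real (Suc m) * C" using C by (simp add: add_increasing2)
    then have "1 \<le> (s\<^sup>2 + real (Suc m) * C) / \<epsilon>\<^sup>2" using \<open>\<epsilon> > 0\<close> by simp
    then have "1 \<le> ennreal ((s\<^sup>2 + real (Suc m) * C) / \<epsilon>\<^sup>2)" using ennreal_leI[of 1] by simp
    then show ?thesis unfolding C_def[symmetric]
      by (rule order_trans[OF measure_pmf.emeasure_le_1])
  next
    case False
    have int1: "integrable (T y) (D y)"
      by (rule measure_pmf.integrable_const_bound[where B=B])
        (use bounded closed Suc.prems in \<open>auto simp: AE_measure_pmf_iff\<close>)
    have int2: "integrable (T y) (\<lambda>z. (D y z)\<^sup>2)"
    proof (rule measure_pmf.integrable_const_bound[where B="B\<^sup>2"])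
      have "norm ((D y z)\<^sup>2) \<le> B\<^sup>2" if "z \<in> set_pmf (T y)" for z
      proof -
        have "\<bar>D y z\<bar> \<le> B" using bounded closed Suc.prems that by auto
        then show ?thesis using power_mono[of "\<bar>D y z\<bar>" B 2] by simp
      qed
      then show "AE z in T y. norm ((D y z)\<^sup>2) \<le> B\<^sup>2" by (auto simp: AE_measure_pmf_iff)
    qed simp
    have eq: "((s + D y z)\<^sup>2 + real m * C) / \<epsilon>\<^sup>2
        = (s\<^sup>2 + real m * C) / \<epsilon>\<^sup>2 + (2 * s / \<epsilon>\<^sup>2) * D y z + (1 / \<epsilon>\<^sup>2) * (D y z)\<^sup>2" for z
      by (simp add: power2_sum add_divide_distrib mult.commute)
    have "emeasure (path_pmf T (Suc m) y) {xs. exceeds D \<epsilon> s xs}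
        = (\<integral>\<^sup>+ z. emeasure (path_pmf T m z) ((#) y -` {xs. exceeds D \<epsilon> s xs}) \<partial>T y)"
      by (simp add: emeasure_map_pmf)
    also have "\<dots> \<le> (\<integral>\<^sup>+ z. ennreal (((s + D y z)\<^sup>2 + real m * C) / \<epsilon>\<^sup>2) \<partial>T y)"
    proof (rule nn_integral_mono_AE, simp only: AE_measure_pmf_iff, intro ballI)
      fix z assume z: "z \<in> set_pmf (T y)"
      have "emeasure (path_pmf T m z) ((#) y -` {xs. exceeds D \<epsilon> s xs})
          \<le> emeasure (path_pmf T m z) {xs. exceeds D \<epsilon> (s + D y z) xs}"
      proof (rule emeasure_mono_AE, simp only: AE_measure_pmf_iff, intro ballI impI)
        fix xs assume xs: "xs \<in> set_pmf (path_pmf T m z)" "xs \<in> (#) y -` {xs. exceeds D \<epsilon> s xs}"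
        then obtain zs where "xs = z # zs" using path_pmf_hd by (cases xs) fastforce+
        then show "xs \<in> {xs. exceeds D \<epsilon> (s + D y z) xs}" using xs False by simp
      qed simp
      also have "\<dots> \<le> ennreal (((s + D y z)\<^sup>2 + real m * C) / \<epsilon>\<^sup>2)"
        unfolding C_def by (rule Suc.IH) (use z closed Suc.prems in auto)
      finally show "emeasure (path_pmf T m z) ((#) y -` {xs. exceeds D \<epsilon> s xs})
          \<le> ennreal (((s + D y z)\<^sup>2 + real m * C) / \<epsilon>\<^sup>2)" .
    qed
    also have "\<dots> = ennreal (measure_pmf.expectation (T y) (\<lambda>z. ((s + D y z)\<^sup>2 + real m * C) / \<epsilon>\<^sup>2))"
    proof (rule nn_integral_eq_integral)
      show "integrable (T y) (\<lambda>z. ((s + D y z)\<^sup>2 + real m * C) / \<epsilon>\<^sup>2)"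
        unfolding eq by (intro Bochner_Integration.integrable_add integrable_mult_right int1 int2) simp
    qed (use C in auto)
    also have "measure_pmf.expectation (T y) (\<lambda>z. ((s + D y z)\<^sup>2 + real m * C) / \<epsilon>\<^sup>2)
        = (s\<^sup>2 + real m * C) / \<epsilon>\<^sup>2 + (2 * s / \<epsilon>\<^sup>2) * measure_pmf.expectation (T y) (D y)
          + (1 / \<epsilon>\<^sup>2) * measure_pmf.expectation (T y) (\<lambda>z. (D y z)\<^sup>2)"
      unfolding eq using int1 int2 by (simp add: Bochner_Integration.integral_add)
    also have "\<dots> = (s\<^sup>2 + real m * C + 2 * (s * measure_pmf.expectation (T y) (D y))
          + measure_pmf.expectation (T y) (\<lambda>z. (D y z)\<^sup>2)) / \<epsilon>\<^sup>2"
      by (simp add: add_divide_distrib)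
    \<comment> \<open>The threshold has not been passed, so
      \<open>\<bar>s\<bar> \<le> \<epsilon>\<close> and the cross term is controlled by the bias
      although the increments are not centred.\<close>
    also have "\<dots> \<le> (s\<^sup>2 + real m * C + 2 * (\<epsilon> * \<beta>) + b) / \<epsilon>\<^sup>2"
    proof (intro divide_right_mono add_mono order_refl var Suc.prems mult_left_mono)
      have "s * measure_pmf.expectation (T y) (D y) \<le> \<bar>s\<bar> * \<bar>measure_pmf.expectation (T y) (D y)\<bar>"
        by (metis abs_ge_self abs_mult)
      also have "\<dots> \<le> \<epsilon> * \<beta>" using False bias[OF Suc.prems] \<open>\<epsilon> > 0\<close> by (intro mult_mono) auto
      finally show "s * measure_pmf.expectation (T y) (D y) \<le> \<epsilon> * \<beta>" .
    qed auto
    also have "s\<^sup>2 + real m * C + 2 * (\<epsilon> * \<beta>) + b = s\<^sup>2 + real (Suc m) * C"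
      by (simp add: C_def algebra_simps)
    finally show ?thesis by (simp add: C_def ennreal_leI)
  qed
qed

section \<open>The queueing chain\<close>

locale lcq_chain =
  fixes n :: nat and lam q :: real and d :: nat
  assumes n: "n \<ge> 1" and lam_pos: "0 < lam" and lam_less_1: "lam < 1" and q_pos: "0 < q" and q_le_1: "q \<le> 1"
begin

abbreviation \<alpha> :: real where "\<alpha> \<equiv> alpha_n q n"
abbreviation r :: real where "r \<equiv> unif_c n lam"
abbreviation S :: "(nat \<Rightarrow> real) set" where "S \<equiv> S_n n"

definition arrive :: "(nat \<Rightarrow> real) \<Rightarrow> nat \<Rightarrow> nat \<Rightarrow> real" where
  "arrive u k = u(k := u k + 1 / real n)"
definition depart :: "(nat \<Rightarrow> real) \<Rightarrow> nat \<Rightarrow> nat \<Rightarrow> real" where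
  "depart u k = u(k := u k - 1 / real n)"
definition arrive_rate :: "(nat \<Rightarrow> real) \<Rightarrow> nat \<Rightarrow> real" where
  "arrive_rate u k = real n * lam * (u (k - 1) - u k)"
definition depart_rate :: "(nat \<Rightarrow> real) \<Rightarrow> nat \<Rightarrow> real" where
  "depart_rate u k = real n * \<alpha> * ((1 - u (k + 1)) ^ d - (1 - u k) ^ d)"

lemma n_pos: "real n > 0" using n by simp

lemma alpha_nonneg: "0 \<le> \<alpha>" and alpha_le_1: "\<alpha> \<le> 1"
  using q_pos q_le_1 by (auto simp: alpha_n_def intro: power_le_one)

lemma r_bounds: "real n \<le> r" "r \<le> 2 * real n" "r > 0"
proof -
  show 1: "real n \<le> r" "r \<le> 2 * real n"
    using n_pos lam_pos lam_less_1 by (auto simp: unif_c_def algebra_simps)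
  then show "r > 0" using n_pos by linarith
qed

lemma S_U: "u \<in> S \<Longrightarrow> u \<in> U_set"
  by (auto simp: S_n_def)

lemma arrive_inj: "arrive u k = arrive u k' \<Longrightarrow> k = k'"
  and depart_inj: "depart u k = depart u k' \<Longrightarrow> k = k'"
  and arrive_neq_depart: "arrive u k \<noteq> depart u k'"
  and arrive_neq: "arrive u k \<noteq> u" and depart_neq: "depart u k \<noteq> u"
  using n_pos by (auto simp: arrive_def depart_def dest!: fun_cong[of _ _ k] split: if_splits)

lemma qrate_arrive:
  assumes "k \<ge> 1"
  shows "qrate n lam q d u (arrive u k) = arrive_rate u k"
proof -
  have the: "(THE j. j \<ge> 1 \<and> arrive u k = u(j := u j + 1 / real n)) = k"
    using assms arrive_inj by (intro the_equality) (auto simp: arrive_def)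
  have ex: "\<exists>j\<ge>1. arrive u k = u(j := u j + 1 / real n)" using assms by (auto simp: arrive_def)
  have nex: "\<not> (\<exists>j\<ge>1. arrive u k = u(j := u j - 1 / real n))"
    using arrive_neq_depart by (auto simp: depart_def)
  show ?thesis unfolding qrate_def if_P[OF ex] if_not_P[OF nex] the Let_def arrive_rate_def by simp
qed

lemma qrate_depart:
  assumes "k \<ge> 1"
  shows "qrate n lam q d u (depart u k) = depart_rate u k"
proof -
  have the: "(THE j. j \<ge> 1 \<and> depart u k = u(j := u j - 1 / real n)) = k"
    using assms depart_inj by (intro the_equality) (auto simp: depart_def)
  have ex: "\<exists>j\<ge>1. depart u k = u(j := u j - 1 / real n)" using assms by (auto simp: depart_def)
  have nex: "\<not> (\<exists>j\<ge>1. depart u k = u(j := u j + 1 / real n))"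
    using arrive_neq_depart by (metis arrive_def)
  show ?thesis unfolding qrate_def if_P[OF ex] if_not_P[OF nex] the Let_def depart_rate_def by simp
qed

lemma qrate_other:
  assumes "\<And>k. k \<ge> 1 \<Longrightarrow> v \<noteq> arrive u k" "\<And>k. k \<ge> 1 \<Longrightarrow> v \<noteq> depart u k"
  shows "qrate n lam q d u v = 0"
  using assms by (auto simp: qrate_def arrive_def depart_def)

lemma arrive_rate_nonneg: "u \<in> S \<Longrightarrow> k \<ge> 1 \<Longrightarrow> 0 \<le> arrive_rate u k"
  using U_set_Suc[OF S_U, of u "k - 1"] lam_pos by (simp add: arrive_rate_def)

lemma depart_rate_nonneg: "u \<in> S \<Longrightarrow> 0 \<le> depart_rate u k"
  using one_minus_power_diff_nonneg[OF S_U, of u k d] alpha_nonneg by (simp add: depart_rate_def)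

lemma S_support:
  assumes "u \<in> S"
  obtains K where "K \<ge> 1" "\<And>k. k \<ge> K \<Longrightarrow> u k = 0"
proof -
  obtain K where "\<forall>k\<ge>K. u k = 0" using assms by (auto simp: S_n_def)
  then show ?thesis using that[of "max 1 K"] by simp
qed

text \<open>A nonzero rate means \<open>u k < u (k - 1)\<close>; both are multiples of
  \<open>1 / n\<close>, so there is room for the whole jump.\<close>

lemma arrive_in_S:
  assumes u: "u \<in> S" and k: "k \<ge> 1" and pos: "arrive_rate u k \<noteq> 0"
  shows "arrive u k \<in> S"
proof -
  obtain j where kj: "k = Suc j" using k by (cases k) auto
  obtain a b :: nat where ab: "u j = real a / real n" "u k = real b / real n"
    using u by (fastforce simp: S_n_def)
  obtain K where K: "K \<ge> 1" "\<And>k. k \<ge> K \<Longrightarrow> u k = 0" using S_support[OF u] by metis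
  have "u j \<noteq> u k" using pos by (auto simp: arrive_rate_def kj)
  moreover have "u k \<le> u j" using U_set_Suc[OF S_U[OF u], of j] kj by simp
  ultimately have "b < a" using ab n_pos by (simp add: divide_le_cancel)
  then have "real b + 1 \<le> real a" by simp
  then have le: "u k + 1 / real n \<le> u j"
    unfolding ab add_divide_distrib[symmetric] by (intro divide_right_mono) auto
  have "arrive u k \<in> U_set"
  proof (rule U_setI)
    show "arrive u k 0 = 1" using k U_set_0[OF S_U[OF u]] by (simp add: arrive_def)
    show "arrive u k (Suc i) \<le> arrive u k i" for i
      using le U_set_Suc[OF S_U[OF u], of i] n_pos by (auto simp: arrive_def kj intro: order_trans[of _ "u i"])
    show "0 \<le> arrive u k i" for i using U_set_nonneg[OF S_U[OF u], of i] by (auto simp: arrive_def)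
  qed
  moreover have "\<exists>m::nat. arrive u k i = real m / real n" for i
  proof (cases "i = k")
    case True
    then have "arrive u k i = real (Suc b) / real n" using ab by (simp add: arrive_def add_divide_distrib)
    then show ?thesis by blast
  qed (use u in \<open>auto simp: arrive_def S_n_def\<close>)
  moreover have "\<forall>i\<ge>max K (Suc k). arrive u k i = 0" using K by (auto simp: arrive_def)
  ultimately show ?thesis unfolding S_n_def by blast
qed

lemma depart_in_S:
  assumes u: "u \<in> S" and k: "k \<ge> 1" and pos: "depart_rate u k \<noteq> 0"
  shows "depart u k \<in> S"
proof -
  obtain a b :: nat where ab: "u (Suc k) = real a / real n" "u k = real b / real n"
    using u by (fastforce simp: S_n_def)
  obtain K where K: "K \<ge> 1" "\<And>k. k \<ge> K \<Longrightarrow> u k = 0" using S_support[OF u] by metis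
  have "u k \<noteq> u (Suc k)" using pos by (auto simp: depart_rate_def)
  moreover have "u (Suc k) \<le> u k" using U_set_Suc[OF S_U[OF u], of k] by simp
  ultimately have "a < b" using ab n_pos by (simp add: divide_le_cancel)
  then have "real a \<le> real b - 1" by simp
  then have le: "u (Suc k) \<le> u k - 1 / real n"
    unfolding ab diff_divide_distrib[symmetric] by (intro divide_right_mono) auto
  have "depart u k \<in> U_set"
  proof (rule U_setI)
    show "depart u k 0 = 1" using k U_set_0[OF S_U[OF u]] by (simp add: depart_def)
    show "depart u k (Suc i) \<le> depart u k i" for i
      using le U_set_Suc[OF S_U[OF u], of i] n_pos by (auto simp: depart_def intro: order_trans[of _ "u k"])
    show "0 \<le> depart u k i" for i
      using U_set_nonneg[OF S_U[OF u], of i] U_set_nonneg[OF S_U[OF u], of "Suc k"] le by (auto simp: depart_def)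
  qed
  moreover have "\<exists>m::nat. depart u k i = real m / real n" for i
  proof (cases "i = k")
    case True
    then have "depart u k i = real (b - 1) / real n" using ab \<open>a < b\<close> by (simp add: depart_def diff_divide_distrib of_nat_diff)
    then show ?thesis by blast
  qed (use u in \<open>auto simp: depart_def S_n_def\<close>)
  moreover have "\<forall>i\<ge>max K (Suc k). depart u k i = 0" using K by (auto simp: depart_def)
  ultimately show ?thesis unfolding S_n_def by blast
qed

lemma qrate_nonneg:
  assumes "u \<in> S"
  shows "0 \<le> qrate n lam q d u v"
proof (cases "(\<exists>k\<ge>1. v = arrive u k) \<or> (\<exists>k\<ge>1. v = depart u k)")
  case True
  then show ?thesis
    using qrate_arrive qrate_depart arrive_rate_nonneg[OF assms] depart_rate_nonneg[OF assms] by auto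
next
  case False
  then have "qrate n lam q d u v = 0" by (intro qrate_other) blast+
  then show ?thesis by simp
qed

text \<open>Both families of rates telescope. \<open>K\<close> lies beyond the support of
  \<open>u\<close>, so all later rates vanish, and a jump that would leave \<open>S\<close> already
  has rate 0.\<close>

lemma qrate_total:
  assumes u: "u \<in> S"
  obtains A where "finite A" "A \<subseteq> S - {u}" "\<And>v. v \<in> S - {u} - A \<Longrightarrow> qrate n lam q d u v = 0"
    "(\<Sum>v\<in>A. qrate n lam q d u v) = real n * lam + real n * \<alpha> * (1 - (1 - u 1) ^ d)"
proof -
  obtain K where K: "K \<ge> 1" "\<And>k. k \<ge> K \<Longrightarrow> u k = 0" using S_support[OF u] by metis
  let ?A = "arrive u ` {1..K}" and ?D = "depart u ` {1..K}"
  have zero: "qrate n lam q d u v = 0" if "v \<notin> ?A \<union> ?D" for v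
  proof (cases "(\<exists>k\<ge>1. v = arrive u k) \<or> (\<exists>k\<ge>1. v = depart u k)")
    case True
    then consider k where "k \<ge> 1" "v = arrive u k" | k where "k \<ge> 1" "v = depart u k" by blast
    then show ?thesis
    proof cases
      case 1
      then have "k > K" using that by force
      then show ?thesis using 1 qrate_arrive[of k u] K(2)[of k] K(2)[of "k - 1"] by (simp add: arrive_rate_def)
    next
      case 2
      then have "k > K" using that by force
      then show ?thesis using 2 qrate_depart[of k u] K(2)[of k] K(2)[of "k + 1"] by (simp add: depart_rate_def)
    qed
  next
    case False
    then show ?thesis by (intro qrate_other) blast+
  qed
  have notS: "qrate n lam q d u v = 0" if "v \<in> ?A \<union> ?D" "v \<notin> S" for v
  proof -
    from that(1) consider k where "k \<ge> 1" "v = arrive u k" | k where "k \<ge> 1" "v = depart u k" by auto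
    then show ?thesis
      by cases (use that(2) arrive_in_S[OF u] depart_in_S[OF u] qrate_arrive qrate_depart in metis)+
  qed
  have "(\<Sum>v\<in>(?A \<union> ?D) \<inter> S. qrate n lam q d u v) = (\<Sum>v\<in>?A \<union> ?D. qrate n lam q d u v)"
    by (rule sum.mono_neutral_left) (use notS in auto)
  also have "\<dots> = (\<Sum>v\<in>?A. qrate n lam q d u v) + (\<Sum>v\<in>?D. qrate n lam q d u v)"
    by (rule sum.union_disjoint) (use arrive_neq_depart in auto)
  also have "(\<Sum>v\<in>?A. qrate n lam q d u v) = (\<Sum>k=1..K. arrive_rate u k)"
    using arrive_inj by (subst sum.reindex) (auto simp: inj_on_def qrate_arrive)
  also have "\<dots> = real n * lam * (\<Sum>k=1..K. u (k - 1) - u k)"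
    by (simp add: arrive_rate_def sum_distrib_left)
  also have "(\<Sum>k=1..K. u (k - 1) - u k) = u 0 - u K"
    using sum_telescope''[of 0 K u] by (simp add: sum_subtractf sum_negf[symmetric] flip: One_nat_def)
  also have "\<dots> = 1" using K U_set_0[OF S_U[OF u]] by simp
  also have "(\<Sum>v\<in>?D. qrate n lam q d u v) = (\<Sum>k=1..K. depart_rate u k)"
    using depart_inj by (subst sum.reindex) (auto simp: inj_on_def qrate_depart)
  also have "\<dots> = real n * \<alpha> * (\<Sum>k=1..K. (1 - u (Suc k)) ^ d - (1 - u k) ^ d)"
    by (simp add: depart_rate_def sum_distrib_left)
  also have "(\<Sum>k=1..K. (1 - u (Suc k)) ^ d - (1 - u k) ^ d) = (1 - u (Suc K)) ^ d - (1 - u 1) ^ d"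
    using sum_Suc_diff[of 1 K "\<lambda>k. (1 - u k) ^ d"] K by simp
  also have "\<dots> = 1 - (1 - u 1) ^ d" using K by simp
  finally show ?thesis
    by (intro that[of "(?A \<union> ?D) \<inter> S"]) (use zero arrive_neq[symmetric] depart_neq[symmetric] in auto)
qed

text \<open>The holding probability is nonnegative because arrivals have total rate
  \<open>n * lam\<close> and departures at most \<open>n\<close>, which together make up
  \<open>unif_c\<close>.\<close>

lemma jumpK_nonneg:
  assumes u: "u \<in> S"
  shows "0 \<le> jumpK n lam q d u v"
proof (cases "v = u")
  case True
  obtain A where A: "finite A" "A \<subseteq> S - {u}" "\<And>v. v \<in> S - {u} - A \<Longrightarrow> qrate n lam q d u v = 0"
    "(\<Sum>v\<in>A. qrate n lam q d u v) = real n * lam + real n * \<alpha> * (1 - (1 - u 1) ^ d)"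
    using qrate_total[OF u] by metis
  have "infsum (qrate n lam q d u) (S - {u}) = infsum (qrate n lam q d u) A"
    by (rule infsum_cong_neutral) (use A in auto)
  also have "\<dots> = real n * lam + real n * (\<alpha> * (1 - (1 - u 1) ^ d))" using A by simp
  also have "\<dots> \<le> r"
  proof -
    have "\<alpha> * (1 - (1 - u 1) ^ d) \<le> 1 * 1"
      using alpha_nonneg alpha_le_1 U_set_le_1[OF S_U[OF u], of 1] U_set_nonneg[OF S_U[OF u], of 1]
      by (intro mult_mono) (auto intro: power_le_one)
    then have "real n * (\<alpha> * (1 - (1 - u 1) ^ d)) \<le> real n * 1" by (intro mult_left_mono) auto
    then show ?thesis by (simp add: unif_c_def algebra_simps)
  qed
  finally show ?thesis using True r_bounds by (simp add: jumpK_def)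
next
  case False
  then show ?thesis using qrate_nonneg[OF u] r_bounds by (simp add: jumpK_def)
qed

lemma jumpK_total:
  assumes u: "u \<in> S"
  shows "(\<integral>\<^sup>+ v. ennreal (if v \<in> S then jumpK n lam q d u v else 0) \<partial>count_space UNIV) = 1"
proof -
  obtain A where A: "finite A" "A \<subseteq> S - {u}" "\<And>v. v \<in> S - {u} - A \<Longrightarrow> qrate n lam q d u v = 0"
    using qrate_total[OF u] by metis
  have "infsum (qrate n lam q d u) (S - {u}) = infsum (qrate n lam q d u) A"
    by (rule infsum_cong_neutral) (use A in auto)
  then have inf: "infsum (qrate n lam q d u) (S - {u}) = (\<Sum>v\<in>A. qrate n lam q d u v)"
    using A by simp
  have "(\<integral>\<^sup>+ v. ennreal (if v \<in> S then jumpK n lam q d u v else 0) \<partial>count_space UNIV)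
      = (\<Sum>v\<in>insert u A. ennreal (if v \<in> S then jumpK n lam q d u v else 0))"
    by (rule nn_integral_count_space') (use A in \<open>auto simp: jumpK_def\<close>)
  also have "\<dots> = (\<Sum>v\<in>insert u A. ennreal (jumpK n lam q d u v))"
    by (intro sum.cong refl) (use A u in auto)
  also have "\<dots> = ennreal (\<Sum>v\<in>insert u A. jumpK n lam q d u v)"
    by (rule sum_ennreal) (use jumpK_nonneg[OF u] in auto)
  also have "(\<Sum>v\<in>insert u A. jumpK n lam q d u v) = jumpK n lam q d u u + (\<Sum>v\<in>A. jumpK n lam q d u v)"
    using A by (intro sum.insert) auto
  also have "(\<Sum>v\<in>A. jumpK n lam q d u v) = (\<Sum>v\<in>A. qrate n lam q d u v / r)"
    by (intro sum.cong refl) (use A in \<open>auto simp: jumpK_def\<close>)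
  also have "jumpK n lam q d u u + \<dots> = 1"
    by (simp add: jumpK_def inf sum_divide_distrib)
  finally show ?thesis by simp
qed

definition jump_pmf :: "(nat \<Rightarrow> real) \<Rightarrow> (nat \<Rightarrow> real) pmf" where
  "jump_pmf u = (if u \<in> S then embed_pmf (\<lambda>v. if v \<in> S then jumpK n lam q d u v else 0) else return_pmf u)"

lemma pmf_jump_pmf:
  assumes "u \<in> S"
  shows "pmf (jump_pmf u) v = (if v \<in> S then jumpK n lam q d u v else 0)"
  unfolding jump_pmf_def using assms jumpK_nonneg[OF assms] jumpK_total[OF assms]
  by (simp add: pmf_embed_pmf)

text \<open>Valid also when the jump would leave \<open>S\<close>: then the rate is 0 and so is the
  probability.\<close>

lemma pmf_jump_arrive:
  assumes "u \<in> S" "k \<ge> 1"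
  shows "pmf (jump_pmf u) (arrive u k) = arrive_rate u k / r"
  using assms arrive_in_S[OF assms] by (auto simp: pmf_jump_pmf jumpK_def arrive_neq qrate_arrive)

lemma pmf_jump_depart:
  assumes "u \<in> S" "k \<ge> 1"
  shows "pmf (jump_pmf u) (depart u k) = depart_rate u k / r"
  using assms depart_in_S[OF assms] by (auto simp: pmf_jump_pmf jumpK_def depart_neq qrate_depart)

lemma set_jump_pmf:
  assumes u: "u \<in> S" and v: "v \<in> set_pmf (jump_pmf u)"
  shows "v \<in> S" "v = u \<or> (\<exists>k\<ge>1. v = arrive u k) \<or> (\<exists>k\<ge>1. v = depart u k)"
proof -
  have "(if v \<in> S then jumpK n lam q d u v else 0) \<noteq> 0"
    using v by (simp add: set_pmf_iff pmf_jump_pmf[OF u])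
  then have "v \<in> S" "jumpK n lam q d u v \<noteq> 0" by (auto split: if_splits)
  then show "v \<in> S" "v = u \<or> (\<exists>k\<ge>1. v = arrive u k) \<or> (\<exists>k\<ge>1. v = depart u k)"
    using qrate_other[of v u] by (auto simp: jumpK_def split: if_splits)
qed

lemma jump_pmf_dist:
  assumes "u \<in> S" "v \<in> set_pmf (jump_pmf u)"
  shows "\<bar>v k - u k\<bar> \<le> 1 / real n"
  using set_jump_pmf(2)[OF assms] by (auto simp: arrive_def depart_def)

text \<open>Only the two jumps at \<open>k\<close> itself change coordinate \<open>k\<close>; their
  size \<open>1 / n\<close> cancels the factor \<open>n\<close> in the rates.\<close>

lemma expectation_jump_pmf:
  assumes u: "u \<in> S" and k: "k \<ge> 1"
  shows "measure_pmf.expectation (jump_pmf u) (\<lambda>v. v k) = u k + lcq_drift lam d \<alpha> u k / r"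
proof -
  have int: "integrable (jump_pmf u) (\<lambda>v. v k)"
    by (rule measure_pmf.integrable_const_bound[where B=1])
      (use set_jump_pmf(1)[OF u] S_U U_set_nonneg U_set_le_1 in \<open>auto simp: AE_measure_pmf_iff\<close>)
  have "measure_pmf.expectation (jump_pmf u) (\<lambda>v. v k - u k)
     = (\<Sum>v\<in>{arrive u k, depart u k}. (v k - u k) * pmf (jump_pmf u) v)"
  proof (rule integral_measure_pmf_real)
    fix v assume "v \<in> set_pmf (jump_pmf u)" "v k - u k \<noteq> 0"
    then show "v \<in> {arrive u k, depart u k}"
      using set_jump_pmf(2)[OF u, of v] by (auto simp: arrive_def depart_def split: if_splits)
  qed simp
  also have "\<dots> = (1 / real n) * (arrive_rate u k / r) - (1 / real n) * (depart_rate u k / r)"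
    using arrive_neq_depart by (simp add: pmf_jump_arrive[OF u k] pmf_jump_depart[OF u k]) (simp add: arrive_def depart_def)
  also have "\<dots> = lcq_drift lam d \<alpha> u k / r"
    using n_pos r_bounds by (simp add: arrive_rate_def depart_rate_def lcq_drift_def field_simps)
  finally show ?thesis using int by simp
qed

end

section \<open>Iterated jumps and their Poisson randomization\<close>

context lcq_chain
begin

lemma S_coordinate_bounds: "u \<in> S \<Longrightarrow> 0 \<le> u k \<and> u k \<le> 1"
  using S_U U_set_nonneg U_set_le_1 by blast

primrec jump_pow :: "nat \<Rightarrow> (nat \<Rightarrow> real) \<Rightarrow> (nat \<Rightarrow> real) pmf" where
  "jump_pow 0 u = return_pmf u"
| "jump_pow (Suc j) u = bind_pmf (jump_pow j u) jump_pmf"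

lemma set_jump_pow:
  assumes "u \<in> S" "v \<in> set_pmf (jump_pow j u)"
  shows "v \<in> S" "\<bar>v k - u k\<bar> \<le> real j / real n"
  using assms(2)
proof (induction j arbitrary: v)
  case (Suc j)
  { case 1
    then show ?case using Suc.IH(1) set_jump_pmf(1) by auto
  next
    case 2
    then obtain w where w: "w \<in> set_pmf (jump_pow j u)" "v \<in> set_pmf (jump_pmf w)" by auto
    then have "\<bar>v k - w k\<bar> \<le> 1 / real n" "\<bar>w k - u k\<bar> \<le> real j / real n"
      using Suc.IH jump_pmf_dist by auto
    then have "\<bar>v k - u k\<bar> \<le> 1 / real n + real j / real n" by linarith
    then show ?case by (simp add: add_divide_distrib) }
qed (use assms in auto)

text \<open>The recursion of \<open>jumpKpow\<close> sums over \<open>S\<close> only; this agrees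
  with the mixture because the chain never leaves \<open>S\<close>.\<close>

lemma pmf_jump_pow:
  assumes u: "u \<in> S" and "v \<in> S"
  shows "pmf (jump_pow j u) v = jumpKpow n lam q d j u v"
  using assms(2)
proof (induction j arbitrary: v)
  case (Suc j)
  have "pmf (jump_pow (Suc j) u) v = measure_pmf.expectation (jump_pow j u) (\<lambda>w. pmf (jump_pmf w) v)"
    by (simp add: pmf_bind)
  also have "\<dots> = infsum (\<lambda>w. pmf (jump_pow j u) w * pmf (jump_pmf w) v) UNIV"
    by (rule expectation_pmf_eq_infsum(1)[where B=1]) (simp add: pmf_le_1)
  also have "\<dots> = infsum (\<lambda>w. jumpKpow n lam q d j u w * jumpK n lam q d w v) S"
  proof (rule infsum_cong_neutral)
    show "pmf (jump_pow j u) w * pmf (jump_pmf w) v = 0" if "w \<in> UNIV - S" for w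
      using that set_jump_pow(1)[OF u, of w j] by (auto simp: set_pmf_iff)
  qed (use Suc in \<open>auto simp: pmf_jump_pmf\<close>)
  finally show ?case by simp
qed (auto simp: pmf_return)

text \<open>After \<open>j\<close> jumps every coordinate has moved by at most \<open>j / n\<close>,
  whatever the path, so the unweighted Lipschitz bound applies pointwise.\<close>

lemma drift_expectation_jump_pow:
  assumes u: "u \<in> S" and k: "k \<ge> 1"
  shows "\<bar>measure_pmf.expectation (jump_pow j u) (\<lambda>v. lcq_drift lam d \<alpha> v k) - lcq_drift lam d \<alpha> u k\<bar>
      \<le> (2 + 2 * real d) * (real j / real n)"
proof -
  have S: "v \<in> S" if "v \<in> set_pmf (jump_pow j u)" for v using set_jump_pow(1)[OF u that] .
  have int: "integrable (jump_pow j u) (\<lambda>v. lcq_drift lam d \<alpha> v k)"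
    by (rule measure_pmf.integrable_const_bound[where B=2])
      (use S S_U k lam_pos lam_less_1 alpha_nonneg alpha_le_1 in
        \<open>auto simp: AE_measure_pmf_iff intro!: lcq_drift_bound\<close>)
  have "measure_pmf.expectation (jump_pow j u) (\<lambda>v. lcq_drift lam d \<alpha> v k) - lcq_drift lam d \<alpha> u k
     = measure_pmf.expectation (jump_pow j u) (\<lambda>v. lcq_drift lam d \<alpha> v k - lcq_drift lam d \<alpha> u k)"
    using int by simp
  also have "\<bar>\<dots>\<bar> \<le> measure_pmf.expectation (jump_pow j u) (\<lambda>v. \<bar>lcq_drift lam d \<alpha> v k - lcq_drift lam d \<alpha> u k\<bar>)"
    by (rule integral_abs_bound)
  also have "\<dots> \<le> measure_pmf.expectation (jump_pow j u) (\<lambda>v. (2 + 2 * real d) * (real j / real n))"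
  proof (rule integral_mono_AE)
    show "integrable (jump_pow j u) (\<lambda>v. \<bar>lcq_drift lam d \<alpha> v k - lcq_drift lam d \<alpha> u k\<bar>)"
      using int by simp
    have "\<bar>lcq_drift lam d \<alpha> v k - lcq_drift lam d \<alpha> u k\<bar> \<le> (2 + 2 * real d) * (real j / real n)"
      if "v \<in> set_pmf (jump_pow j u)" for v
      by (rule lcq_drift_lipschitz_sup)
        (use that S S_U u set_jump_pow(2)[OF u that] lam_pos lam_less_1 alpha_nonneg alpha_le_1 in auto)
    then show "AE v in jump_pow j u. \<bar>lcq_drift lam d \<alpha> v k - lcq_drift lam d \<alpha> u k\<bar> \<le> (2 + 2 * real d) * (real j / real n)"
      by (simp add: AE_measure_pmf_iff)
  qed simp
  finally show ?thesis by simp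
qed

text \<open>Each further jump adds the drift over \<open>r\<close>, taken at a state at distance at
  most \<open>j / n\<close> from the start. The errors of order \<open>j / (n * r)\<close> stay
  below a quadratic because \<open>j\<^sup>2 + j \<le> (j + 1)\<^sup>2\<close>.\<close>

lemma expectation_jump_pow:
  assumes u: "u \<in> S" and k: "k \<ge> 1"
  shows "\<bar>measure_pmf.expectation (jump_pow j u) (\<lambda>v. v k) - u k - real j / r * lcq_drift lam d \<alpha> u k\<bar>
      \<le> (2 + 2 * real d) / (real n * r) * (real j)\<^sup>2"
proof (induction j)
  case (Suc j)
  let ?E = "measure_pmf.expectation (jump_pow j u)"
  have S: "v \<in> S" if "v \<in> set_pmf (jump_pow j u)" for v using set_jump_pow(1)[OF u that] .
  have int: "integrable (jump_pow j u) (\<lambda>v. lcq_drift lam d \<alpha> v k)"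
    by (rule measure_pmf.integrable_const_bound[where B=2])
      (use S S_U k lam_pos lam_less_1 alpha_nonneg alpha_le_1 in
        \<open>auto simp: AE_measure_pmf_iff intro!: lcq_drift_bound\<close>)
  have int': "integrable (jump_pow j u) (\<lambda>v. v k)"
    by (rule measure_pmf.integrable_const_bound[where B=1])
      (use S S_U U_set_nonneg U_set_le_1 in \<open>auto simp: AE_measure_pmf_iff\<close>)
  have "measure_pmf.expectation (jump_pow (Suc j) u) (\<lambda>v. v k)
      = ?E (\<lambda>w. measure_pmf.expectation (jump_pmf w) (\<lambda>v. v k))"
    unfolding jump_pow.simps
  proof (rule integral_bind_pmf_bounded[where B=1])
    fix v assume "v \<in> set_pmf (bind_pmf (jump_pow j u) jump_pmf)"
    then show "0 \<le> v k \<and> v k \<le> 1"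
      using set_jump_pow(1)[OF u, of v "Suc j"] by (intro S_coordinate_bounds) simp
  qed
  also have "\<dots> = ?E (\<lambda>w. w k + lcq_drift lam d \<alpha> w k / r)"
    by (rule integral_cong_AE) (use S k in \<open>auto simp: AE_measure_pmf_iff expectation_jump_pmf\<close>)
  also have "\<dots> = ?E (\<lambda>w. w k) + ?E (\<lambda>w. lcq_drift lam d \<alpha> w k) / r"
    using int int' by simp
  finally have eq: "measure_pmf.expectation (jump_pow (Suc j) u) (\<lambda>v. v k) - u k - real (Suc j) / r * lcq_drift lam d \<alpha> u k
     = (?E (\<lambda>v. v k) - u k - real j / r * lcq_drift lam d \<alpha> u k)
        + (?E (\<lambda>w. lcq_drift lam d \<alpha> w k) - lcq_drift lam d \<alpha> u k) / r"
    by (simp add: add_divide_distrib diff_divide_distrib distrib_right)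
  have "\<bar>(?E (\<lambda>w. lcq_drift lam d \<alpha> w k) - lcq_drift lam d \<alpha> u k) / r\<bar>
      \<le> (2 + 2 * real d) * (real j / real n) / r"
    unfolding abs_divide abs_of_pos[OF r_bounds(3)]
    by (rule divide_right_mono[OF drift_expectation_jump_pow[OF u k] less_imp_le[OF r_bounds(3)]])
  also have "\<dots> = (2 + 2 * real d) / (real n * r) * real j" by simp
  finally have "\<bar>measure_pmf.expectation (jump_pow (Suc j) u) (\<lambda>v. v k) - u k - real (Suc j) / r * lcq_drift lam d \<alpha> u k\<bar>
     \<le> (2 + 2 * real d) / (real n * r) * (real j)\<^sup>2 + (2 + 2 * real d) / (real n * r) * real j"
    unfolding eq using Suc.IH by linarith
  also have "\<dots> = (2 + 2 * real d) / (real n * r) * ((real j)\<^sup>2 + real j)" by (simp only: distrib_left)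
  also have "\<dots> \<le> (2 + 2 * real d) / (real n * r) * (real (Suc j))\<^sup>2"
    using r_bounds(3) n_pos by (intro mult_left_mono) (auto simp: power2_eq_square algebra_simps)
  finally show ?case .
qed simp

definition time_pmf :: "real \<Rightarrow> (nat \<Rightarrow> real) \<Rightarrow> (nat \<Rightarrow> real) pmf" where
  "time_pmf h u = bind_pmf (poisson_pmf (r * h)) (\<lambda>j. jump_pow j u)"

lemma set_time_pmf: "u \<in> S \<Longrightarrow> set_pmf (time_pmf h u) \<subseteq> S"
  using set_jump_pow(1) by (auto simp: time_pmf_def)

lemma pmf_time_pmf:
  assumes h: "h > 0" and u: "u \<in> S" "v \<in> S"
  shows "pmf (time_pmf h u) v = ptrans n lam q d h u v"
proof -
  have rh: "0 < r * h" using h r_bounds by simp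
  have "pmf (time_pmf h u) v = measure_pmf.expectation (poisson_pmf (r * h)) (\<lambda>j. pmf (jump_pow j u) v)"
    by (simp add: time_pmf_def pmf_bind)
  also have "\<dots> = infsetsum (\<lambda>j. pmf (poisson_pmf (r * h)) j * pmf (jump_pow j u) v) UNIV"
    by (rule pmf_expectation_eq_infsetsum)
  also have "\<dots> = (\<Sum>j. pmf (poisson_pmf (r * h)) j * pmf (jump_pow j u) v)"
    by (rule infsetsum_nat') (rule expectation_pmf_eq_infsum(2)[where B=1], simp add: pmf_le_1)
  also have "\<dots> = ptrans n lam q d h u v"
    unfolding ptrans_def using rh u by (simp add: pmf_jump_pow mult.commute mult.left_commute)
  finally show ?thesis .
qed

section \<open>Bias and second moment over one grid step\<close>

definition increment_error :: "real \<Rightarrow> nat \<Rightarrow> (nat \<Rightarrow> real) \<Rightarrow> (nat \<Rightarrow> real) \<Rightarrow> real" where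
  "increment_error h k u v = v k - u k - h * lcq_drift lam d \<alpha> u k"

lemma increment_error_bound:
  assumes "h > 0" "u \<in> S" "v \<in> S" "k \<ge> 1"
  shows "\<bar>increment_error h k u v\<bar> \<le> 1 + 2 * h"
proof -
  have "\<bar>h * lcq_drift lam d \<alpha> u k\<bar> \<le> h * 2"
    unfolding abs_mult using assms lcq_drift_bound[of lam \<alpha> u k d] lam_pos lam_less_1 alpha_nonneg alpha_le_1 S_U
    by (intro mult_mono) auto
  moreover have "\<bar>v k - u k\<bar> \<le> 1" by (rule U_set_dist_le_1) (use assms S_U in auto)
  ultimately show ?thesis unfolding increment_error_def by linarith
qed

text \<open>\<open>expectation_jump_pow\<close> averaged over the Poisson number J of jumps: the
  linear term is exact because E[J] / r = h, and the quadratic error has mean proportional to r h +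
  (r h)^2, where r \<le> 2 n.\<close>

lemma increment_error_bias:
  assumes h: "h > 0" and u: "u \<in> S" and k: "k \<ge> 1"
  shows "\<bar>measure_pmf.expectation (time_pmf h u) (increment_error h k u)\<bar>
    \<le> (2 + 2 * real d) * (h / real n + 2 * h\<^sup>2)"
proof -
  let ?P = "measure_pmf.expectation (poisson_pmf (r * h))"
  let ?e = "\<lambda>j. measure_pmf.expectation (jump_pow j u) (\<lambda>v. v k)"
  let ?f = "lcq_drift lam d \<alpha> u k"
  have rh: "0 < r * h" using h r_bounds by simp
  note mom = poisson_moments[OF rh, unfolded has_bochner_integral_iff]
  have S: "v \<in> S" if "v \<in> set_pmf (time_pmf h u)" for v using set_time_pmf[OF u] that by auto
  have int: "integrable (time_pmf h u) (\<lambda>v. v k)"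
    by (rule measure_pmf.integrable_const_bound[where B=1])
      (use S S_U U_set_nonneg U_set_le_1 in \<open>auto simp: AE_measure_pmf_iff\<close>)
  have e01: "0 \<le> ?e j" "?e j \<le> 1" for j
  proof -
    have "AE v in jump_pow j u. 0 \<le> v k \<and> v k \<le> 1"
      using set_jump_pow(1)[OF u] S_U U_set_nonneg U_set_le_1 by (auto simp: AE_measure_pmf_iff)
    then show "0 \<le> ?e j" "?e j \<le> 1"
      by (auto intro!: integral_nonneg_AE measure_pmf.integral_le_const measure_pmf.integrable_const_bound[where B=1] elim: AE_mp)
  qed
  have inte: "integrable (poisson_pmf (r * h)) ?e"
    by (rule measure_pmf.integrable_const_bound[where B=1]) (use e01 in auto)
  have "measure_pmf.expectation (time_pmf h u) (\<lambda>v. v k) = ?P ?e"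
    unfolding time_pmf_def
  proof (rule integral_bind_pmf_bounded[where B=1])
    fix v assume "v \<in> set_pmf (bind_pmf (poisson_pmf (r * h)) (\<lambda>j. jump_pow j u))"
    then show "0 \<le> v k \<and> v k \<le> 1"
      using set_time_pmf[OF u, of h] by (intro S_coordinate_bounds) (auto simp: time_pmf_def)
  qed
  then have E: "measure_pmf.expectation (time_pmf h u) (increment_error h k u) = ?P ?e - u k - h * ?f"
    unfolding increment_error_def[abs_def] using int by simp
  have f: "h * ?f = ?P (\<lambda>j. real j / r * ?f)"
    using mom r_bounds(3) by simp
  have P: "?P ?e - u k - ?P (\<lambda>j. real j / r * ?f) = ?P (\<lambda>j. ?e j - u k - real j / r * ?f)"
    using inte mom by simp
  have "\<bar>measure_pmf.expectation (time_pmf h u) (increment_error h k u)\<bar>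
      \<le> ?P (\<lambda>j. \<bar>?e j - u k - real j / r * ?f\<bar>)"
    unfolding E f P by (rule integral_abs_bound)
  also have "\<dots> \<le> ?P (\<lambda>j. (2 + 2 * real d) / (real n * r) * (real j)\<^sup>2)"
  proof (rule integral_mono)
    show "integrable (poisson_pmf (r * h)) (\<lambda>j. \<bar>?e j - u k - real j / r * ?f\<bar>)"
      using mom(1) by (intro integrable_abs Bochner_Integration.integrable_diff inte integrable_mult_left integrable_divide_zero) auto
    show "integrable (poisson_pmf (r * h)) (\<lambda>j. (2 + 2 * real d) / (real n * r) * (real j)\<^sup>2)"
      using mom(2) by (intro integrable_mult_right) auto
  qed (rule expectation_jump_pow[OF u k])
  also have "\<dots> = (2 + 2 * real d) / (real n * r) * (r * h + (r * h)\<^sup>2)"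
    using mom by simp
  also have "\<dots> = (2 + 2 * real d) * (h / real n + (r / real n) * h\<^sup>2)"
    using n_pos r_bounds(3) by (simp add: field_simps power2_eq_square)
  also have "\<dots> \<le> (2 + 2 * real d) * (h / real n + 2 * h\<^sup>2)"
    using r_bounds n_pos by (intro mult_left_mono add_mono mult_right_mono) (auto simp: pos_divide_le_eq)
  finally show ?thesis .
qed

text \<open>The displacement is at most J / n with J the Poisson number of jumps, and no
  cancellation is exploited: \<open>4 * h / n\<close> comes from E[J] \<le> 2 n h, and
  \<open>16 * h\<^sup>2\<close> collects equal shares from the square of E[J] and from the drift
  bound 2.\<close>

lemma increment_error_second_moment:
  assumes h: "h > 0" and u: "u \<in> S" and k: "k \<ge> 1"
  shows "measure_pmf.expectation (time_pmf h u) (\<lambda>v. (increment_error h k u v)\<^sup>2) \<le> 4 * h / real n + 16 * h\<^sup>2"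
proof -
  let ?P = "measure_pmf.expectation (poisson_pmf (r * h))"
  let ?f = "lcq_drift lam d \<alpha> u k"
  let ?g = "\<lambda>v. (increment_error h k u v)\<^sup>2"
  have rh: "0 < r * h" using h r_bounds by simp
  note mom = poisson_moments[OF rh, unfolded has_bochner_integral_iff]
  have gB: "?g v \<le> (1 + 2 * h)\<^sup>2" if "v \<in> S" for v
    using increment_error_bound[OF h u that k] power_mono[of "\<bar>increment_error h k u v\<bar>" "1 + 2 * h" 2] by simp
  have f2: "\<bar>?f\<bar> \<le> 2"
    by (rule lcq_drift_bound) (use u k lam_pos lam_less_1 alpha_nonneg alpha_le_1 S_U in auto)
  have g_le: "?g v \<le> 2 * (real j / real n)\<^sup>2 + 8 * h\<^sup>2" if "v \<in> set_pmf (jump_pow j u)" for v j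
  proof -
    have "?g v \<le> 2 * (v k - u k)\<^sup>2 + 2 * (h * ?f)\<^sup>2"
    proof -
      have "(x - y)\<^sup>2 \<le> 2 * x\<^sup>2 + 2 * y\<^sup>2" for x y :: real
        using zero_le_power2[of "x + y"] by (simp add: power2_eq_square algebra_simps)
      then show ?thesis by (simp add: increment_error_def)
    qed
    also have "(v k - u k)\<^sup>2 \<le> (real j / real n)\<^sup>2"
      using set_jump_pow(2)[OF u that, of k] power_mono[of "\<bar>v k - u k\<bar>" _ 2] by simp
    also have "(h * ?f)\<^sup>2 \<le> (h * 2)\<^sup>2"
      unfolding power_mult_distrib using f2 power_mono[of "\<bar>?f\<bar>" 2 2] by (intro mult_left_mono) auto
    finally show ?thesis by (simp add: power_mult_distrib)
  qed
  have inner: "measure_pmf.expectation (jump_pow j u) ?g \<le> 2 / (real n)\<^sup>2 * (real j)\<^sup>2 + 8 * h\<^sup>2" for j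
  proof (rule measure_pmf.integral_le_const)
    show "integrable (jump_pow j u) ?g"
      by (rule measure_pmf.integrable_const_bound[where B="(1 + 2 * h)\<^sup>2"])
        (use gB set_jump_pow(1)[OF u] in \<open>auto simp: AE_measure_pmf_iff\<close>)
    show "AE v in jump_pow j u. ?g v \<le> 2 / (real n)\<^sup>2 * (real j)\<^sup>2 + 8 * h\<^sup>2"
      using g_le by (simp add: AE_measure_pmf_iff power_divide)
  qed
  have inner_bound: "\<bar>measure_pmf.expectation (jump_pow j u) ?g\<bar> \<le> (1 + 2 * h)\<^sup>2" for j
  proof -
    have "measure_pmf.expectation (jump_pow j u) ?g \<le> (1 + 2 * h)\<^sup>2"
      by (rule measure_pmf.integral_le_const)
        (use gB set_jump_pow(1)[OF u] in \<open>auto simp: AE_measure_pmf_iff intro!: measure_pmf.integrable_const_bound[where B="(1 + 2 * h)\<^sup>2"]\<close>)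
    moreover have "0 \<le> measure_pmf.expectation (jump_pow j u) ?g" by (rule Bochner_Integration.integral_nonneg) simp
    ultimately show ?thesis by simp
  qed
  have "measure_pmf.expectation (time_pmf h u) ?g = ?P (\<lambda>j. measure_pmf.expectation (jump_pow j u) ?g)"
    unfolding time_pmf_def
    by (rule integral_bind_pmf_bounded[where B="(1 + 2 * h)\<^sup>2"]) (use gB set_jump_pow(1)[OF u] in auto)
  also have "\<dots> \<le> ?P (\<lambda>j. 2 / (real n)\<^sup>2 * (real j)\<^sup>2 + 8 * h\<^sup>2)"
  proof (rule integral_mono)
    show "integrable (poisson_pmf (r * h)) (\<lambda>j. measure_pmf.expectation (jump_pow j u) ?g)"
      by (rule measure_pmf.integrable_const_bound[where B="(1 + 2 * h)\<^sup>2"]) (use inner_bound in auto)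
    show "integrable (poisson_pmf (r * h)) (\<lambda>j. 2 / (real n)\<^sup>2 * (real j)\<^sup>2 + 8 * h\<^sup>2)"
      using mom(2) by (intro Bochner_Integration.integrable_add integrable_mult_right) auto
  qed (rule inner)
  also have "\<dots> = 2 / (real n)\<^sup>2 * (r * h + (r * h)\<^sup>2) + 8 * h\<^sup>2"
    using mom by simp
  also have "\<dots> \<le> 2 / (real n)\<^sup>2 * (2 * real n * h + (2 * real n * h)\<^sup>2) + 8 * h\<^sup>2"
    using r_bounds h n_pos by (intro add_mono mult_left_mono power_mono mult_right_mono) auto
  also have "\<dots> = 4 * h / real n + 16 * h\<^sup>2"
    using n_pos by (simp add: field_simps power2_eq_square)
  finally show ?thesis .
qed

end

section \<open>Comparison of the chain with the flow\<close>

text \<open>A deterministic statement about one path. The four errors are the fluctuation, the gap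
  between \<open>a\<close> and 1, the Euler error of the flow, and the discarded coordinates. The
  last closes the recursion: coordinate \<open>K\<close> needs coordinate \<open>K + 1\<close>, for
  which the trivial bound 1 already has the required form.\<close>

lemma (in lcq_flow) discrete_gronwall:
  fixes y :: "nat \<Rightarrow> nat \<Rightarrow> real"
  assumes y: "\<And>i. i \<le> m \<Longrightarrow> y i \<in> U_set" and h: "h > 0" and mh: "real m * h \<le> T"
    and a: "0 \<le> a" "a \<le> 1" and K: "K > 0" and \<epsilon>: "\<epsilon> \<ge> 0"
    and mart: "\<And>i k. i \<le> m \<Longrightarrow> 1 \<le> k \<Longrightarrow> k \<le> K \<Longrightarrow>
      \<bar>y i k - y 0 k - (\<Sum>j<i. h * lcq_drift lam d a (y j) k)\<bar> \<le> \<epsilon>"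
    and i: "i \<le> m"
  shows "rho (y i) (flow (y 0) (real i * h))
    \<le> (\<epsilon> + T * (1 - a) + T * (4 * (1 + real d) * h) + 1 / real K) * exp (L * T)"
proof -
  define u where "u = y 0"
  define v where "v j = flow u (real j * h)" for j :: nat
  define Q where "Q = \<epsilon> + T * (1 - a) + T * (4 * (1 + real d) * h) + 1 / real K"
  have u: "u \<in> U_set" unfolding u_def using y by simp
  have vU: "v j \<in> U_set" for j unfolding v_def by (rule flow_U[OF u])
  have T: "T \<ge> 0" using mh h by (meson dual_order.trans less_imp_le mult_nonneg_nonneg of_nat_0_le_iff)
  have Q: "Q \<ge> 0" "1 / real K \<le> Q" using T a h \<epsilon> K by (auto simp: Q_def)
  have hL: "1 \<le> 1 + h * L" using h L_pos by simp
  have euler: "\<bar>v i k - u k - (\<Sum>j<i. h * lcq_drift lam d 1 (v j) k)\<bar> \<le> real i * (4 * (1 + real d) * h\<^sup>2)"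
    if "k \<ge> 1" for i k
  proof (induction i)
    case 0
    then show ?case by (simp add: v_def flow_0[OF u])
  next
    case (Suc i)
    have "\<bar>v (Suc i) k - v i k - h * lcq_drift lam d 1 (v i) k\<bar> \<le> 4 * (1 + real d) * h\<^sup>2"
      using flow_euler_error[OF u, of "real i * h" h k] h that by (simp add: v_def algebra_simps)
    with Suc show ?case by (simp add: algebra_simps)
  qed
  have "rho (y i) (v i) \<le> Q * (1 + h * L) ^ i" using i
  proof (induction i rule: less_induct)
    case (less i)
    have one: "1 \<le> (1 + h * L) ^ i" using hL by (rule one_le_power)
    show ?case
    proof (rule rho_leI[OF y[OF less.prems] vU])
      fix k :: nat assume k: "k \<ge> 1"
      show "\<bar>y i k - v i k\<bar> \<le> real k * (Q * (1 + h * L) ^ i)"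
      proof (cases "k \<le> K")
        case False
        have "\<bar>y i k - v i k\<bar> \<le> 1" by (rule U_set_dist_le_1[OF y[OF less.prems] vU])
        also have "1 \<le> real k * (1 / real K)" using False K by simp
        also have "\<dots> \<le> real k * (Q * 1)" using Q by (intro mult_left_mono) auto
        also have "\<dots> \<le> real k * (Q * (1 + h * L) ^ i)" using one Q by (intro mult_left_mono) auto
        finally show ?thesis .
      next
        case True
        have dr: "\<bar>h * lcq_drift lam d a (y j) k - h * lcq_drift lam d 1 (v j) k\<bar>
            \<le> h * (1 - a) + real k * (Q * ((h * L) * (1 + h * L) ^ j))" if "j < i" for j
        proof -
          have yj: "y j \<in> U_set" using y that less.prems by simp
          have D: "\<bar>y j l - v j l\<bar> \<le> real l * (Q * (1 + h * L) ^ j)" for l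
            by (rule rho_leD[OF yj vU less.IH[OF that]]) (use that less.prems in simp)
          have "\<bar>lcq_drift lam d a (y j) k - lcq_drift lam d 1 (y j) k\<bar> \<le> 1 - a"
            by (rule lcq_drift_alpha[OF a yj])
          moreover have "\<bar>lcq_drift lam d 1 (y j) k - lcq_drift lam d 1 (v j) k\<bar> \<le> real k * (L * (Q * (1 + h * L) ^ j))"
            unfolding L_def[symmetric]
            by (rule lcq_drift_lipschitz[of lam 1 "y j" "v j" k _ d, folded L_def])
              (use lam_pos lam_less_1 yj vU k D Q hL in auto)
          ultimately have "\<bar>lcq_drift lam d a (y j) k - lcq_drift lam d 1 (v j) k\<bar> \<le> (1 - a) + real k * (L * (Q * (1 + h * L) ^ j))"
            by linarith
          then have "h * \<bar>lcq_drift lam d a (y j) k - lcq_drift lam d 1 (v j) k\<bar> \<le> h * ((1 - a) + real k * (L * (Q * (1 + h * L) ^ j)))"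
            using h by (intro mult_left_mono) auto
          moreover have "\<bar>h * lcq_drift lam d a (y j) k - h * lcq_drift lam d 1 (v j) k\<bar> = h * \<bar>lcq_drift lam d a (y j) k - lcq_drift lam d 1 (v j) k\<bar>"
            using h by (simp add: abs_mult flip: right_diff_distrib)
          ultimately show ?thesis by (simp add: algebra_simps)
        qed
        have geo: "(\<Sum>j<i. (h * L) * (1 + h * L) ^ j) = (1 + h * L) ^ i - 1"
        proof -
          have "(\<Sum>j<i. (h * L) * (1 + h * L) ^ j) = (1 + h * L - 1) * (\<Sum>j<i. (1 + h * L) ^ j)"
            by (simp add: sum_distrib_left)
          also have "\<dots> = (1 + h * L) ^ i - 1" using power_diff_1_eq[of "1 + h * L" i] by simp
          finally show ?thesis .
        qed
        have ih: "real i * h \<le> T"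
          by (rule order_trans[OF mult_right_mono mh]) (use less.prems h in auto)
        let ?S = "\<Sum>j<i. h * lcq_drift lam d a (y j) k" and ?S' = "\<Sum>j<i. h * lcq_drift lam d 1 (v j) k"
        have "\<bar>?S - ?S'\<bar> \<le> (\<Sum>j<i. \<bar>h * lcq_drift lam d a (y j) k - h * lcq_drift lam d 1 (v j) k\<bar>)"
          unfolding sum_subtractf[symmetric] by (rule sum_abs)
        also have "\<dots> \<le> (\<Sum>j<i. h * (1 - a) + real k * (Q * ((h * L) * (1 + h * L) ^ j)))"
          by (intro sum_mono dr) auto
        also have "\<dots> = (real i * h) * (1 - a) + real k * (Q * ((1 + h * L) ^ i - 1))"
          unfolding sum.distrib geo[symmetric] sum_distrib_left by simp
        also have "(real i * h) * (1 - a) \<le> T * (1 - a)" using ih a by (intro mult_right_mono) auto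
        finally have S: "\<bar>?S - ?S'\<bar> \<le> T * (1 - a) + real k * (Q * ((1 + h * L) ^ i - 1))" by simp
        have "real i * (4 * (1 + real d) * h\<^sup>2) = (real i * h) * (4 * (1 + real d) * h)"
          by (simp add: power2_eq_square)
        also have "\<dots> \<le> T * (4 * (1 + real d) * h)" using ih h by (intro mult_right_mono) auto
        finally have eu: "\<bar>v i k - u k - ?S'\<bar> \<le> T * (4 * (1 + real d) * h)" using euler[OF k, of i] by linarith
        have "\<bar>y i k - u k - ?S\<bar> \<le> \<epsilon>" using mart[OF less.prems k True] by (simp add: u_def)
        then have "\<bar>y i k - v i k\<bar> \<le> \<epsilon> + (T * (1 - a) + real k * (Q * ((1 + h * L) ^ i - 1))) + T * (4 * (1 + real d) * h)"
          using S eu by linarith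
        also have "\<dots> \<le> 1 * Q + real k * (Q * ((1 + h * L) ^ i - 1))" using K by (simp add: Q_def)
        \<comment> \<open>The fixed error carries no weight; \<open>k \<ge> 1\<close> allows it to
          be counted with weight \<open>k\<close>, and it then cancels the \<open>- 1\<close> of the
          geometric sum.\<close>
        also have "\<dots> \<le> real k * Q + real k * (Q * ((1 + h * L) ^ i - 1))"
          using k Q by (intro add_right_mono mult_right_mono) auto
        also have "\<dots> = real k * (Q * (1 + h * L) ^ i)" by (simp add: algebra_simps)
        finally show ?thesis .
      qed
    qed
  qed
  also have "(1 + h * L) ^ i \<le> exp (h * L) ^ i"
    using hL by (intro power_mono) (auto simp: exp_ge_add_one_self)
  also have "exp (h * L) ^ i = exp (real i * (h * L))" by (simp add: exp_of_nat_mult)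
  also have "\<dots> \<le> exp (L * T)"
  proof -
    have "real i * h \<le> T" by (rule order_trans[OF mult_right_mono mh]) (use i h in auto)
    then have "L * (real i * h) \<le> L * T" using L_pos by (intro mult_left_mono) auto
    then show ?thesis by (simp add: mult_ac)
  qed
  finally show ?thesis using Q by (simp add: Q_def v_def u_def mult_left_mono)
qed

lemma not_exceeds_partial_sums:
  assumes "\<not> exceeds D \<epsilon> s xs" "i < length xs"
  shows "\<bar>s + (\<Sum>j<i. D (xs ! j) (xs ! Suc j))\<bar> \<le> \<epsilon>"
  using assms
proof (induction D \<epsilon> s xs arbitrary: i rule: exceeds.induct)
  case (3 D \<epsilon> s y z zs)
  show ?case
  proof (cases i)
    case (Suc i')
    then show ?thesis using "3.IH"[of i'] "3.prems"
      by (simp add: sum.lessThan_Suc_shift add.assoc del: sum.lessThan_Suc)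
  qed (use 3 in auto)
qed auto

text \<open>Countability allows the law of a sampled path to be summed over its possible
  values.\<close>

lemma countable_S_n: "countable (S_n n)"
proof (rule countable_subset)
  show "S_n n \<subseteq> (\<lambda>(l::nat list) k. if k < length l then real (l ! k) / real n else 0) ` UNIV"
  proof
    fix u assume u: "u \<in> S_n n"
    then have "\<forall>k. \<exists>m::nat. u k = real m / real n" by (auto simp: S_n_def)
    then obtain f :: "nat \<Rightarrow> nat" where f: "\<And>k. u k = real (f k) / real n" by metis
    obtain K where K: "\<And>k. k \<ge> K \<Longrightarrow> u k = 0" using u by (auto simp: S_n_def)
    have "u = (\<lambda>(l::nat list) k. if k < length l then real (l ! k) / real n else 0) (map f [0..<K])"
      using f K by (auto simp: fun_eq_iff)
    then show "u \<in> (\<lambda>(l::nat list) k. if k < length l then real (l ! k) / real n else 0) ` UNIV" by blast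
  qed
qed simp

lemma countable_lists_S_n: "countable {xs. length xs = m \<and> set xs \<subseteq> S_n n}"
  by (rule countable_subset[OF _ countable_lists[OF countable_S_n[of n]]]) auto

context lcq_chain
begin

sublocale flow: lcq_flow lam d
  by unfold_locales (rule lam_pos lam_less_1)+

lemma set_path_pmf:
  assumes "u \<in> S" "xs \<in> set_pmf (path_pmf (time_pmf h) m u)"
  shows "length xs = Suc m \<and> set xs \<subseteq> S"
  using assms
proof (induction m arbitrary: u xs)
  case (Suc m)
  then obtain z zs where "z \<in> set_pmf (time_pmf h u)" "zs \<in> set_pmf (path_pmf (time_pmf h) m z)" "xs = u # zs"
    by auto
  then show ?case using Suc.IH[of z zs] set_time_pmf[OF Suc.prems(1)] Suc.prems(1) by auto
qed auto

text \<open>The joint law of the process at the grid times \<open>0, h, \<dots>, m h\<close> is the law of a path of the chain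
  started from the initial distribution.\<close>

lemma process_grid_event:
  assumes proc: "is_LCQ_process n lam q d M X" and h: "h > 0"
    and bad: "\<And>u. u \<in> S \<Longrightarrow> emeasure (path_pmf (time_pmf h) m u) (- Good) \<le> ennreal \<delta>" and \<delta>: "\<delta> \<ge> 0"
    and A: "A \<in> sets M"
    and good: "\<And>\<omega>. \<omega> \<in> space M \<Longrightarrow> (\<And>i. i \<le> m \<Longrightarrow> X \<omega> (real i * h) \<in> S) \<Longrightarrow>
        map (\<lambda>i. X \<omega> (real i * h)) [0..<Suc m] \<in> Good \<Longrightarrow> \<omega> \<in> A"
  shows "1 - \<delta> \<le> measure M A"
proof -
  interpret M: prob_space M using proc by (simp add: is_LCQ_process_def)
  have [measurable]: "\<And>t k. (\<lambda>\<omega>. X \<omega> t k) \<in> borel_measurable M" using proc by (simp add: is_LCQ_process_def)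
  have eq_sets: "{\<omega>\<in>space M. X \<omega> t = x} \<in> sets M" for t x
    unfolding fun_eq_iff by measurable
  define E where "E xs = {\<omega>\<in>space M. \<forall>i\<le>m. X \<omega> (real i * h) = xs ! i}" for xs
  have E_sets: "E xs \<in> sets M" for xs unfolding E_def fun_eq_iff by measurable
  define \<mu>0 where "\<mu>0 x = (if x \<in> S then measure M {\<omega>\<in>space M. X \<omega> 0 = x} else 0)" for x
  have \<mu>0_total: "(\<integral>\<^sup>+ x. ennreal (\<mu>0 x) \<partial>count_space UNIV) = 1"
  proof -
    have "(\<integral>\<^sup>+ x. ennreal (\<mu>0 x) \<partial>count_space UNIV)
        = (\<integral>\<^sup>+ x. emeasure M {\<omega>\<in>space M. X \<omega> 0 = x} \<partial>count_space S)"
      unfolding \<mu>0_def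
      by (subst nn_integral_count_space_indicator)
        (auto intro!: nn_integral_cong simp: M.emeasure_eq_measure split: split_indicator)
    also have "\<dots> = emeasure M (\<Union>x\<in>S. {\<omega>\<in>space M. X \<omega> 0 = x})"
      by (rule emeasure_UN_countable[symmetric])
        (auto simp: disjoint_family_on_def countable_S_n intro: eq_sets)
    also have "(\<Union>x\<in>S. {\<omega>\<in>space M. X \<omega> 0 = x}) = {\<omega>\<in>space M. X \<omega> 0 \<in> S}" by auto
    also have "emeasure M \<dots> = 1" using proc by (simp add: is_LCQ_process_def M.emeasure_eq_measure)
    finally show ?thesis .
  qed
  define p0 where "p0 = embed_pmf \<mu>0"
  have p0: "pmf p0 x = \<mu>0 x" for x
    unfolding p0_def by (rule pmf_embed_pmf) (use \<mu>0_total in \<open>auto simp: \<mu>0_def\<close>)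
  have set_p0: "set_pmf p0 \<subseteq> S" by (auto simp: set_pmf_iff p0 \<mu>0_def split: if_splits)
  define P where "P = bind_pmf p0 (path_pmf (time_pmf h) m)"
  \<comment> \<open>The good paths that the chain can follow. They are countably many, so the
    probabilities of the disjoint events \<open>E xs\<close> add up.\<close>
  define \<L> where "\<L> = {xs. length xs = Suc m \<and> set xs \<subseteq> S} \<inter> Good"
  \<comment> \<open>Here the finite-dimensional laws in \<open>is_LCQ_process\<close> meet the
    product formula \<open>pmf_path_pmf\<close>.\<close>
  have P_E: "ennreal (pmf P xs) = emeasure M (E xs)" if xs: "xs \<in> \<L>" for xs
  proof -
    have len: "length xs = Suc m" and S: "set xs \<subseteq> S" using xs by (auto simp: \<L>_def)
    have ne: "xs \<noteq> []" using len by auto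
    have "pmf P xs = (\<integral>x. pmf (path_pmf (time_pmf h) m x) xs \<partial>p0)" by (simp add: P_def pmf_bind)
    also have "\<dots> = (\<Sum>x\<in>{hd xs}. pmf (path_pmf (time_pmf h) m x) xs * pmf p0 x)"
    proof (rule integral_measure_pmf_real)
      show "x \<in> {hd xs}" if "pmf (path_pmf (time_pmf h) m x) xs \<noteq> 0" for x
        using that path_pmf_hd[of xs "time_pmf h" m x] by (auto simp: set_pmf_iff)
    qed simp
    also have "\<dots> = \<mu>0 (xs ! 0) * (\<Prod>i<m. pmf (time_pmf h (xs ! i)) (xs ! Suc i))"
      using pmf_path_pmf[OF len, of "time_pmf h"] by (simp add: p0 hd_conv_nth[OF ne])
    also have "(\<Prod>i<m. pmf (time_pmf h (xs ! i)) (xs ! Suc i))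
        = (\<Prod>i<m. ptrans n lam q d (real (Suc i) * h - real i * h) (xs ! i) (xs ! Suc i))"
    proof (rule prod.cong[OF refl])
      fix i assume i: "i \<in> {..<m}"
      have "real (Suc i) * h - real i * h = h" by (simp add: algebra_simps)
      moreover have "xs ! i \<in> S" "xs ! Suc i \<in> S" using i len S by (auto intro!: subsetD[OF S] nth_mem)
      ultimately show "pmf (time_pmf h (xs ! i)) (xs ! Suc i)
          = ptrans n lam q d (real (Suc i) * h - real i * h) (xs ! i) (xs ! Suc i)"
        using pmf_time_pmf[OF h] by simp
    qed
    also have "\<mu>0 (xs ! 0) = measure M {\<omega>\<in>space M. X \<omega> 0 = xs ! 0}"
      using len S by (auto simp: \<mu>0_def intro!: subsetD[OF S] nth_mem)
    also have "measure M {\<omega>\<in>space M. X \<omega> 0 = xs ! 0}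
        * (\<Prod>i<m. ptrans n lam q d (real (Suc i) * h - real i * h) (xs ! i) (xs ! Suc i)) = measure M (E xs)"
    proof -
      have "\<forall>i\<le>m. xs ! i \<in> S" using len S by (auto intro!: subsetD[OF S] nth_mem)
      moreover have "\<forall>i<m. real i * h \<le> real (Suc i) * h" using h by (simp add: algebra_simps)
      moreover note proc[unfolded is_LCQ_process_def, THEN conjunct2, THEN conjunct2, THEN conjunct2, THEN conjunct2,
          THEN spec[of _ m], THEN spec[of _ "\<lambda>i. real i * h"], THEN spec[of _ "\<lambda>i. xs ! i"]]
      ultimately show ?thesis unfolding E_def by simp
    qed
    finally show ?thesis by (simp add: M.emeasure_eq_measure)
  qed
  have "emeasure P (- \<L>) = (\<integral>\<^sup>+ u. emeasure (path_pmf (time_pmf h) m u) (- \<L>) \<partial>p0)"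
    by (simp add: P_def)
  also have "\<dots> \<le> (\<integral>\<^sup>+ u. ennreal \<delta> \<partial>p0)"
  proof (rule nn_integral_mono_AE, simp only: AE_measure_pmf_iff, intro ballI)
    fix u assume "u \<in> set_pmf p0"
    then have u: "u \<in> S" using set_p0 by auto
    have "emeasure (path_pmf (time_pmf h) m u) (- \<L>) \<le> emeasure (path_pmf (time_pmf h) m u) (- Good)"
      by (rule emeasure_mono_AE) (use set_path_pmf[OF u] in \<open>auto simp: AE_measure_pmf_iff \<L>_def\<close>)
    also note bad[OF u]
    finally show "emeasure (path_pmf (time_pmf h) m u) (- \<L>) \<le> ennreal \<delta>" .
  qed
  also have "\<dots> = ennreal \<delta>" by simp
  finally have "measure P (- \<L>) \<le> \<delta>"
    using \<delta> by (simp add: measure_pmf.emeasure_eq_measure)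
  then have P_\<L>: "1 - \<delta> \<le> measure P \<L>"
    using measure_pmf.prob_compl[of \<L> P] by (simp add: Compl_eq_Diff_UNIV)
  have "ennreal (measure P \<L>) = (\<integral>\<^sup>+ xs. ennreal (pmf P xs) \<partial>count_space \<L>)"
    by (simp add: nn_integral_pmf measure_pmf.emeasure_eq_measure)
  also have "\<dots> = (\<integral>\<^sup>+ xs. emeasure M (E xs) \<partial>count_space \<L>)"
    by (rule nn_integral_cong) (use P_E in simp)
  also have "\<dots> = emeasure M (\<Union>xs\<in>\<L>. E xs)"
  proof (rule emeasure_UN_countable[symmetric])
    show "countable \<L>" unfolding \<L>_def
      by (rule countable_subset[OF _ countable_lists_S_n[of "Suc m" n]]) auto
    have "xs = ys" if "xs \<in> \<L>" "ys \<in> \<L>" "\<omega> \<in> E xs" "\<omega> \<in> E ys" for xs ys \<omega>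
      using that by (intro nth_equalityI) (auto simp: \<L>_def E_def)
    then show "disjoint_family_on E \<L>" by (auto simp: disjoint_family_on_def)
  qed (rule E_sets)
  also have "\<dots> \<le> emeasure M A"
  proof (rule emeasure_mono[OF _ A], safe)
    fix xs \<omega> assume xs: "xs \<in> \<L>" "\<omega> \<in> E xs"
    then have eq: "X \<omega> (real i * h) = xs ! i" if "i \<le> m" for i using that by (auto simp: E_def)
    have "map (\<lambda>i. X \<omega> (real i * h)) [0..<Suc m] = xs"
      using xs eq by (intro nth_equalityI) (auto simp: \<L>_def simp del: upt_Suc)
    moreover have "xs ! i \<in> S" if "i \<le> m" for i using xs that by (auto simp: \<L>_def)
    ultimately show "\<omega> \<in> A" using xs eq by (intro good) (auto simp: E_def \<L>_def)
  qed
  finally show ?thesis using P_\<L> by (simp add: M.emeasure_eq_measure)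
qed

end

context lcq_chain
begin

text \<open>The mesh condition gives m h^2 = T h \<le> T^2 / n, so biases and second moments summed
  over the grid are of order \<open>1 / n\<close>, however fine the grid is. The factor
  \<open>K\<close> is a union bound over coordinates.\<close>

lemma path_exceeds_bound:
  assumes h: "h > 0" and u: "u \<in> S" and \<epsilon>: "\<epsilon> > 0" and mh: "real m * h = T" and hn: "h \<le> T / real n"
  shows "emeasure (path_pmf (time_pmf h) m u) {xs. \<exists>k\<in>{1..K}. exceeds (increment_error h k) \<epsilon> 0 xs}
    \<le> ennreal (real K * ((4 * T + 16 * T\<^sup>2 + 2 * \<epsilon> * ((2 + 2 * real d) * (T + 2 * T\<^sup>2))) / real n / \<epsilon>\<^sup>2))"
proof -
  define b where "b = 4 * h / real n + 16 * h\<^sup>2"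
  define \<beta> where "\<beta> = (2 + 2 * real d) * (h / real n + 2 * h\<^sup>2)"
  have T: "0 \<le> T" using mh h by auto
  have mh2: "real m * h\<^sup>2 \<le> T\<^sup>2 / real n"
  proof -
    have "real m * h\<^sup>2 = T * h" unfolding mh[symmetric] by (simp add: power2_eq_square)
    also have "\<dots> \<le> T * (T / real n)" using hn T by (rule mult_left_mono)
    finally show ?thesis by (simp add: power2_eq_square)
  qed
  have mb: "real m * b \<le> (4 * T + 16 * T\<^sup>2) / real n"
  proof -
    have "real m * b = 4 * (real m * h) / real n + 16 * (real m * h\<^sup>2)" by (simp add: b_def algebra_simps)
    also have "\<dots> \<le> 4 * T / real n + 16 * (T\<^sup>2 / real n)" using mh2 mh by simp
    finally show ?thesis by (simp add: add_divide_distrib)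
  qed
  have m\<beta>: "real m * \<beta> \<le> (2 + 2 * real d) * ((T + 2 * T\<^sup>2) / real n)"
  proof -
    have "real m * \<beta> = (2 + 2 * real d) * (real m * h / real n + 2 * (real m * h\<^sup>2))"
      unfolding \<beta>_def by (simp add: algebra_simps)
    also have "\<dots> \<le> (2 + 2 * real d) * (T / real n + 2 * (T\<^sup>2 / real n))"
      using mh2 mh by (intro mult_left_mono) auto
    finally show ?thesis by (simp add: add_divide_distrib)
  qed
  have each: "emeasure (path_pmf (time_pmf h) m u) {xs. exceeds (increment_error h k) \<epsilon> 0 xs}
    \<le> ennreal ((4 * T + 16 * T\<^sup>2 + 2 * \<epsilon> * ((2 + 2 * real d) * (T + 2 * T\<^sup>2))) / real n / \<epsilon>\<^sup>2)"
    if k: "k \<in> {1..K}" for k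
  proof -
    have "emeasure (path_pmf (time_pmf h) m u) {xs. exceeds (increment_error h k) \<epsilon> 0 xs}
      \<le> ennreal ((0\<^sup>2 + real m * (b + 2 * \<epsilon> * \<beta>)) / \<epsilon>\<^sup>2)"
      by (rule path_pmf_exceeds[where S=S and B="1 + 2 * h"])
        (use set_time_pmf increment_error_bound increment_error_bias increment_error_second_moment h u \<epsilon> k
          in \<open>auto simp: b_def \<beta>_def\<close>)
    also have "\<dots> \<le> ennreal ((4 * T + 16 * T\<^sup>2 + 2 * \<epsilon> * ((2 + 2 * real d) * (T + 2 * T\<^sup>2))) / real n / \<epsilon>\<^sup>2)"
    proof (intro ennreal_leI divide_right_mono)
      have "real m * (b + 2 * \<epsilon> * \<beta>) = real m * b + 2 * \<epsilon> * (real m * \<beta>)" by (simp add: algebra_simps)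
      also have "\<dots> \<le> (4 * T + 16 * T\<^sup>2) / real n + 2 * \<epsilon> * ((2 + 2 * real d) * ((T + 2 * T\<^sup>2) / real n))"
        using \<epsilon> by (intro add_mono mb mult_left_mono m\<beta>) auto
      finally show "0\<^sup>2 + real m * (b + 2 * \<epsilon> * \<beta>) \<le> (4 * T + 16 * T\<^sup>2 + 2 * \<epsilon> * ((2 + 2 * real d) * (T + 2 * T\<^sup>2))) / real n"
        unfolding add_divide_distrib[of "4 * T + 16 * T\<^sup>2"] by simp
    qed simp
    finally show ?thesis .
  qed
  have "{xs. \<exists>k\<in>{1..K}. exceeds (increment_error h k) \<epsilon> 0 xs} = (\<Union>k\<in>{1..K}. {xs. exceeds (increment_error h k) \<epsilon> 0 xs})"
    by auto
  then have "emeasure (path_pmf (time_pmf h) m u) {xs. \<exists>k\<in>{1..K}. exceeds (increment_error h k) \<epsilon> 0 xs}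
     \<le> (\<Sum>k\<in>{1..K}. emeasure (path_pmf (time_pmf h) m u) {xs. exceeds (increment_error h k) \<epsilon> 0 xs})"
    by (simp only:) (rule emeasure_subadditive_finite, auto)
  also have "\<dots> \<le> (\<Sum>k\<in>{1..K}. ennreal ((4 * T + 16 * T\<^sup>2 + 2 * \<epsilon> * ((2 + 2 * real d) * (T + 2 * T\<^sup>2))) / real n / \<epsilon>\<^sup>2))"
    by (rule sum_mono[OF each])
  also have "\<dots> = ennreal (real K * ((4 * T + 16 * T\<^sup>2 + 2 * \<epsilon> * ((2 + 2 * real d) * (T + 2 * T\<^sup>2))) / real n / \<epsilon>\<^sup>2))"
    using T \<epsilon> by (subst ennreal_mult) (auto simp: ennreal_of_nat_eq_real_of_nat)
  finally show ?thesis .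
qed

text \<open>\<open>n \<le> 2 ^ p\<close> ensures the mesh condition. Measurability of the event is
  left to the caller, since it rests on measurability of the flow in its starting point, which is
  obtained through the coding of states.\<close>

lemma process_grid_near_flow:
  assumes proc: "is_LCQ_process n lam q d M X" and T: "T > 0" and \<epsilon>: "\<epsilon> > 0" and K: "K > 0" and p: "n \<le> 2 ^ p"
    and \<eta>: "(\<epsilon> + T * (1 - \<alpha>) + T * (4 * (1 + real d) * (T / real n)) + 1 / real K) * exp (flow.L * T) \<le> \<eta>"
    and meas: "{\<omega>\<in>space M. \<forall>i\<le>2^p. rho (X \<omega> (real i * (T / 2^p))) (flow.flow (X \<omega> 0) (real i * (T / 2^p))) \<le> \<eta>} \<in> sets M"
  shows "1 - real K * ((4 * T + 16 * T\<^sup>2 + 2 * \<epsilon> * ((2 + 2 * real d) * (T + 2 * T\<^sup>2))) / real n / \<epsilon>\<^sup>2)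
    \<le> measure M {\<omega>\<in>space M. \<forall>i\<le>2^p. rho (X \<omega> (real i * (T / 2^p))) (flow.flow (X \<omega> 0) (real i * (T / 2^p))) \<le> \<eta>}"
proof -
  define m :: nat where "m = 2 ^ p"
  define h where "h = T / real m"
  have hT: "T / 2 ^ p = h" by (simp add: h_def m_def)
  have m: "m > 0" "real n \<le> real m" unfolding of_nat_le_iff m_def by (simp, rule p)
  have h: "h > 0" and mh: "real m * h = T" using T m by (auto simp: h_def)
  have hn: "h \<le> T / real n" unfolding h_def using T m n_pos by (intro divide_left_mono) auto
  show ?thesis
  proof (rule process_grid_event[OF proc h _ _ meas, where m=m and Good="- {xs. \<exists>k\<in>{1..K}. exceeds (increment_error h k) \<epsilon> 0 xs}"])
    show "emeasure (path_pmf (time_pmf h) m u) (- (- {xs. \<exists>k\<in>{1..K}. exceeds (increment_error h k) \<epsilon> 0 xs}))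
      \<le> ennreal (real K * ((4 * T + 16 * T\<^sup>2 + 2 * \<epsilon> * ((2 + 2 * real d) * (T + 2 * T\<^sup>2))) / real n / \<epsilon>\<^sup>2))"
      if "u \<in> S" for u
      unfolding double_compl by (rule path_exceeds_bound[OF h that \<epsilon> mh hn])
    show "0 \<le> real K * ((4 * T + 16 * T\<^sup>2 + 2 * \<epsilon> * ((2 + 2 * real d) * (T + 2 * T\<^sup>2))) / real n / \<epsilon>\<^sup>2)"
      using T \<epsilon> by auto
    fix \<omega> assume \<omega>: "\<omega> \<in> space M" and XS: "\<And>i. i \<le> m \<Longrightarrow> X \<omega> (real i * h) \<in> S"
      and good: "map (\<lambda>i. X \<omega> (real i * h)) [0..<Suc m] \<in> - {xs. \<exists>k\<in>{1..K}. exceeds (increment_error h k) \<epsilon> 0 xs}"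
    define y where "y i = X \<omega> (real i * h)" for i :: nat
    have y0: "y 0 = X \<omega> 0" by (simp add: y_def)
    have "rho (y i) (flow.flow (y 0) (real i * h)) \<le> \<eta>" if i: "i \<le> m" for i
    proof -
      have "rho (y i) (flow.flow (y 0) (real i * h))
         \<le> (\<epsilon> + T * (1 - \<alpha>) + T * (4 * (1 + real d) * h) + 1 / real K) * exp (flow.L * T)"
      proof (rule flow.discrete_gronwall[where m=m])
        show "y i \<in> U_set" if "i \<le> m" for i using XS[OF that] S_U by (simp add: y_def)
        fix i k assume ik: "i \<le> m" "1 \<le> k" "k \<le> K"
        have "\<not> exceeds (increment_error h k) \<epsilon> 0 (map y [0..<Suc m])"
          using good ik unfolding y_def[abs_def] by (auto simp del: upt_Suc)
        from not_exceeds_partial_sums[OF this, of i]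
        have "\<bar>\<Sum>j<i. increment_error h k (map y [0..<Suc m] ! j) (map y [0..<Suc m] ! Suc j)\<bar> \<le> \<epsilon>"
          using ik by (simp del: upt_Suc)
        also have "(\<Sum>j<i. increment_error h k (map y [0..<Suc m] ! j) (map y [0..<Suc m] ! Suc j))
            = (\<Sum>j<i. (y (Suc j) k - y j k) - h * lcq_drift lam d \<alpha> (y j) k)"
          using ik by (intro sum.cong refl) (auto simp: increment_error_def nth_append simp del: upt_Suc)
        also have "\<dots> = y i k - y 0 k - (\<Sum>j<i. h * lcq_drift lam d \<alpha> (y j) k)"
          unfolding sum_subtractf[of "\<lambda>j. y (Suc j) k - y j k"] sum_lessThan_telescope[of "\<lambda>j. y j k"] ..
        finally show "\<bar>y i k - y 0 k - (\<Sum>j<i. h * lcq_drift lam d \<alpha> (y j) k)\<bar> \<le> \<epsilon>" .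
      qed (use h mh alpha_nonneg alpha_le_1 K \<epsilon> i in auto)
      also have "\<dots> \<le> (\<epsilon> + T * (1 - \<alpha>) + T * (4 * (1 + real d) * (T / real n)) + 1 / real K) * exp (flow.L * T)"
        using hn T by (intro mult_right_mono add_mono mult_left_mono) auto
      also note \<eta>
      finally show ?thesis .
    qed
    then show "\<omega> \<in> {\<omega>\<in>space M. \<forall>i\<le>2^p. rho (X \<omega> (real i * (T / 2^p))) (flow.flow (X \<omega> 0) (real i * (T / 2^p))) \<le> \<eta>}"
      using \<omega> unfolding hT m_def[symmetric] y0 by (simp add: y_def)
  qed
qed

end

section \<open>The limit process\<close>

context lcq_flow
begin

definition psi :: "real \<Rightarrow> real \<Rightarrow> nat \<Rightarrow> real" where
  "psi s = flow (param_U s)"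

lemma psi_U: "psi s t \<in> U_set"
  unfolding psi_def by (rule flow_U[OF param_U_in_U])

lemma psi_D_U: "psi s \<in> D_U"
  unfolding psi_def by (rule flow_D_U[OF param_U_in_U])

lemma psi_state_code: "u \<in> U_set \<Longrightarrow> psi (state_code u) = flow u"
  by (simp add: psi_def param_U_state_code)

lemma psi_sequentially:
  assumes s: "s \<longlonglongrightarrow> a" and e: "e > 0"
  shows "eventually (\<lambda>n. \<forall>t\<in>{0..T}. rho (psi (s n) t) (psi a t) < e) sequentially"
proof -
  have "e * exp (- (L * T)) > 0" using e by simp
  from param_U_sequentially[OF s this] show ?thesis
  proof eventually_elim
    case (elim n)
    show ?case
    proof
      fix t assume t: "t \<in> {0..T}"
      have "rho (psi (s n) t) (psi a t) \<le> rho (param_U (s n)) (param_U a) * exp (L * t)"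
        unfolding psi_def using t by (intro flow_lipschitz param_U_in_U) auto
      also have "\<dots> \<le> rho (param_U (s n)) (param_U a) * exp (L * T)"
        using t L_pos by (intro mult_left_mono rho_nonneg param_U_in_U) auto
      also have "\<dots> < e * exp (- (L * T)) * exp (L * T)" using elim by (intro mult_strict_right_mono) auto
      also have "\<dots> = e" by (simp add: exp_minus)
      finally show "rho (psi (s n) t) (psi a t) < e" .
    qed
  qed
qed

lemma continuous_psi: "continuous_on UNIV (\<lambda>s. psi s t k)"
proof (rule continuous_at_imp_continuous_on, intro ballI)
  fix a :: real
  show "isCont (\<lambda>s. psi s t k) a"
    unfolding continuous_at_sequentially
  proof (intro allI impI)
    fix s assume s: "s \<longlonglongrightarrow> a"
    have max: "psi x t = psi x (max 0 t)" for x by (auto simp: psi_def flow_def)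
    show "((\<lambda>s. psi s t k) \<circ> s) \<longlonglongrightarrow> psi a t k"
    proof (rule tendstoI)
      fix e :: real assume e: "e > 0"
      then have "e / (real k + 1) > 0" by simp
      from psi_sequentially[OF s this, of "max 0 t"]
      show "eventually (\<lambda>n. dist (((\<lambda>s. psi s t k) \<circ> s) n) (psi a t k) < e) sequentially"
      proof eventually_elim
        case (elim n)
        then have "rho (psi (s n) t) (psi a t) < e / (real k + 1)" using max by auto
        then have "\<bar>psi (s n) t k - psi a t k\<bar> \<le> real k * (e / (real k + 1))"
          using rho_leD[OF psi_U psi_U] less_imp_le by blast
        also have "\<dots> < e" using e by (simp add: field_simps)
        finally show ?case by (simp add: dist_real_def)
      qed
    qed
  qed
qed

text \<open>Continuity of \<open>psi\<close> in its real parameter, composed with the measurable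
  code, takes the place of a \<sigma>-algebra on \<open>U_set\<close>.\<close>

lemma flow_measurable:
  assumes "\<And>k. (\<lambda>\<omega>. Y \<omega> k) \<in> borel_measurable M" and "\<And>\<omega>. \<omega> \<in> space M \<Longrightarrow> Y \<omega> \<in> U_set"
  shows "(\<lambda>\<omega>. flow (Y \<omega>) t k) \<in> borel_measurable M"
proof -
  have "(\<lambda>\<omega>. psi (state_code (Y \<omega>)) t k) \<in> borel_measurable M"
    by (rule measurable_compose[OF state_code_measurable[OF assms(1)] borel_measurable_continuous_onI[OF continuous_psi]])
  then show ?thesis
    by (rule subst[OF measurable_cong, rotated]) (simp add: psi_state_code assms(2))
qed

text \<open>Compactness of [0, 1]: if no \<eta> and \<open>T\<close> worked, the parameters of
  counterexamples would accumulate at some \<open>a\<close>, the paths and the trajectories would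
  both tend to \<open>psi a\<close>, and continuity of \<open>F\<close> there would force their
  difference to 0. The strict \<open>t < T\<close> matches what right continuity extracts from grids
  on [0, T].\<close>

lemma skor_bcont_uniform_on_psi:
  assumes F: "skor_bcont F" and e: "e > 0"
  obtains \<eta> T where "\<eta> > 0" "T > 0"
    "\<And>s y. 0 \<le> s \<Longrightarrow> s \<le> 1 \<Longrightarrow> y \<in> D_U \<Longrightarrow> (\<And>t. 0 \<le> t \<Longrightarrow> t < T \<Longrightarrow> rho (y t) (psi s t) \<le> \<eta>) \<Longrightarrow> \<bar>F y - F (psi s)\<bar> < e"
proof (rule ccontr)
  assume no: "\<not> thesis"
  have "\<exists>s y. 0 \<le> s \<and> s \<le> 1 \<and> y \<in> D_U \<and> (\<forall>t. 0 \<le> t \<longrightarrow> t < real (Suc i) \<longrightarrow> rho (y t) (psi s t) \<le> 1 / real (Suc i))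
      \<and> e \<le> \<bar>F y - F (psi s)\<bar>" for i
  proof (rule ccontr)
    assume neg: "\<not> ?thesis"
    have "\<bar>F y - F (psi s)\<bar> < e"
      if "0 \<le> s" "s \<le> 1" "y \<in> D_U" "\<And>t. 0 \<le> t \<Longrightarrow> t < real (Suc i) \<Longrightarrow> rho (y t) (psi s t) \<le> 1 / real (Suc i)" for s y
      using neg that by (meson not_le)
    then show False using that[of "1 / real (Suc i)" "real (Suc i)"] no by simp
  qed
  then obtain s y where sy: "\<And>i. 0 \<le> s i" "\<And>i. s i \<le> 1" "\<And>i. y i \<in> D_U"
    "\<And>i t. 0 \<le> t \<Longrightarrow> t < real (Suc i) \<Longrightarrow> rho (y i t) (psi (s i) t) \<le> 1 / real (Suc i)"
    "\<And>i. e \<le> \<bar>F (y i) - F (psi (s i))\<bar>" by metis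
  have "compact {0..1::real}" by simp
  moreover have "\<forall>i. s i \<in> {0..1}" using sy by auto
  ultimately obtain a r where r: "strict_mono r" "(s \<circ> r) \<longlonglongrightarrow> a"
    unfolding compact_eq_seq_compact_metric seq_compact_def by metis
  have U: "y i t \<in> U_set" if "t \<ge> 0" for i t using sy(3)[of i] that by (auto simp: D_U_def)
  \<comment> \<open>Used twice: for the offending paths and for the trajectories
    \<open>psi (s (r i))\<close> themselves.\<close>
  have close: "eventually (\<lambda>i. skor_dist (psi a) (z i) < e') sequentially"
    if e': "e' > 0" and z: "\<And>i t. 0 \<le> t \<Longrightarrow> z i t \<in> U_set"
      "\<And>i t. 0 \<le> t \<Longrightarrow> t < real (Suc i) \<Longrightarrow> rho (z i t) (psi (s (r i)) t) \<le> 1 / real (Suc i)" for e' z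
  proof -
    obtain T where T: "T > 0" "exp (- T) < e' / 4" using exp_neg_small[of "e' / 4"] e' by auto
    have "(\<lambda>i. 1 / real (Suc i)) \<longlonglongrightarrow> 0" by real_asymp
    then have "eventually (\<lambda>i. 1 / real (Suc i) < e' / 4) sequentially"
      using e' by (intro order_tendstoD) auto
    moreover have "eventually (\<lambda>i. real (Suc i) > T) sequentially" by real_asymp
    moreover have "eventually (\<lambda>i. \<forall>t\<in>{0..T}. rho (psi ((s \<circ> r) i) t) (psi a t) < e' / 4) sequentially"
      by (rule psi_sequentially[OF r(2)]) (use e' in simp)
    ultimately show ?thesis
    proof eventually_elim
      case (elim i)
      have "skor_dist (psi a) (z i) \<le> e' / 2 + exp (- T)"
      proof (rule skor_dist_le_uniform)
        fix t assume t: "0 \<le> t" "t \<le> T"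
        have "rho (psi a t) (z i t) \<le> rho (psi a t) (psi (s (r i)) t) + rho (psi (s (r i)) t) (z i t)"
          by (rule rho_triangle) (use t z psi_U in auto)
        moreover have "rho (psi a t) (psi (s (r i)) t) < e' / 4" using elim(3) t by (auto simp: rho_commute)
        moreover have "rho (psi (s (r i)) t) (z i t) \<le> 1 / real (Suc i)" using z(2)[of t i] elim t by (auto simp: rho_commute)
        ultimately show "rho (psi a t) (z i t) \<le> e' / 2" using elim(1) by linarith
      qed (use T e' in auto)
      then show ?case using T e' by linarith
    qed
  qed
  have "(\<lambda>i. F (y (r i))) \<longlonglongrightarrow> F (psi a)"
  proof (rule skor_bcont_tendsto[OF F psi_D_U sy(3) close])
    fix i :: nat and t :: real
    assume t: "0 \<le> t" "t < real (Suc i)"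
    have ri: "i \<le> r i" by (rule seq_suble[OF r(1)])
    have "rho (y (r i) t) (psi (s (r i)) t) \<le> 1 / real (Suc (r i))"
      by (rule sy(4)) (use t ri in auto)
    also have "\<dots> \<le> 1 / real (Suc i)" using ri by (intro divide_left_mono) auto
    finally show "rho (y (r i) t) (psi (s (r i)) t) \<le> 1 / real (Suc i)" .
  qed (auto intro: U)
  moreover have "(\<lambda>i. F (psi (s (r i)))) \<longlonglongrightarrow> F (psi a)"
    by (rule skor_bcont_tendsto[OF F psi_D_U psi_D_U close]) (auto simp: psi_U rho_refl)
  ultimately have "(\<lambda>i. \<bar>F (y (r i)) - F (psi (s (r i)))\<bar>) \<longlonglongrightarrow> \<bar>F (psi a) - F (psi a)\<bar>"
    by (intro tendsto_intros)
  then have "eventually (\<lambda>i. \<bar>F (y (r i)) - F (psi (s (r i)))\<bar> < e) sequentially"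
    using e by (intro order_tendstoD) auto
  then obtain i where "\<bar>F (y (r i)) - F (psi (s (r i)))\<bar> < e"
    by (auto simp: eventually_sequentially)
  with sy(5)[of "r i"] show False by simp
qed

lemma isCont_psi:
  assumes F: "skor_bcont F"
  shows "isCont (\<lambda>s. F (psi s)) a"
  unfolding continuous_at_sequentially
proof (intro allI impI)
  fix s assume s: "s \<longlonglongrightarrow> a"
  have "eventually (\<lambda>i. skor_dist (psi a) (psi (s i)) < e) sequentially" if e: "e > 0" for e
  proof -
    obtain T where T: "T > 0" "exp (- T) < e / 2" using exp_neg_small[of "e / 2"] e by auto
    have "e / 2 > 0" using e by simp
    from psi_sequentially[OF s this, of T] show ?thesis
    proof eventually_elim
      case (elim i)
      have "skor_dist (psi a) (psi (s i)) \<le> e / 2 + exp (- T)"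
        by (rule skor_dist_le_uniform) (use T e elim in \<open>auto simp: rho_commute intro: less_imp_le\<close>)
      then show ?case using T by linarith
    qed
  qed
  then have "(\<lambda>i. F (psi (s i))) \<longlonglongrightarrow> F (psi a)" by (rule skor_bcont_tendsto[OF F psi_D_U psi_D_U])
  then show "((\<lambda>s. F (psi s)) \<circ> s) \<longlonglongrightarrow> F (psi a)" by (simp add: comp_def)
qed

text \<open>The probability bound is the same at every fine enough dyadic level, so it survives the
  intersection of the decreasing events \<open>C p\<close>. On the intersection, right continuity of
  both paths carries the estimate from dyadic times to all times.\<close>

lemma process_near_flow:
  fixes M :: "'a measure"
  assumes n: "n \<ge> 1" and q: "0 < q" "q \<le> 1" and proc: "is_LCQ_process n lam q d M X"
    and T: "T > 0" and \<epsilon>: "\<epsilon> > 0" and K: "K > 0"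
    and \<eta>: "(\<epsilon> + T * (1 - alpha_n q n) + T * (4 * (1 + real d) * (T / real n)) + 1 / real K) * exp (L * T) \<le> \<eta>"
  obtains G where "G \<in> sets M"
    "1 - real K * ((4 * T + 16 * T\<^sup>2 + 2 * \<epsilon> * ((2 + 2 * real d) * (T + 2 * T\<^sup>2))) / real n / \<epsilon>\<^sup>2) \<le> measure M G"
    "\<And>\<omega> t. \<omega> \<in> G \<Longrightarrow> 0 \<le> t \<Longrightarrow> t < T \<Longrightarrow> rho (X \<omega> t) (flow (X \<omega> 0) t) \<le> \<eta>"
proof -
  interpret chain: lcq_chain n lam q d
    by unfold_locales (use n q lam_pos lam_less_1 in auto)
  interpret M: prob_space M using proc by (simp add: is_LCQ_process_def)
  have XD: "X \<omega> \<in> D_U" if "\<omega> \<in> space M" for \<omega> using proc that by (simp add: is_LCQ_process_def)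
  have XU: "X \<omega> t \<in> U_set" if "\<omega> \<in> space M" "t \<ge> 0" for \<omega> t using XD[OF that(1)] that(2) by (auto simp: D_U_def)
  have X[measurable]: "(\<lambda>\<omega>. X \<omega> t k) \<in> borel_measurable M" for t k using proc by (simp add: is_LCQ_process_def)
  have flow[measurable]: "(\<lambda>\<omega>. flow (X \<omega> 0) t k) \<in> borel_measurable M" for t k
    by (rule flow_measurable) (auto simp: XU)
  define C where "C p = {\<omega>\<in>space M. \<forall>i\<le>2^p. rho (X \<omega> (real i * (T / 2^p))) (flow (X \<omega> 0) (real i * (T / 2^p))) \<le> \<eta>}" for p :: nat
  have C_sets: "C p \<in> sets M" for p
  proof -
    have "C p = {\<omega>\<in>space M. \<forall>i\<le>2^p. \<forall>k\<ge>1. \<bar>X \<omega> (real i * (T / 2^p)) k - flow (X \<omega> 0) (real i * (T / 2^p)) k\<bar> \<le> real k * \<eta>}"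
      unfolding C_def by (rule Collect_cong, rule conj_cong[OF refl], subst rho_le_iff) (auto simp: XU flow_U T less_imp_le)
    also have "\<dots> \<in> sets M" by measurable
    finally show ?thesis .
  qed
  let ?\<delta> = "real K * ((4 * T + 16 * T\<^sup>2 + 2 * \<epsilon> * ((2 + 2 * real d) * (T + 2 * T\<^sup>2))) / real n / \<epsilon>\<^sup>2)"
  have C_prob: "1 - ?\<delta> \<le> measure M (C p)" if "p \<ge> n" for p
    unfolding C_def
  proof (rule chain.process_grid_near_flow[OF proc T \<epsilon> K _ \<eta>])
    have "n \<le> 2 ^ n" by (simp add: less_imp_le)
    also have "(2::nat) ^ n \<le> 2 ^ p" using that by (intro power_increasing) auto
    finally show "n \<le> 2 ^ p" .
  qed (rule C_sets[unfolded C_def])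
  have dec: "decseq C"
  proof (rule decseq_SucI, rule subsetI)
    fix p \<omega> assume \<omega>: "\<omega> \<in> C (Suc p)"
    have "rho (X \<omega> (real i * (T / 2^p))) (flow (X \<omega> 0) (real i * (T / 2^p))) \<le> \<eta>" if "i \<le> 2^p" for i
    proof -
      have "2 * i \<le> 2 ^ Suc p" using that by simp
      then have "rho (X \<omega> (real (2 * i) * (T / 2^Suc p))) (flow (X \<omega> 0) (real (2 * i) * (T / 2^Suc p))) \<le> \<eta>"
        using \<omega> unfolding C_def by blast
      then show ?thesis by simp
    qed
    then show "\<omega> \<in> C p" using \<omega> by (auto simp: C_def)
  qed
  show ?thesis
  proof (rule that[of "\<Inter>p. C p"])
    show "(\<Inter>p. C p) \<in> sets M" using C_sets by auto
    have "(\<lambda>p. measure M (C p)) \<longlonglongrightarrow> measure M (\<Inter>p. C p)"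
      by (rule M.finite_Lim_measure_decseq) (use C_sets dec in auto)
    then show "1 - ?\<delta> \<le> measure M (\<Inter>p. C p)"
      by (rule LIMSEQ_le_const) (use C_prob in blast)
    fix \<omega> t assume \<omega>: "\<omega> \<in> (\<Inter>p. C p)" and t: "0 \<le> t" "t < T"
    have sp: "\<omega> \<in> space M" using \<omega> by (auto simp: C_def)
    show "rho (X \<omega> t) (flow (X \<omega> 0) t) \<le> \<eta>"
    proof (rule field_le_epsilon)
      fix e :: real assume e: "e > 0"
      have e2: "e / 2 > 0" using e by simp
      obtain \<delta> where \<delta>: "\<delta> > 0" "\<And>s. t \<le> s \<Longrightarrow> s < t + \<delta> \<Longrightarrow> rho (X \<omega> s) (X \<omega> t) < e / 2"
        using D_U_right_continuous[OF XD[OF sp] t(1) e2] by blast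
      have fD: "flow (X \<omega> 0) \<in> D_U" by (rule flow_D_U[OF XU[OF sp]]) simp
      obtain \<delta>' where \<delta>': "\<delta>' > 0" "\<And>s. t \<le> s \<Longrightarrow> s < t + \<delta>' \<Longrightarrow> rho (flow (X \<omega> 0) s) (flow (X \<omega> 0) t) < e / 2"
        using D_U_right_continuous[OF fD t(1) e2] by blast
      have "(\<lambda>p. T / 2 ^ p) \<longlonglongrightarrow> 0" by real_asymp
      then have "eventually (\<lambda>p. T / 2 ^ p < min \<delta> \<delta>') sequentially"
        using \<delta> \<delta>' by (intro order_tendstoD) auto
      then obtain p :: nat where p: "T / 2 ^ p < min \<delta> \<delta>'" by (auto simp: eventually_sequentially)
      define w where "w = 2 ^ p * t / T"
      have w: "0 \<le> w" "w < 2 ^ p" using t T by (auto simp: w_def field_simps)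
      \<comment> \<open>Index of the first grid point strictly after \<open>t\<close>; it is at most
        \<open>2 ^ p\<close> because \<open>t < T\<close>.\<close>
      define i where "i = nat (\<lfloor>w\<rfloor> + 1)"
      have ri: "real i = real_of_int \<lfloor>w\<rfloor> + 1" using w by (simp add: i_def)
      have "\<lfloor>w\<rfloor> < 2 ^ p" using w by (simp add: floor_less_iff)
      then have i2: "i \<le> 2 ^ p" unfolding i_def by (simp add: nat_le_iff)
      have wi: "w \<le> real i" "real i \<le> w + 1" unfolding ri by linarith+
      define s where "s = real i * (T / 2 ^ p)"
      have tw: "t = w * (T / 2 ^ p)" using T by (simp add: w_def)
      have ts: "t \<le> s" unfolding tw s_def using wi T by (intro mult_right_mono) auto
      have "s \<le> (w + 1) * (T / 2 ^ p)" unfolding s_def using wi T by (intro mult_right_mono) auto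
      also have "\<dots> = t + T / 2 ^ p" unfolding tw by (simp only: distrib_right mult_1_left)
      finally have st: "s < t + \<delta>" "s < t + \<delta>'" using p by auto
      have s: "rho (X \<omega> s) (flow (X \<omega> 0) s) \<le> \<eta>"
        using \<omega> i2 unfolding s_def C_def by blast
      have in_U: "X \<omega> t \<in> U_set" "X \<omega> s \<in> U_set" "flow (X \<omega> 0) s \<in> U_set" "flow (X \<omega> 0) t \<in> U_set"
        using XU[OF sp] t ts by (auto intro!: flow_U)
      have "rho (X \<omega> t) (flow (X \<omega> 0) t) \<le> rho (X \<omega> t) (X \<omega> s) + rho (X \<omega> s) (flow (X \<omega> 0) t)"
        by (rule rho_triangle) (use in_U in auto)
      also have "rho (X \<omega> s) (flow (X \<omega> 0) t) \<le> rho (X \<omega> s) (flow (X \<omega> 0) s) + rho (flow (X \<omega> 0) s) (flow (X \<omega> 0) t)"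
        by (rule rho_triangle) (use in_U in auto)
      finally show "rho (X \<omega> t) (flow (X \<omega> 0) t) \<le> \<eta> + e"
        using \<delta>(2)[OF ts st(1)] \<delta>'(2)[OF ts st(2)] s rho_commute[of "X \<omega> t" "X \<omega> s"] by linarith
    qed
  qed
qed

end

lemma skor_bcont_bounded:
  assumes "skor_bcont F"
  shows "\<exists>B>0. \<forall>x\<in>D_U. \<bar>F x\<bar> \<le> B"
proof -
  obtain B where "\<forall>x\<in>D_U. \<bar>F x\<bar> \<le> B" using assms unfolding skor_bcont_def by blast
  then have "\<forall>x\<in>D_U. \<bar>F x\<bar> \<le> \<bar>B\<bar> + 1" by force
  then show ?thesis by (intro exI[of _ "\<bar>B\<bar> + 1"]) auto
qed

context lcq_flow
begin

text \<open>None of the estimates depends on the initial law, so \<open>n0\<close> can be fixed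
  before the process.\<close>

lemma process_tracks_flow:
  assumes q: "0 < q" "q \<le> 1" and \<eta>: "\<eta> > 0" and T: "T > 0" and e: "e > 0"
  obtains n0 where "\<And>n (M :: 'a measure) X. n \<ge> n0 \<Longrightarrow> n \<ge> 1 \<Longrightarrow> is_LCQ_process n lam q d M X \<Longrightarrow>
    \<exists>G\<in>sets M. 1 - e \<le> measure M G \<and> (\<forall>\<omega>\<in>G. \<forall>t. 0 \<le> t \<longrightarrow> t < T \<longrightarrow> rho (X \<omega> t) (flow (X \<omega> 0) t) \<le> \<eta>)"
proof -
  define E where "E = exp (L * T)"
  have E: "E > 0" by (simp add: E_def)
  \<comment> \<open>Three quantities of size at most \<epsilon> have to fit under
    \<open>\<eta> / E\<close>: the fluctuation, the terms vanishing in \<open>n\<close>, and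
    \<open>1 / K\<close>. The factor 4 leaves slack.\<close>
  define \<epsilon> where "\<epsilon> = \<eta> / (4 * E)"
  have \<epsilon>: "\<epsilon> > 0" using \<eta> E by (simp add: \<epsilon>_def)
  obtain K' :: nat where K': "1 / real (Suc K') < \<epsilon>" using nat_approx_posE[OF \<epsilon>] by auto
  define K where "K = Suc K'"
  define C where "C = 4 * T + 16 * T\<^sup>2 + 2 * \<epsilon> * ((2 + 2 * real d) * (T + 2 * T\<^sup>2))"
  have "(\<lambda>n. T * (1 - q) ^ n + T * (4 * (1 + real d) * (T / real n))) \<longlonglongrightarrow> T * 0 + 0"
  proof (intro tendsto_add tendsto_mult tendsto_const LIMSEQ_power_zero)
    show "norm (1 - q) < 1" using q by simp
    show "(\<lambda>n. T * (4 * (1 + real d) * (T / real n))) \<longlonglongrightarrow> 0" by real_asymp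
  qed
  then have "eventually (\<lambda>n. T * (1 - q) ^ n + T * (4 * (1 + real d) * (T / real n)) < \<epsilon>) sequentially"
    using \<epsilon> by (intro order_tendstoD) auto
  moreover have "eventually (\<lambda>n. real K * (C / real n / \<epsilon>\<^sup>2) < e) sequentially"
  proof -
    have "(\<lambda>n. real K * (C / real n / \<epsilon>\<^sup>2)) \<longlonglongrightarrow> 0" using \<epsilon> by real_asymp
    then show ?thesis using e by (intro order_tendstoD) auto
  qed
  ultimately have "eventually (\<lambda>n. T * (1 - q) ^ n + T * (4 * (1 + real d) * (T / real n)) < \<epsilon>
      \<and> real K * (C / real n / \<epsilon>\<^sup>2) < e) sequentially" by (rule eventually_conj)
  then obtain n0 where n0: "\<And>n. n \<ge> n0 \<Longrightarrow> T * (1 - q) ^ n + T * (4 * (1 + real d) * (T / real n)) < \<epsilon>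
      \<and> real K * (C / real n / \<epsilon>\<^sup>2) < e" by (auto simp: eventually_sequentially)
  show ?thesis
  proof (rule that[of n0])
    fix n and M :: "'a measure" and X
    assume n: "n \<ge> n0" "n \<ge> 1" and proc: "is_LCQ_process n lam q d M X"
    have "\<epsilon> + T * (1 - alpha_n q n) + T * (4 * (1 + real d) * (T / real n)) + 1 / real K \<le> 4 * \<epsilon>"
      using n0[OF n(1)] K' \<epsilon> by (simp add: alpha_n_def K_def)
    then have "(\<epsilon> + T * (1 - alpha_n q n) + T * (4 * (1 + real d) * (T / real n)) + 1 / real K) * exp (L * T) \<le> 4 * \<epsilon> * E"
      unfolding E_def[symmetric] using E by (intro mult_right_mono) auto
    also have "\<dots> = \<eta>" using E by (simp add: \<epsilon>_def)
    finally have bound: "(\<epsilon> + T * (1 - alpha_n q n) + T * (4 * (1 + real d) * (T / real n)) + 1 / real K) * exp (L * T) \<le> \<eta>" .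
    have K: "K > 0" by (simp add: K_def)
    obtain G where G: "G \<in> sets M" "1 - real K * (C / real n / \<epsilon>\<^sup>2) \<le> measure M G"
      "\<And>\<omega> t. \<omega> \<in> G \<Longrightarrow> 0 \<le> t \<Longrightarrow> t < T \<Longrightarrow> rho (X \<omega> t) (flow (X \<omega> 0) t) \<le> \<eta>"
      using process_near_flow[OF n(2) q proc T \<epsilon> K bound] unfolding C_def[symmetric] by metis
    have "1 - e \<le> measure M G" using G(2) n0[OF n(1)] by linarith
    with G show "\<exists>G\<in>sets M. 1 - e \<le> measure M G \<and> (\<forall>\<omega>\<in>G. \<forall>t. 0 \<le> t \<longrightarrow> t < T \<longrightarrow> rho (X \<omega> t) (flow (X \<omega> 0) t) \<le> \<eta>)"
      by blast
  qed
qed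

text \<open>Off the good event the two functionals differ by at most \<open>2 * B\<close>; on it,
  \<open>state_code\<close> turns the start into a parameter in [0, 1], where the uniform continuity
  estimate applies.\<close>

lemma functional_tracks_flow:
  fixes M :: "nat \<Rightarrow> 'a measure"
  assumes q: "0 < q" "q \<le> 1" and F: "skor_bcont F"
    and proc: "\<And>n. n \<ge> 1 \<Longrightarrow> is_LCQ_process n lam q d (M n) (X n)"
  shows "(\<lambda>n. integral\<^sup>L (M n) (\<lambda>\<omega>. F (X n \<omega>)) - integral\<^sup>L (M n) (\<lambda>\<omega>. F (psi (state_code (X n \<omega> 0))))) \<longlonglongrightarrow> 0"
proof (rule tendstoI)
  fix e :: real assume e: "e > 0"
  obtain B where B: "B > 0" "\<And>x. x \<in> D_U \<Longrightarrow> \<bar>F x\<bar> \<le> B" using skor_bcont_bounded[OF F] by blast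
  have "e / 2 > 0" using e by simp
  then obtain \<eta> T where \<eta>T: "\<eta> > 0" "T > 0"
    "\<And>s y. 0 \<le> s \<Longrightarrow> s \<le> 1 \<Longrightarrow> y \<in> D_U \<Longrightarrow> (\<And>t. 0 \<le> t \<Longrightarrow> t < T \<Longrightarrow> rho (y t) (psi s t) \<le> \<eta>) \<Longrightarrow> \<bar>F y - F (psi s)\<bar> < e / 2"
    using skor_bcont_uniform_on_psi[OF F] by metis
  \<comment> \<open>The bad event then costs at most \<open>2 * B * e' = e / 4\<close>, which
    together with \<open>e / 2\<close> stays below \<open>e\<close>.\<close>
  define e' where "e' = e / (8 * B)"
  have e': "e' > 0" using e B by (simp add: e'_def)
  obtain n0 where n0: "\<And>n (M :: 'a measure) X. n \<ge> n0 \<Longrightarrow> n \<ge> 1 \<Longrightarrow> is_LCQ_process n lam q d M X \<Longrightarrow>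
    \<exists>G\<in>sets M. 1 - e' \<le> measure M G \<and> (\<forall>\<omega>\<in>G. \<forall>t. 0 \<le> t \<longrightarrow> t < T \<longrightarrow> rho (X \<omega> t) (flow (X \<omega> 0) t) \<le> \<eta>)"
    using process_tracks_flow[OF q \<eta>T(1,2) e'] by metis
  have "dist (integral\<^sup>L (M n) (\<lambda>\<omega>. F (X n \<omega>)) - integral\<^sup>L (M n) (\<lambda>\<omega>. F (psi (state_code (X n \<omega> 0))))) 0 < e"
    if n: "n \<ge> max n0 1" for n
  proof -
    have p: "is_LCQ_process n lam q d (M n) (X n)" using proc n by simp
    interpret M: prob_space "M n" using p by (simp add: is_LCQ_process_def)
    have X: "(\<lambda>\<omega>. X n \<omega> t k) \<in> borel_measurable (M n)" for t k using p by (simp add: is_LCQ_process_def)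
    have D: "X n \<omega> \<in> D_U" if "\<omega> \<in> space (M n)" for \<omega> using p that by (simp add: is_LCQ_process_def)
    have U: "X n \<omega> 0 \<in> U_set" if "\<omega> \<in> space (M n)" for \<omega> using D[OF that] by (simp add: D_U_def)
    obtain G where G: "G \<in> sets (M n)" "1 - e' \<le> measure (M n) G"
      "\<And>\<omega> t. \<omega> \<in> G \<Longrightarrow> 0 \<le> t \<Longrightarrow> t < T \<Longrightarrow> rho (X n \<omega> t) (flow (X n \<omega> 0) t) \<le> \<eta>"
      using n0[OF _ _ p] n by auto
    have m1: "(\<lambda>\<omega>. F (X n \<omega>)) \<in> borel_measurable (M n)" by (rule skor_bcont_measurable[OF X D F])
    have "(\<lambda>s. F (psi s)) \<in> borel_measurable borel"
      using isCont_psi[OF F] by (intro borel_measurable_continuous_onI continuous_at_imp_continuous_on) auto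
    then have m2: "(\<lambda>\<omega>. F (psi (state_code (X n \<omega> 0)))) \<in> borel_measurable (M n)"
      by (rule measurable_compose[OF state_code_measurable[OF X]])
    have i1: "integrable (M n) (\<lambda>\<omega>. F (X n \<omega>))"
      by (rule M.integrable_const_bound[where B=B]) (use m1 B D in auto)
    have i2: "integrable (M n) (\<lambda>\<omega>. F (psi (state_code (X n \<omega> 0))))"
      by (rule M.integrable_const_bound[where B=B]) (use m2 B psi_D_U in auto)
    have iG: "integrable (M n) (indicat_real (space (M n) - G))"
      by (rule integrable_real_indicator) (use G(1) in \<open>auto simp: M.emeasure_eq_measure\<close>)
    have "\<bar>integral\<^sup>L (M n) (\<lambda>\<omega>. F (X n \<omega>)) - integral\<^sup>L (M n) (\<lambda>\<omega>. F (psi (state_code (X n \<omega> 0))))\<bar>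
       = \<bar>integral\<^sup>L (M n) (\<lambda>\<omega>. F (X n \<omega>) - F (psi (state_code (X n \<omega> 0))))\<bar>"
      using i1 i2 by simp
    also have "\<dots> \<le> integral\<^sup>L (M n) (\<lambda>\<omega>. \<bar>F (X n \<omega>) - F (psi (state_code (X n \<omega> 0)))\<bar>)"
      by (rule integral_abs_bound)
    also have "\<dots> \<le> integral\<^sup>L (M n) (\<lambda>\<omega>. e / 2 + (2 * B) * indicator (space (M n) - G) \<omega>)"
    proof (rule integral_mono)
      show "integrable (M n) (\<lambda>\<omega>. \<bar>F (X n \<omega>) - F (psi (state_code (X n \<omega> 0)))\<bar>)"
        using i1 i2 by (intro integrable_abs Bochner_Integration.integrable_diff)
      show "integrable (M n) (\<lambda>\<omega>. e / 2 + (2 * B) * indicator (space (M n) - G) \<omega>)"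
        using iG by (intro Bochner_Integration.integrable_add integrable_mult_right) auto
      fix \<omega> assume \<omega>: "\<omega> \<in> space (M n)"
      show "\<bar>F (X n \<omega>) - F (psi (state_code (X n \<omega> 0)))\<bar> \<le> e / 2 + (2 * B) * indicator (space (M n) - G) \<omega>"
      proof (cases "\<omega> \<in> G")
        case True
        have "\<bar>F (X n \<omega>) - F (psi (state_code (X n \<omega> 0)))\<bar> < e / 2"
          using G(3)[OF True] by (intro \<eta>T(3) D \<omega> state_code_bounds) (simp add: psi_state_code U[OF \<omega>])
        then show ?thesis using True by simp
      next
        case False
        have "\<bar>F (X n \<omega>)\<bar> \<le> B" "\<bar>F (psi (state_code (X n \<omega> 0)))\<bar> \<le> B" using B(2) D[OF \<omega>] psi_D_U by auto
        then show ?thesis using False \<omega> e by (simp add: abs_le_iff)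
      qed
    qed
    also have "\<dots> = e / 2 + (2 * B) * measure (M n) (space (M n) - G)"
      using iG G(1) by (subst Bochner_Integration.integral_add) (auto simp: M.prob_space)
    also have "measure (M n) (space (M n) - G) \<le> e'" using M.prob_compl[OF G(1)] G(2) by simp
    also have "e / 2 + (2 * B) * e' < e" using B(1) e by (simp add: e'_def)
    finally show ?thesis using B(1) by (simp add: dist_real_def mult_left_mono)
  qed
  then show "eventually (\<lambda>n. dist (integral\<^sup>L (M n) (\<lambda>\<omega>. F (X n \<omega>)) - integral\<^sup>L (M n) (\<lambda>\<omega>. F (psi (state_code (X n \<omega> 0))))) 0 < e) sequentially"
    unfolding eventually_sequentially by blast
qed

text \<open>With the largest \<open>\<sigma>\<close>-algebra on the orbits that makes the parametrization measurable, a functional is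
  measurable as soon as it depends continuously on the parameter.\<close>

definition psi_algebra :: "(real \<Rightarrow> nat \<Rightarrow> real) measure" where
  "psi_algebra = sigma (range psi) {A. A \<subseteq> range psi \<and> psi -` A \<in> sets borel}"

lemma space_psi_algebra: "space psi_algebra = range psi"
  unfolding psi_algebra_def by (rule space_measure_of) auto

lemma sets_psi_algebra: "sets psi_algebra = {A. A \<subseteq> range psi \<and> psi -` A \<in> sets borel}"
proof -
  have "sigma_algebra (range psi) {A. A \<subseteq> range psi \<and> psi -` A \<in> sets borel}"
    unfolding sigma_algebra_iff2
  proof (intro conjI ballI allI impI)
    fix A assume "A \<in> {A. A \<subseteq> range psi \<and> psi -` A \<in> sets borel}"
    moreover have "psi -` (range psi - A) = UNIV - psi -` A" by auto
    ultimately show "range psi - A \<in> {A. A \<subseteq> range psi \<and> psi -` A \<in> sets borel}" by auto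
  next
    fix A :: "nat \<Rightarrow> _" assume "range A \<subseteq> {A. A \<subseteq> range psi \<and> psi -` A \<in> sets borel}"
    then show "\<Union> (range A) \<in> {A. A \<subseteq> range psi \<and> psi -` A \<in> sets borel}"
      by (auto simp: vimage_UN image_subset_iff)
  qed auto
  then show ?thesis unfolding psi_algebra_def by (rule sigma_algebra.sets_measure_of_eq)
qed

lemma measurable_psi: "psi \<in> measurable borel psi_algebra"
  by (rule measurableI) (auto simp: space_psi_algebra sets_psi_algebra)

lemma measurable_psi_algebra:
  fixes g :: "(real \<Rightarrow> nat \<Rightarrow> real) \<Rightarrow> real"
  assumes "(\<lambda>s. g (psi s)) \<in> borel_measurable borel"
  shows "g \<in> borel_measurable psi_algebra"
proof (rule measurableI)
  fix A :: "real set" assume "A \<in> sets borel"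
  then have "(\<lambda>s. g (psi s)) -` A \<inter> space borel \<in> sets borel" by (rule measurable_sets[OF assms])
  moreover have "psi -` (g -` A \<inter> range psi) = (\<lambda>s. g (psi s)) -` A" by auto
  ultimately show "g -` A \<inter> space psi_algebra \<in> sets psi_algebra"
    by (simp add: space_psi_algebra sets_psi_algebra)
qed simp

end

theorem theorem3p1:
  fixes lam q :: real and d :: nat
    and M :: "nat \<Rightarrow> 'a measure" and X :: "nat \<Rightarrow> 'a \<Rightarrow> real \<Rightarrow> nat \<Rightarrow> real"
  assumes "d \<ge> 1" and "0 < lam" and "lam < 1" and "0 < q" and "q \<le> 1"
    and "\<And>n. n \<ge> 1 \<Longrightarrow> is_LCQ_process n lam q d (M n) (X n)"
  shows "\<forall>\<sigma>. strict_mono \<sigma> \<and> (\<forall>i. 1 \<le> \<sigma> i) \<longrightarrow>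
     (\<exists>\<tau>::nat \<Rightarrow> nat. strict_mono \<tau> \<and>
       (\<exists>N :: (real \<Rightarrow> nat \<Rightarrow> real) measure.
          prob_space N
        \<and> (\<forall>t k. (\<lambda>\<omega>. \<omega> t k) \<in> borel_measurable N)
        \<and> (\<forall>\<omega>\<in>space N. \<omega> \<in> D_U \<and> (\<forall>t\<ge>0. \<omega> t 0 = 1)
             \<and> (\<forall>k\<ge>1. \<forall>t\<ge>0. ((\<lambda>s. \<omega> s k) has_real_derivative
                   (lam * (\<omega> t (k - 1) - \<omega> t k) - (1 - \<omega> t (k + 1)) ^ d + (1 - \<omega> t k) ^ d))
                   (at t within {0..})))
        \<and> (\<forall>F. skor_bcont F \<longrightarrow>
             (\<lambda>i. integral\<^sup>L (M (\<sigma> (\<tau> i))) (\<lambda>\<omega>. F (X (\<sigma> (\<tau> i)) \<omega>)))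
               \<longlonglongrightarrow> integral\<^sup>L N F)))"
proof (intro allI impI)
  fix \<sigma> :: "nat \<Rightarrow> nat" assume \<sigma>: "strict_mono \<sigma> \<and> (\<forall>i. 1 \<le> \<sigma> i)"
  interpret lcq_flow lam d by unfold_locales fact+
  have proc: "is_LCQ_process (\<sigma> i) lam q d (M (\<sigma> i)) (X (\<sigma> i))" for i using assms(6) \<sigma> by blast
  have prob: "prob_space (M (\<sigma> i))" for i using proc by (simp add: is_LCQ_process_def)
  have code: "(\<lambda>\<omega>. state_code (X (\<sigma> i) \<omega> 0)) \<in> borel_measurable (M (\<sigma> i))" for i
    by (rule state_code_measurable) (use proc in \<open>simp add: is_LCQ_process_def\<close>)
  \<comment> \<open>The initial laws moved to the line. They live on [0, 1], so tightness is
    automatic.\<close>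
  define \<nu> where "\<nu> i = distr (M (\<sigma> i)) borel (\<lambda>\<omega>. state_code (X (\<sigma> i) \<omega> 0))" for i
  have \<nu>: "real_distribution (\<nu> i)" for i
    unfolding \<nu>_def by (rule prob_space.real_distribution_distr[OF prob code])
  have "tight \<nu>" unfolding tight_def
  proof (intro conjI allI impI \<nu>)
    fix \<epsilon> :: real assume \<epsilon>: "\<epsilon> > 0"
    have bnd: "- 1 < state_code u \<and> state_code u \<le> 1" for u using state_code_bounds[of u] by linarith
    have "measure (\<nu> i) {-1<..1} = 1" for i
    proof -
      have "(\<lambda>\<omega>. state_code (X (\<sigma> i) \<omega> 0)) -` {-1<..1} \<inter> space (M (\<sigma> i)) = space (M (\<sigma> i))"
        using bnd by auto
      then show ?thesis unfolding \<nu>_def using code prob_space.prob_space[OF prob] by (subst measure_distr) auto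
    qed
    then show "\<exists>a b::real. a < b \<and> (\<forall>i. measure (\<nu> i) {a<..b} > 1 - \<epsilon>)"
      using \<epsilon> by (intro exI[of _ "-1"] exI[of _ 1]) auto
  qed
  from tight_imp_convergent_subsubsequence[OF this strict_mono_id]
  obtain \<tau> \<nu>' where \<tau>: "strict_mono (\<tau> :: nat \<Rightarrow> nat)" and \<nu>': "real_distribution \<nu>'"
    and weak: "weak_conv_m (\<lambda>i. \<nu> (\<tau> i)) \<nu>'"
    by (auto simp: comp_def)
  interpret \<nu>': real_distribution \<nu>' by fact
  \<comment> \<open>The trajectory whose start has coded law \<nu>'. The weak limit may charge
    points that are not codes, and there \<open>param_U\<close> still yields a state.\<close>
  define N where "N = distr \<nu>' psi_algebra psi"
  have mpsi: "psi \<in> measurable \<nu>' psi_algebra"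
    using measurable_psi by (simp add: measurable_cong_sets[OF \<nu>'.events_eq_borel refl])
  have Nmeas: "g \<in> borel_measurable N" if "(\<lambda>s. g (psi s)) \<in> borel_measurable borel" for g :: "_ \<Rightarrow> real"
    using measurable_psi_algebra[OF that] by (simp add: N_def)
  have "prob_space N" unfolding N_def by (rule \<nu>'.prob_space_distr[OF mpsi])
  moreover have "(\<lambda>\<omega>. \<omega> t k) \<in> borel_measurable N" for t k
    by (rule Nmeas[OF borel_measurable_continuous_onI[OF continuous_psi]])
  moreover have "\<omega> \<in> D_U \<and> (\<forall>t\<ge>0. \<omega> t 0 = 1)
       \<and> (\<forall>k\<ge>1. \<forall>t\<ge>0. ((\<lambda>s. \<omega> s k) has_real_derivative
             (lam * (\<omega> t (k - 1) - \<omega> t k) - (1 - \<omega> t (k + 1)) ^ d + (1 - \<omega> t k) ^ d)) (at t within {0..}))"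
    if \<omega>N: "\<omega> \<in> space N" for \<omega>
  proof -
    \<comment> \<open>The space of \<open>N\<close> is the range of \<open>psi\<close>, so each of
      its points is a trajectory of the flow, without exceptional null sets.\<close>
    obtain s where \<omega>: "\<omega> = psi s" using \<omega>N by (auto simp: N_def space_psi_algebra)
    have "((\<lambda>r. psi s r k) has_real_derivative
        (lam * (psi s t (k - 1) - psi s t k) - (1 - psi s t (k + 1)) ^ d + (1 - psi s t k) ^ d)) (at t within {0..})"
      if "k \<ge> 1" "t \<ge> 0" for k t
      using flow_has_derivative[OF param_U_in_U[of s] that(2,1)]
      by (simp add: psi_def lcq_drift_def algebra_simps)
    then show ?thesis unfolding \<omega> using psi_D_U U_set_0[OF psi_U] by blast
  qed
  moreover have "(\<lambda>i. integral\<^sup>L (M (\<sigma> (\<tau> i))) (\<lambda>\<omega>. F (X (\<sigma> (\<tau> i)) \<omega>))) \<longlonglongrightarrow> integral\<^sup>L N F"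
    if F: "skor_bcont F" for F
  proof -
    obtain B where B: "\<And>x. x \<in> D_U \<Longrightarrow> \<bar>F x\<bar> \<le> B" using skor_bcont_bounded[OF F] by blast
    have Fpsi: "(\<lambda>s. F (psi s)) \<in> borel_measurable borel"
      using isCont_psi[OF F] by (intro borel_measurable_continuous_onI continuous_at_imp_continuous_on) auto
    \<comment> \<open>Weak convergence tests bounded continuous functions of the real parameter, and
      \<open>isCont_psi\<close> makes \<open>F\<close> composed with \<open>psi\<close> one of
      them.\<close>
    have "(\<lambda>i. integral\<^sup>L (\<nu> (\<tau> i)) (\<lambda>s. F (psi s))) \<longlonglongrightarrow> integral\<^sup>L \<nu>' (\<lambda>s. F (psi s))"
      by (rule weak_conv_imp_integral_bdd_continuous_conv[OF \<nu> \<nu>' weak])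
        (use isCont_psi[OF F] B psi_D_U in auto)
    moreover have "integral\<^sup>L (\<nu> (\<tau> i)) (\<lambda>s. F (psi s))
        = integral\<^sup>L (M (\<sigma> (\<tau> i))) (\<lambda>\<omega>. F (psi (state_code (X (\<sigma> (\<tau> i)) \<omega> 0))))" for i
      unfolding \<nu>_def by (rule integral_distr[OF code Fpsi])
    moreover have "integral\<^sup>L \<nu>' (\<lambda>s. F (psi s)) = integral\<^sup>L N F"
      unfolding N_def by (rule integral_distr[symmetric, OF mpsi measurable_psi_algebra[OF Fpsi]])
    moreover have "(\<lambda>i. integral\<^sup>L (M (\<sigma> (\<tau> i))) (\<lambda>\<omega>. F (X (\<sigma> (\<tau> i)) \<omega>))
        - integral\<^sup>L (M (\<sigma> (\<tau> i))) (\<lambda>\<omega>. F (psi (state_code (X (\<sigma> (\<tau> i)) \<omega> 0))))) \<longlonglongrightarrow> 0"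
    proof -
      have "strict_mono (\<sigma> \<circ> \<tau>)" using \<sigma> \<tau> by (intro strict_mono_o) auto
      from LIMSEQ_subseq_LIMSEQ[OF functional_tracks_flow[OF assms(4,5) F assms(6)] this]
      show ?thesis by (simp add: comp_def)
    qed
    ultimately show ?thesis using tendsto_add by fastforce
  qed
  ultimately show "\<exists>\<tau>::nat \<Rightarrow> nat. strict_mono \<tau> \<and>
       (\<exists>N :: (real \<Rightarrow> nat \<Rightarrow> real) measure.
          prob_space N
        \<and> (\<forall>t k. (\<lambda>\<omega>. \<omega> t k) \<in> borel_measurable N)
        \<and> (\<forall>\<omega>\<in>space N. \<omega> \<in> D_U \<and> (\<forall>t\<ge>0. \<omega> t 0 = 1)
             \<and> (\<forall>k\<ge>1. \<forall>t\<ge>0. ((\<lambda>s. \<omega> s k) has_real_derivative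
                   (lam * (\<omega> t (k - 1) - \<omega> t k) - (1 - \<omega> t (k + 1)) ^ d + (1 - \<omega> t k) ^ d))
                   (at t within {0..})))
        \<and> (\<forall>F. skor_bcont F \<longrightarrow>
             (\<lambda>i. integral\<^sup>L (M (\<sigma> (\<tau> i))) (\<lambda>\<omega>. F (X (\<sigma> (\<tau> i)) \<omega>)))
               \<longlonglongrightarrow> integral\<^sup>L N F))"
    using \<tau> by blast
qed

end
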